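(* Let $p,n_x,n_y\ge 1$, $n=n_x+n_y$, and let $\boldsymbol\theta=(A,\Sigma)\in\Theta_0$ be the parameters of a stable $n$-dimensional VAR($p$) model satisfying the null hypothesis $H_0: A_{k,xy}=0$ for all $k=1,\ldots,p$. Let $\mathcal F\subseteq[0,2\pi]$ be a measurable frequency range of positive Lebesgue measure $|\mathcal F|$, and let $\hat f_{Y\to X}(\mathcal F;\boldsymbol\theta)=f_{Y\to X}(\mathcal F;\hat{\boldsymbol\theta})$ be the single-regression band-limited Granger causality estimator computed from the maximum-likelihood VAR($p$) parameter estimate $\hat{\boldsymbol\theta}$ for a data sequence of length $N$ from the model with true parameter $\boldsymbol\theta$. Then, as $N\to\infty$, $$N\,\hat f_{Y\to X}(\mathcal F;\boldsymbol\theta)\ \xrightarrow{\ d\ }\ \chi^2\!\left(I_{xx}\otimes\mathrm{Re}\{\mathbf S_{yy|x}(\mathcal F)\},\ I_{xx}\otimes[\boldsymbol\Gamma^{-1}]_{yy}\right),$$ where $I_{xx}$ is the $n_x\times n_x$ identity matrix, $\boldsymbol\Gamma$ is the solution of $\boldsymbol\Gamma-\mathbf A\boldsymbol\Gamma\mathbf A^T=\boldsymbol\Sigma$, and $\mathbf S_{yy|x}(\mathcal F)$ is the $pn_y\times pn_y$ matrix $$\mathbf S_{yy|x}(\mathcal F)=\frac1{|\mathcal F|}\int_{\mathcal F}\mathbf S_{yy|x}(\omega)\,d\omega,\qquad [\mathbf S_{yy|x}(\omega)]_{kk',vv'}=[S_{yy|x}(\omega)]_{vv'}\,e^{-i\omega(k-k')},\qquad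 S_{yy|x}(\omega)=\Psi_{yy}(\omega)\Sigma_{yy|x}\Psi_{yy}(\omega)^*,$$ with $k,k'=1,\ldots,p$ indexing blocks and $v,v'\in y$ indexing entries within the blocks.
   Context: **VAR model.** $U_t=\sum_{k=1}^pA_kU_{t-k}+\varepsilon_t$, $-\infty<t<\infty$, is a wide-sense stationary $n$-dimensional process, with $A_k$ real $n\times n$ matrices and $\varepsilon_t$ Gaussian white noise with positive-definite covariance matrix $\Sigma$. Write $A=[A_1\ \ldots\ A_p]$. The model is stable: all eigenvalues of the $pn\times pn$ companion matrix $$\mathbf A=\begin{bmatrix}A_1&A_2&\cdots&A_{p-1}&A_p\\ I&0&\cdots&0&0\\ 0&I&\cdots&0&0\\ \vdots&&\ddots&&\vdots\\ 0&0&\cdots&I&0\end{bmatrix}$$ have modulus $<1$. $\Theta$ is the set of all such $\boldsymbol\theta=(A,\Sigma)$ (stable, $\Sigma$ positive-definite). The model order $p$ is known. **Partition.** $U_t=[X_t^T\ Y_t^T]^T$ with $X_t$ of dimension $n_x$ and $Y_t$ of dimension $n_y$; subscripts $x$ and $y$ denote the index sets $\{1,\ldots,n_x\}$ and $\{n_x+1,\ldots,n\}$, so that $A_{k,xy}$, $\Sigma_{xx}$, etc. are the corresponding submatrices. $\Theta_0=\{\boldsymbol\theta\in\Theta: A_{1,xy}=\cdots=A_{p,xy}=0\}$. **Spectral quantities.** $\Phi(\omega)=I-\sum_{k=1}^pA_ke^{-i\omega k}$, $\Psi(\omega)=\Phi(\omega)^{-1}$ (transfer function), $S(\omega)=\Psi(\omega)\Sigma\Psi(\omega)^*$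 (cross-power spectral density), with $*$ the conjugate transpose. $\Sigma_{yy|x}=\Sigma_{yy}-\Sigma_{yx}[\Sigma_{xx}]^{-1}\Sigma_{xy}$. The spectral Granger causality at angular frequency $\omega\in[0,2\pi]$ is $$f_{Y\to X}(\omega;\boldsymbol\theta)=\log\frac{|S_{xx}(\omega)|}{|S_{xx}(\omega)-\Psi_{xy}(\omega)\Sigma_{yy|x}\Psi_{xy}(\omega)^*|}$$ (with $|\cdot|$ the determinant), and the band-limited Granger causality is $f_{Y\to X}(\mathcal F;\boldsymbol\theta)=\frac1{|\mathcal F|}\int_{\mathcal F}f_{Y\to X}(\omega;\boldsymbol\theta)\,d\omega$. **Estimator.** Given data $u_1,\ldots,u_N$ from the model, $\hat{\boldsymbol\theta}=(\hat A,\hat\Sigma)$ is the maximum-likelihood estimate, obtained by ordinary least squares regression of $u_t$ on $u_{t-1},\ldots,u_{t-p}$, with $\hat\Sigma$ the sample covariance of the residuals. The estimator is $f_{Y\to X}(\mathcal F;\hat{\boldsymbol\theta})$ (on the event $\hat{\boldsymbol\theta}\notin\Theta$, whose probability tends to $0$, its value is immaterial). **Matrices.** $\boldsymbol\Sigma$ is the $pn\times pn$ matrix, in $p\times p$ blocks of size $n\times n$, with $(1,1)$ block $\Sigma$ and all other blocks zero. $[\boldsymbol\Gamma^{-1}]_{yy}$ is the $pn_y\times pn_y$ matrix obtained from $\boldsymbol\Gamma^{-1}$, viewed as a $p\times p$ array of $n\times n$ blocks, by taking the $yy$ submatrix of every block. $\mathrm{Re}$ is the entrywise real part. **Generalised $\chi^2$.**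 For $B$ an $m\times m$ covariance matrix and $A$ an $m\times m$ symmetric matrix, $\chi^2(A,B)$ denotes the distribution of $Z^TAZ$ with $Z\sim\mathcal N(0,B)$. $\otimes$ is the Kronecker product and $\xrightarrow{d}$ is convergence in distribution. *)

theory Defs
  imports "HOL-Probability.Probability"
begin

section \<open>Matrices\<close>

text \<open>
  A vector or matrix index of type \<^typ>\<open>'x + 'y\<close> splits into an \<open>x\<close>-part (left injection) and
  a \<open>y\<close>-part (right injection).
\<close>

definition sub_xx :: "'a^('x::finite + 'y::finite)^('x + 'y) \<Rightarrow> 'a^'x^'x" where
  "sub_xx M = (\<chi> i j. M $ Inl i $ Inl j)"

definition sub_xy :: "'a^('x::finite + 'y::finite)^('x + 'y) \<Rightarrow> 'a^'y^'x" where
  "sub_xy M = (\<chi> i j. M $ Inl i $ Inr j)"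

definition sub_yx :: "'a^('x::finite + 'y::finite)^('x + 'y) \<Rightarrow> 'a^'x^'y" where
  "sub_yx M = (\<chi> i j. M $ Inr i $ Inl j)"

definition sub_yy :: "'a^('x::finite + 'y::finite)^('x + 'y) \<Rightarrow> 'a^'y^'y" where
  "sub_yy M = (\<chi> i j. M $ Inr i $ Inr j)"

definition cmat :: "real^'n^'m \<Rightarrow> complex^'n^'m" where
  "cmat M = (\<chi> i j. complex_of_real (M $ i $ j))"

definition Re_mat :: "complex^'n^'m \<Rightarrow> real^'n^'m" where
  "Re_mat M = (\<chi> i j. Re (M $ i $ j))"

definition ctranspose :: "complex^'n^'m \<Rightarrow> complex^'m^'n" where
  "ctranspose M = (\<chi> i j. cnj (M $ j $ i))"

definition kron :: "('a::times)^'n::finite^'m::finite \<Rightarrow> 'a^'q::finite^'p::finite \<Rightarrow> 'a^('n \<times> 'q)^('m \<times> 'p)" where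
  "kron M N = (\<chi> a b. M $ fst a $ fst b * N $ snd a $ snd b)"

definition pos_definite :: "real^'n^'n \<Rightarrow> bool" where
  "pos_definite M \<longleftrightarrow> transpose M = M \<and> (\<forall>v. v \<noteq> 0 \<longrightarrow> v \<bullet> (M *v v) > 0)"

definition is_eigenvalue :: "complex^'n^'n \<Rightarrow> complex \<Rightarrow> bool" where
  "is_eigenvalue M c \<longleftrightarrow> (\<exists>v. v \<noteq> 0 \<and> M *v v = c *s v)"

definition outer :: "real^'m \<Rightarrow> real^'n \<Rightarrow> real^'n^'m" where
  "outer u v = (\<chi> i j. u $ i * v $ j)"


section \<open>Gaussian and generalised chi-squared laws\<close>

definition std_mvnormal :: "(real^'m) measure" where
  "std_mvnormal = density lborel (\<lambda>z. ennreal (\<Prod>i\<in>UNIV. std_normal_density (z $ i)))"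

text \<open>
  The law \<open>N(0, B)\<close> for a symmetric positive semidefinite \<open>B\<close>, possibly singular: the law of
  \<open>L W\<close> with \<open>W\<close> standard normal and \<open>L L\<^sup>T = B\<close>. Such a square \<open>L\<close> exists for every covariance
  matrix \<open>B\<close>, and the law does not depend on which one is chosen.
\<close>

definition mvnormal :: "real^'m^'m \<Rightarrow> (real^'m) measure" where
  "mvnormal B = distr std_mvnormal borel (\<lambda>w. (SOME L :: real^'m^'m. L ** transpose L = B) *v w)"

definition gen_chi2 :: "real^'m^'m \<Rightarrow> real^'m^'m \<Rightarrow> real measure" where
  "gen_chi2 A B = distr (mvnormal B) borel (\<lambda>z. z \<bullet> (A *v z))"


section \<open>Vector autoregressive models\<close>

text \<open>
  Lags are indexed by a finite linearly ordered type \<^typ>\<open>'p\<close>, whose elements are numbered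
  \<open>1, \<dots>, p\<close> in increasing order, with \<open>p = CARD('p)\<close>.
\<close>

definition lag :: "'p::{finite,linorder} \<Rightarrow> nat" where
  "lag k = card {..k}"

type_synonym ('p, 'n) var_coeffs = "real^'n^'n^'p"

definition companion ::
  "('p::{finite,linorder}, 'n::finite) var_coeffs \<Rightarrow> real^('p \<times> 'n)^('p \<times> 'n)" where
  "companion A = (\<chi> a b.
     if lag (fst a) = 1 then A $ fst b $ snd a $ snd b
     else if lag (fst a) = lag (fst b) + 1 \<and> snd a = snd b then 1 else 0)"

text \<open>The covariance matrix placed in the \<open>(1,1)\<close> block, zero elsewhere.\<close>

definition corner_block ::
  "real^'n::finite^'n \<Rightarrow> real^('p::{finite,linorder} \<times> 'n)^('p \<times> 'n)" where
  "corner_block S = (\<chi> a b.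
     if lag (fst a) = 1 \<and> lag (fst b) = 1 then S $ snd a $ snd b else 0)"

definition var_stable :: "('p::{finite,linorder}, 'n::finite) var_coeffs \<Rightarrow> bool" where
  "var_stable A \<longleftrightarrow> (\<forall>c. is_eigenvalue (cmat (companion A)) c \<longrightarrow> cmod c < 1)"

definition var_params :: "(('p::{finite,linorder}, 'n::finite) var_coeffs \<times> (real^'n^'n)) set" where
  "var_params = {(A, S). var_stable A \<and> pos_definite S}"

definition null_params ::
  "(('p::{finite,linorder}, 'x::finite + 'y::finite) var_coeffs \<times> (real^('x + 'y)^('x + 'y))) set"
where
  "null_params = {(A, S). (A, S) \<in> var_params \<and> (\<forall>k. sub_xy (A $ k) = 0)}"

definition var_predict ::
  "('p::{finite,linorder}, 'n::finite) var_coeffs \<Rightarrow> (int \<Rightarrow> real^'n) \<Rightarrow> int \<Rightarrow> real^'n" where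
  "var_predict A u t = (\<Sum>k\<in>UNIV. A $ k *v u (t - int (lag k)))"

definition wide_sense_stationary :: "'a measure \<Rightarrow> (int \<Rightarrow> 'a \<Rightarrow> real^'n) \<Rightarrow> bool" where
  "wide_sense_stationary M U \<longleftrightarrow>
     (\<forall>t. U t \<in> borel_measurable M \<and> integrable M (\<lambda>\<omega>. (norm (U t \<omega>))\<^sup>2)) \<and>
     (\<exists>m. (\<forall>t. (LINT \<omega>|M. U t \<omega>) = m) \<and>
          (\<forall>s t h. (LINT \<omega>|M. outer (U (s + h) \<omega> - m) (U (t + h) \<omega> - m)) =
                   (LINT \<omega>|M. outer (U s \<omega> - m) (U t \<omega> - m))))"

definition gaussian_white_noise ::
  "'a measure \<Rightarrow> (int \<Rightarrow> 'a \<Rightarrow> real^'n) \<Rightarrow> real^'n^'n \<Rightarrow> bool" where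
  "gaussian_white_noise M e S \<longleftrightarrow>
     prob_space.indep_vars M (\<lambda>_. borel) e UNIV \<and>
     (\<forall>t. distr M borel (e t) = mvnormal S)"

definition var_process ::
  "'a measure \<Rightarrow> ('p::{finite,linorder}, 'n::finite) var_coeffs \<Rightarrow> real^'n^'n \<Rightarrow>
   (int \<Rightarrow> 'a \<Rightarrow> real^'n) \<Rightarrow> (int \<Rightarrow> 'a \<Rightarrow> real^'n) \<Rightarrow> bool" where
  "var_process M A S U e \<longleftrightarrow>
     prob_space M \<and> wide_sense_stationary M U \<and> gaussian_white_noise M e S \<and>
     (\<forall>t. AE \<omega> in M. U t \<omega> = var_predict A (\<lambda>s. U s \<omega>) t + e t \<omega>)"


section \<open>Least squares estimation\<close>

text \<open>
  From data \<open>u\<^sub>1, \<dots>, u\<^sub>N\<close> the regression uses the times \<open>t = p + 1, \<dots>, N\<close> at which all \<open>p\<close>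
  lagged values are available. Only the values of \<open>u\<close> on \<open>{1..N}\<close> enter.
\<close>

definition rss ::
  "nat \<Rightarrow> (int \<Rightarrow> real^'n) \<Rightarrow> ('p::{finite,linorder}, 'n::finite) var_coeffs \<Rightarrow> real" where
  "rss N u A = (\<Sum>t\<in>{int CARD('p) + 1..int N}. (norm (u t - var_predict A u t))\<^sup>2)"

definition is_ols ::
  "nat \<Rightarrow> (int \<Rightarrow> real^'n) \<Rightarrow> ('p::{finite,linorder}, 'n::finite) var_coeffs \<Rightarrow> bool" where
  "is_ols N u A \<longleftrightarrow> (\<forall>B :: ('p, 'n) var_coeffs. rss N u A \<le> rss N u B)"

definition resid_cov ::
  "nat \<Rightarrow> (int \<Rightarrow> real^'n) \<Rightarrow> ('p::{finite,linorder}, 'n::finite) var_coeffs \<Rightarrow> real^'n^'n" where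
  "resid_cov N u A = (1 / (real N - real CARD('p))) *\<^sub>R
     (\<Sum>t\<in>{int CARD('p) + 1..int N}.
        outer (u t - var_predict A u t) (u t - var_predict A u t))"


section \<open>Spectral quantities\<close>

definition var_Phi ::
  "('p::{finite,linorder}, 'n::finite) var_coeffs \<Rightarrow> real \<Rightarrow> complex^'n^'n" where
  "var_Phi A \<omega> = mat 1 -
     (\<Sum>k\<in>UNIV. \<chi> i j. complex_of_real (A $ k $ i $ j) * exp (- \<i> * of_real \<omega> * of_nat (lag k)))"

definition transfer ::
  "('p::{finite,linorder}, 'n::finite) var_coeffs \<Rightarrow> real \<Rightarrow> complex^'n^'n" where
  "transfer A \<omega> = matrix_inv (var_Phi A \<omega>)"

definition cpsd ::
  "('p::{finite,linorder}, 'n::finite) var_coeffs \<Rightarrow> real^'n^'n \<Rightarrow> real \<Rightarrow> complex^'n^'n" where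
  "cpsd A S \<omega> = transfer A \<omega> ** cmat S ** ctranspose (transfer A \<omega>)"

definition partial_cov :: "real^('x::finite + 'y::finite)^('x + 'y) \<Rightarrow> real^'y^'y" where
  "partial_cov S = sub_yy S - sub_yx S ** matrix_inv (sub_xx S) ** sub_xy S"

text \<open>
  Both matrices below are Hermitian, so their determinants are real; \<^const>\<open>Re\<close> only changes the
  type.
\<close>

definition spectral_gc ::
  "('p::{finite,linorder}, 'x::finite + 'y::finite) var_coeffs \<Rightarrow> real^('x + 'y)^('x + 'y) \<Rightarrow>
   real \<Rightarrow> real" where
  "spectral_gc A S \<omega> =
     (let Sxx = sub_xx (cpsd A S \<omega>); Pxy = sub_xy (transfer A \<omega>)
      in ln (Re (det Sxx) / Re (det (Sxx - Pxy ** cmat (partial_cov S) ** ctranspose Pxy))))"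

definition band_gc ::
  "real set \<Rightarrow> ('p::{finite,linorder}, 'x::finite + 'y::finite) var_coeffs \<Rightarrow>
   real^('x + 'y)^('x + 'y) \<Rightarrow> real" where
  "band_gc F A S = (1 / measure lebesgue F) * (LINT \<omega>:F|lebesgue. spectral_gc A S \<omega>)"

definition Syy_x ::
  "('p::{finite,linorder}, 'x::finite + 'y::finite) var_coeffs \<Rightarrow> real^('x + 'y)^('x + 'y) \<Rightarrow>
   real \<Rightarrow> complex^'y^'y" where
  "Syy_x A S \<omega> =
     sub_yy (transfer A \<omega>) ** cmat (partial_cov S) ** ctranspose (sub_yy (transfer A \<omega>))"

definition block_Syy_x ::
  "('p::{finite,linorder}, 'x::finite + 'y::finite) var_coeffs \<Rightarrow> real^('x + 'y)^('x + 'y) \<Rightarrow>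
   real \<Rightarrow> complex^('p \<times> 'y)^('p \<times> 'y)" where
  "block_Syy_x A S \<omega> = (\<chi> a b. Syy_x A S \<omega> $ snd a $ snd b *
     exp (- \<i> * of_real \<omega> * (of_nat (lag (fst a)) - of_nat (lag (fst b)))))"

definition band_block_Syy_x ::
  "real set \<Rightarrow> ('p::{finite,linorder}, 'x::finite + 'y::finite) var_coeffs \<Rightarrow>
   real^('x + 'y)^('x + 'y) \<Rightarrow> complex^('p \<times> 'y)^('p \<times> 'y)" where
  "band_block_Syy_x F A S =
     (1 / measure lebesgue F) *\<^sub>R (LINT \<omega>:F|lebesgue. block_Syy_x A S \<omega>)"

definition blocks_yy ::
  "'a^('p::finite \<times> ('x::finite + 'y::finite))^('p \<times> ('x + 'y)) \<Rightarrow> 'a^('p \<times> 'y)^('p \<times> 'y)" where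
  "blocks_yy G = (\<chi> a b. G $ (fst a, Inr (snd a)) $ (fst b, Inr (snd b)))"

end

theory Submission
  imports Defs "HOL-Computational_Algebra.Fundamental_Theorem_Algebra"
begin

text \<open>
  Under the null hypothesis \<open>\<Psi>\<^sub>x\<^sub>y\<close> is of first order in the estimated coefficients \<open>A\<^sub>x\<^sub>y\<close>, so the
  log-determinant ratio is, to second order and uniformly in the frequency, the quadratic form
  \<open>tr (\<Sigma>\<^sub>x\<^sub>x\<^sup>-\<^sup>1 A\<^sub>x\<^sub>y S\<^sub>y\<^sub>y\<^sub>|\<^sub>x A\<^sub>x\<^sub>y\<^sup>*)\<close>; integrating over the band gives the matrix \<open>Re S\<^sub>y\<^sub>y\<^sub>|\<^sub>x(F)\<close>.
  The scaled least squares error is the normalised score times the inverse sample covariance of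
  the state, which tends to \<open>\<Gamma>\<^sup>-\<^sup>1\<close>. For the score, Gaussian noise makes the stochastic exponential
  an exact martingale, which yields the central limit theorem; the unknown stationary start is
  exponentially forgotten, so it may be replaced by zero and needs no independence from the
  noise. Finally the Laplace transform of a quadratic form is a Gaussian average of
  characteristic functions, so convergence of the latter suffices.
\<close>

section \<open>Matrix norms and limits\<close>

text \<open>Three obstacles shape the proof. First, the estimator is only known to minimise the
  residual sum of squares; its normal equations express the scaled error through the score as soon
  as the sample state covariance is invertible, which happens with probability tending to one.
  Second, that sample covariance is handled by algebra: summing outer products along the state
  recursion telescopes, so it solves the equation of \<Gamma> up to terms that vanish in
  probability, and the map X - C X C^T is injective because powers of the stable companion matrix
  decay. Third, the exponential must stay bounded for its expectation to be compared with that of a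
  character; its coefficients are therefore switched off before their accumulated conditional
  variance would exceed a level above the limit, a decision that depends only on earlier noise. The
  identity factors of the two Kronecker products come from whitening: with H^T H = \<Sigma>_xx^-1,
  multiplying the x rows of the score by H turns both the weight \<Sigma>_xx^-1 of the quadratic
  form and the noise covariance \<Sigma>_xx into the identity.\<close>

lemma norm_vector_smult:
  fixes v :: "'a::real_normed_field^'n"
  shows "norm (c *s v) = norm c * norm v"
  by (simp add: norm_vec_def norm_mult L2_set_right_distrib)

text \<open>The norm of nested vectors is the Frobenius norm. Each row of the product is a
  combination of the rows of \<open>B\<close>, so Cauchy-Schwarz applies row by row.\<close>

lemma norm_matrix_mult_le:
  fixes A :: "'a::real_normed_field^'n^'m" and B :: "'a^'q^'n"
  shows "norm (A ** B) \<le> norm A * norm B"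
proof -
  have row: "norm ((A ** B) $ i) \<le> norm (A $ i) * norm B" for i
  proof -
    have "(A ** B) $ i = (\<Sum>k\<in>UNIV. A $ i $ k *s B $ k)"
      by (simp add: vec_eq_iff matrix_matrix_mult_def)
    also have "norm \<dots> \<le> (\<Sum>k\<in>UNIV. \<bar>norm (A $ i $ k)\<bar> * \<bar>norm (B $ k)\<bar>)"
      by (rule order_trans[OF norm_sum]) (simp add: norm_vector_smult)
    also have "\<dots> \<le> norm (A $ i) * norm B"
      unfolding norm_vec_def[of "A $ i"] norm_vec_def[of B] by (rule L2_set_mult_ineq)
    finally show ?thesis .
  qed
  have "norm (A ** B) \<le> L2_set (\<lambda>i. norm (A $ i) * norm B) UNIV"
    unfolding norm_vec_def[of "A ** B"] by (rule L2_set_mono) (auto intro: row)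
  also have "\<dots> = norm A * norm B"
    unfolding norm_vec_def[of A] by (simp add: L2_set_left_distrib)
  finally show ?thesis .
qed

lemma norm_matrix_vector_le:
  fixes A :: "'a::real_normed_field^'n^'m"
  shows "norm (A *v x) \<le> norm A * norm x"
proof -
  have comp: "norm ((A *v x) $ i) \<le> norm (A $ i) * norm x" for i
  proof -
    have "norm ((A *v x) $ i) \<le> (\<Sum>k\<in>UNIV. \<bar>norm (A $ i $ k)\<bar> * \<bar>norm (x $ k)\<bar>)"
      unfolding matrix_vector_mult_def by (simp add: sum_norm_le norm_mult)
    also have "\<dots> \<le> norm (A $ i) * norm x"
      unfolding norm_vec_def[of "A $ i"] norm_vec_def[of x] by (rule L2_set_mult_ineq)
    finally show ?thesis .
  qed
  have "norm (A *v x) \<le> L2_set (\<lambda>i. norm (A $ i) * norm x) UNIV"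
    unfolding norm_vec_def[of "A *v x"] by (rule L2_set_mono) (auto intro: comp)
  also have "\<dots> = norm A * norm x"
    unfolding norm_vec_def[of A] by (simp add: L2_set_left_distrib)
  finally show ?thesis .
qed

lemma matrix_diff_mult: "(A - B) ** C = A ** C - B ** C" for A B :: "'a::ring_1^'n^'m"
  by (simp add: vec_eq_iff matrix_matrix_mult_def left_diff_distrib sum_subtractf)

lemma matrix_mult_diff: "A ** (B - C) = A ** B - A ** C" for A :: "'a::ring_1^'n^'m"
  by (simp add: vec_eq_iff matrix_matrix_mult_def right_diff_distrib sum_subtractf)

lemma norm_transpose [simp]:
  fixes A :: "'a::real_normed_field^'n^'m"
  shows "norm (transpose A) = norm A"
proof -
  have "(norm (transpose A))\<^sup>2 = (norm A)\<^sup>2"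
    unfolding norm_vec_def L2_set_def
    by (simp add: sum_nonneg transpose_def) (rule sum.swap)
  then show ?thesis by simp
qed

lemma norm_ctranspose [simp]: "norm (ctranspose A) = norm A"
proof -
  have "(norm (ctranspose A))\<^sup>2 = (norm A)\<^sup>2"
    unfolding norm_vec_def L2_set_def
    by (simp add: sum_nonneg ctranspose_def) (rule sum.swap)
  then show ?thesis by simp
qed

lemma tendsto_vec_nth2: "(f \<longlongrightarrow> A) F \<Longrightarrow> ((\<lambda>x. f x $ i $ j) \<longlongrightarrow> A $ i $ j) F"
  by (intro tendsto_vec_nth)

lemma mat_tendstoI:
  assumes "\<And>i j. ((\<lambda>x. f x $ i $ j) \<longlongrightarrow> A $ i $ j) F"
  shows "(f \<longlongrightarrow> A) F"
  by (intro vec_tendstoI assms)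

lemma tendsto_matrix_mult [tendsto_intros]:
  fixes f :: "'c \<Rightarrow> 'a::real_normed_field^'n^'m"
  assumes "(f \<longlongrightarrow> A) F" "(g \<longlongrightarrow> B) F"
  shows "((\<lambda>x. f x ** g x) \<longlongrightarrow> A ** B) F"
  by (rule mat_tendstoI)
    (simp add: matrix_matrix_mult_def, intro tendsto_sum tendsto_mult tendsto_vec_nth2 assms)

lemma tendsto_matrix_vector_mult [tendsto_intros]:
  fixes f :: "'c \<Rightarrow> 'a::real_normed_field^'n^'m"
  assumes "(f \<longlongrightarrow> A) F" "(g \<longlongrightarrow> b) F"
  shows "((\<lambda>x. f x *v g x) \<longlongrightarrow> A *v b) F"
  by (rule vec_tendstoI)
    (simp add: matrix_vector_mult_def,
      intro tendsto_sum tendsto_mult tendsto_vec_nth2 tendsto_vec_nth assms)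

lemma tendsto_transpose [tendsto_intros]:
  "(f \<longlongrightarrow> A) F \<Longrightarrow> ((\<lambda>x. transpose (f x)) \<longlongrightarrow> transpose A) F"
  unfolding transpose_def by (rule mat_tendstoI) (simp add: tendsto_vec_nth2)

lemma tendsto_ctranspose [tendsto_intros]:
  "(f \<longlongrightarrow> A) F \<Longrightarrow> ((\<lambda>x. ctranspose (f x)) \<longlongrightarrow> ctranspose A) F"
  unfolding ctranspose_def by (rule mat_tendstoI) (simp add: tendsto_vec_nth2 tendsto_cnj)

lemma tendsto_cmat [tendsto_intros]:
  "(f \<longlongrightarrow> A) F \<Longrightarrow> ((\<lambda>x. cmat (f x)) \<longlongrightarrow> cmat A) F"
  unfolding cmat_def by (rule mat_tendstoI) (simp add: tendsto_vec_nth2 tendsto_of_real)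

lemma tendsto_sub_blocks [tendsto_intros]:
  assumes "(f \<longlongrightarrow> A) F"
  shows "((\<lambda>x. sub_xx (f x)) \<longlongrightarrow> sub_xx A) F" "((\<lambda>x. sub_xy (f x)) \<longlongrightarrow> sub_xy A) F"
    "((\<lambda>x. sub_yx (f x)) \<longlongrightarrow> sub_yx A) F" "((\<lambda>x. sub_yy (f x)) \<longlongrightarrow> sub_yy A) F"
  unfolding sub_xx_def sub_xy_def sub_yx_def sub_yy_def
  by (rule mat_tendstoI; simp add: tendsto_vec_nth2 assms)+

lemma tendsto_det [tendsto_intros]:
  fixes f :: "'c \<Rightarrow> 'a::real_normed_field^'n^'n"
  assumes "(f \<longlongrightarrow> A) F"
  shows "((\<lambda>x. det (f x)) \<longlongrightarrow> det A) F"
  unfolding det_def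
  by (intro tendsto_sum tendsto_mult tendsto_prod tendsto_vec_nth2 assms tendsto_const)

section \<open>Inverse matrices\<close>

lemma matrix_inv_unique:
  fixes A :: "'a::semiring_1^'n^'m"
  assumes "A ** B = mat 1" "B ** A = mat 1"
  shows "matrix_inv A = B"
proof -
  have "A ** matrix_inv A = mat 1 \<and> matrix_inv A ** A = mat 1"
    unfolding matrix_inv_def by (rule someI_ex) (use assms in blast)
  then show ?thesis
    by (metis assms(2) matrix_mul_assoc matrix_mul_lid matrix_mul_rid)
qed

lemma matrix_inv_mult:
  fixes A :: "'a::field^'n^'n"
  assumes "det A \<noteq> 0"
  shows "A ** matrix_inv A = mat 1" "matrix_inv A ** A = mat 1"
proof -
  have "\<exists>B. A ** B = mat 1 \<and> B ** A = mat 1"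
    using assms invertible_det_nz[of A] unfolding invertible_def by blast
  then have "A ** matrix_inv A = mat 1 \<and> matrix_inv A ** A = mat 1"
    unfolding matrix_inv_def by (rule someI_ex)
  then show "A ** matrix_inv A = mat 1" "matrix_inv A ** A = mat 1" by auto
qed

lemma matrix_inv_eqI:
  fixes A :: "'a::field^'n^'n"
  assumes "A ** B = mat 1"
  shows "matrix_inv A = B"
  using assms matrix_left_right_inverse by (intro matrix_inv_unique) auto

lemma det_nonzeroI:
  fixes A :: "'a::field^'n^'n"
  assumes "A ** B = mat 1"
  shows "det A \<noteq> 0"
  using assms invertible_det_nz[of A] invertible_right_inverse[of A] by blast

lemma det_nonzero_ker:
  fixes A :: "'a::field^'n^'n"
  assumes "\<And>v. A *v v = 0 \<Longrightarrow> v = 0"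
  shows "det A \<noteq> 0"
  using assms invertible_det_nz[of A] invertible_left_inverse[of A] matrix_left_invertible_ker[of A]
  by blast

text \<open>Cramer's rule with a unit vector on the right-hand side. It exhibits the entries of the
  inverse as quotients of determinants, from which continuity of inversion follows.\<close>

lemma matrix_inv_nth:
  fixes A :: "'a::field^'n^'n"
  assumes "det A \<noteq> 0"
  shows "matrix_inv A $ k $ l =
    det (\<chi> i j. if j = k then (if i = l then 1 else 0) else A $ i $ j) / det A"
proof -
  have "A *v (matrix_inv A *v axis l 1) = axis l 1"
    by (simp add: matrix_vector_mul_assoc matrix_inv_mult[OF assms])
  then have "matrix_inv A *v axis l 1 =
      (\<chi> k. det (\<chi> i j. if j = k then axis l 1 $ i else A $ i $ j) / det A)"
    using cramer[OF assms] by blast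
  moreover have "(matrix_inv A *v axis l 1) $ k = matrix_inv A $ k $ l"
    by (simp add: matrix_vector_mult_def axis_def if_distrib if_distribR cong: if_cong)
  ultimately show ?thesis
    by (simp add: axis_def cong: if_cong)
qed

lemma tendsto_matrix_inv [tendsto_intros]:
  fixes f :: "'c \<Rightarrow> 'a::real_normed_field^'n^'n"
  assumes f: "(f \<longlongrightarrow> A) F" and A: "det A \<noteq> 0"
  shows "((\<lambda>x. matrix_inv (f x)) \<longlongrightarrow> matrix_inv A) F"
proof (rule mat_tendstoI)
  fix k l
  have ev: "\<forall>\<^sub>F x in F. det (f x) \<noteq> 0"
    using tendsto_imp_eventually_ne[OF tendsto_det[OF f] A] .
  have m: "((\<lambda>x. \<chi> i j. if j = k then (if i = l then 1 else 0) else f x $ i $ j) \<longlongrightarrow>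
      (\<chi> i j. if j = k then (if i = l then 1 else 0) else A $ i $ j)) F"
    by (rule mat_tendstoI) (simp add: tendsto_vec_nth2 f)
  have "((\<lambda>x. det (\<chi> i j. if j = k then (if i = l then 1 else 0) else f x $ i $ j) / det (f x))
      \<longlongrightarrow> matrix_inv A $ k $ l) F"
    unfolding matrix_inv_nth[OF A] by (intro tendsto_divide tendsto_det m f A)
  then show "((\<lambda>x. matrix_inv (f x) $ k $ l) \<longlongrightarrow> matrix_inv A $ k $ l) F"
    by (rule Lim_transform_eventually) (use ev in eventually_elim, simp add: matrix_inv_nth)
qed

section \<open>Positive semidefinite matrices\<close>

definition psd :: "real^'n^'n \<Rightarrow> bool" where
  "psd B \<longleftrightarrow> transpose B = B \<and> (\<forall>v. 0 \<le> v \<bullet> (B *v v))"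

lemma pos_definite_imp_psd: "pos_definite B \<Longrightarrow> psd B"
  unfolding pos_definite_def psd_def by (metis inner_zero_left less_eq_real_def)

lemma sym_inner_commute:
  assumes "transpose B = (B :: real^'n^'n)"
  shows "u \<bullet> (B *v v) = v \<bullet> (B *v u)"
  by (metis assms dot_lmul_matrix inner_commute transpose_matrix_vector)

lemma psd_nth_commute:
  assumes "psd B"
  shows "B $ i $ j = B $ j $ i"
proof -
  have "transpose B $ i $ j = B $ i $ j" using assms unfolding psd_def by simp
  then show ?thesis by (simp add: transpose_def)
qed

lemma psd_cauchy_schwarz:
  assumes "psd B"
  shows "(u \<bullet> (B *v v))\<^sup>2 \<le> (u \<bullet> (B *v u)) * (v \<bullet> (B *v v))"
proof -
  let ?a = "u \<bullet> (B *v u)" and ?b = "u \<bullet> (B *v v)" and ?c = "v \<bullet> (B *v v)"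
  have sym: "v \<bullet> (B *v u) = ?b"
    using assms sym_inner_commute unfolding psd_def by blast
  have q: "0 \<le> ?a + 2 * t * ?b + t\<^sup>2 * ?c" for t :: real
  proof -
    have "0 \<le> (u + t *\<^sub>R v) \<bullet> (B *v (u + t *\<^sub>R v))"
      using assms unfolding psd_def by blast
    also have "\<dots> = ?a + 2 * t * ?b + t\<^sup>2 * ?c"
      by (simp add: matrix_vector_right_distrib matrix_vector_mult_scaleR inner_add_left
          inner_add_right sym power2_eq_square algebra_simps)
    finally show ?thesis .
  qed
  have c: "0 \<le> ?c" using assms unfolding psd_def by blast
  show ?thesis
  proof (cases "?c = 0")
    case True
    \<comment> \<open>With \<open>?c = 0\<close> the inequality \<open>q\<close> is affine in t, and
      a nonzero slope would let the t chosen below bring it down to -1. Otherwise t = -b/c minimises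
      the parabola.\<close>
    have "?b = 0"
    proof (rule ccontr)
      assume "?b \<noteq> 0"
      then show False
        using q[of "- (?a + 1) / (2 * ?b)"] True by (simp add: field_simps)
    qed
    then show ?thesis using True by simp
  next
    case False
    then have "0 < ?c" using c by simp
    have "0 \<le> ?a - ?b\<^sup>2 / ?c"
      using q[of "- ?b / ?c"] False by (simp add: field_simps power2_eq_square)
    then show ?thesis using \<open>0 < ?c\<close> by (simp add: field_simps)
  qed
qed

lemma quadratic_form_sum:
  "u \<bullet> ((B :: real^'n^'m) *v v) = (\<Sum>i\<in>UNIV. \<Sum>j\<in>UNIV. u $ i * B $ i $ j * v $ j)"
  by (simp add: inner_vec_def matrix_vector_mult_def sum_distrib_left mult.assoc)

lemma inner_axis_quadratic: "axis i 1 \<bullet> ((B :: real^'n^'m) *v axis j 1) = B $ i $ j"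
  by (simp add: inner_axis' matrix_vector_mult_basis column_def)

lemma psd_nth_square_le: "psd B \<Longrightarrow> (B $ i $ j)\<^sup>2 \<le> B $ i $ i * B $ j $ j"
  using psd_cauchy_schwarz[of B "axis i 1" "axis j 1"] by (simp add: inner_axis_quadratic)

lemma psd_diag_nonneg: "psd B \<Longrightarrow> 0 \<le> B $ i $ i"
  unfolding psd_def by (metis inner_axis_quadratic)

lemma matrix_mult_transpose_nth:
  "((L :: real^'n^'m) ** transpose L) $ i $ j = (\<Sum>k\<in>UNIV. L $ i $ k * L $ j $ k)"
  by (simp add: matrix_matrix_mult_def transpose_def)

text \<open>Cholesky elimination, by induction on the set of indices carrying nonzero rows.\<close>

lemma psd_factor_aux:
  fixes B :: "real^'n^'n"
  assumes "finite I" "psd B" "\<And>i j. B $ i $ j \<noteq> 0 \<Longrightarrow> i \<in> I"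
  shows "\<exists>L :: real^'n^'n. L ** transpose L = B \<and> (\<forall>i k. L $ i $ k \<noteq> 0 \<longrightarrow> k \<in> I)"
  using assms
proof (induction I arbitrary: B rule: finite_induct)
  case empty
  then have "B = 0" by (auto simp: vec_eq_iff)
  then show ?case
    by (intro exI[of _ 0]) (auto simp: vec_eq_iff matrix_mult_transpose_nth)
next
  case (insert m I B)
  have sym: "B $ i $ j = B $ j $ i" for i j
    using insert.prems(1) psd_nth_commute by blast
  define d where "d = B $ m $ m"
  have d0: "0 \<le> d" unfolding d_def using insert.prems(1) by (rule psd_diag_nonneg)
  \<comment> \<open>The new column of the factor. A zero pivot forces column \<open>m\<close> to
    vanish altogether (\<open>row0\<close>), so nothing is left to eliminate; otherwise
    \<open>B'\<close> below is the Schur complement of the pivot.\<close>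
  define l where "l = (\<chi> i. if d = 0 then 0 else B $ i $ m / sqrt d)"
  have ll: "l $ i * l $ j = (if d = 0 then 0 else B $ i $ m * B $ j $ m / d)" for i j
    using d0 by (simp add: l_def)
  have row0: "B $ i $ m = 0" if "d = 0" for i
    using psd_nth_square_le[OF insert.prems(1), of i m] that unfolding d_def by simp
  define B' where "B' = (\<chi> i j. B $ i $ j - l $ i * l $ j)"
  have B'm: "B' $ i $ m = 0" for i
    using row0[of i] by (simp add: B'_def ll) (simp add: d_def)
  have symB': "B' $ i $ j = B' $ j $ i" for i j
    unfolding B'_def using sym[of i j] by simp
  have "psd B'" unfolding psd_def
  proof (intro conjI allI)
    show "transpose B' = B'" by (simp add: vec_eq_iff transpose_def symB')
    fix v
    have eq: "v \<bullet> (B' *v v) = v \<bullet> (B *v v) - (l \<bullet> v)\<^sup>2"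
    proof -
      have "(l \<bullet> v)\<^sup>2 = (\<Sum>i\<in>UNIV. \<Sum>j\<in>UNIV. v $ i * (l $ i * l $ j) * v $ j)"
        by (simp add: inner_vec_def power2_eq_square sum_product algebra_simps)
      then show ?thesis
        unfolding quadratic_form_sum B'_def
        by (simp add: algebra_simps sum_subtractf)
    qed
    show "0 \<le> v \<bullet> (B' *v v)"
    proof (cases "d = 0")
      case True
      then have "l = 0" by (simp add: l_def vec_eq_iff)
      then show ?thesis using eq insert.prems(1) unfolding psd_def by simp
    next
      case False
      have "l \<bullet> v = (v \<bullet> (B *v axis m 1)) / sqrt d"
        using False by (simp add: l_def inner_vec_def matrix_vector_mult_basis column_def
            sum_divide_distrib mult.commute)
      then have "(l \<bullet> v)\<^sup>2 = (v \<bullet> (B *v axis m 1))\<^sup>2 / d"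
        using d0 by (simp add: power_divide)
      also have "\<dots> \<le> ((v \<bullet> (B *v v)) * d) / d"
        using psd_cauchy_schwarz[OF insert.prems(1), of v "axis m 1"] d0
        by (intro divide_right_mono) (simp_all add: inner_axis_quadratic d_def)
      also have "\<dots> = v \<bullet> (B *v v)" using False by simp
      finally show ?thesis using eq by simp
    qed
  qed
  moreover have "i \<in> I" if "B' $ i $ j \<noteq> 0" for i j
  proof -
    have "i \<noteq> m" using that B'm[of j] symB'[of i j] by metis
    moreover have "B $ i $ j \<noteq> 0 \<or> B $ i $ m \<noteq> 0"
      using that by (auto simp: B'_def ll split: if_splits)
    ultimately show ?thesis using insert.prems(2) by blast
  qed
  ultimately obtain L :: "real^'n^'n" where L: "L ** transpose L = B'"
    "\<And>i k. L $ i $ k \<noteq> 0 \<Longrightarrow> k \<in> I"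
    using insert.IH[of B'] by blast
  define L' where "L' = (\<chi> i k. if k = m then l $ i else L $ i $ k)"
  have "(L' ** transpose L') $ i $ j = B $ i $ j" for i j
  proof -
    have L0: "L $ i $ m = 0" for i using L(2) insert.hyps by blast
    have "(\<Sum>k\<in>UNIV. L' $ i $ k * L' $ j $ k) =
        l $ i * l $ j + (\<Sum>k\<in>UNIV - {m}. L' $ i $ k * L' $ j $ k)"
      by (subst sum.remove[of _ m]) (simp_all add: L'_def)
    also have "(\<Sum>k\<in>UNIV - {m}. L' $ i $ k * L' $ j $ k) = (\<Sum>k\<in>UNIV - {m}. L $ i $ k * L $ j $ k)"
      by (rule sum.cong) (auto simp: L'_def)
    also have "\<dots> = (\<Sum>k\<in>UNIV. L $ i $ k * L $ j $ k)"
      by (subst (2) sum.remove[of _ m]) (simp_all add: L0)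
    also have "\<dots> = B' $ i $ j"
      using L(1) by (metis matrix_mult_transpose_nth)
    finally show ?thesis by (simp add: matrix_mult_transpose_nth B'_def)
  qed
  then have "L' ** transpose L' = B" by (simp add: vec_eq_iff)
  moreover have "k \<in> insert m I" if "L' $ i $ k \<noteq> 0" for i k
    using that L(2) by (auto simp: L'_def split: if_splits)
  ultimately show ?case by blast
qed

lemma psd_factor:
  fixes B :: "real^'n^'n"
  assumes "psd B"
  obtains L :: "real^'n^'n" where "L ** transpose L = B"
  using psd_factor_aux[of UNIV B] assms by auto

lemma pos_definite_det_nonzero: "pos_definite B \<Longrightarrow> det B \<noteq> 0"
  unfolding pos_definite_def by (intro det_nonzero_ker) (metis inner_zero_right less_irrefl)

section \<open>Powers of a matrix with spectral radius below one\<close>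

lemma contracting_recursion_tendsto_0:
  fixes x w :: "nat \<Rightarrow> 'a::real_normed_vector"
  assumes step: "\<And>k. norm (x (Suc k)) \<le> r * norm (x k) + norm (w k)"
    and r: "0 \<le> r" "r < 1" and w: "w \<longlonglongrightarrow> 0"
  shows "x \<longlonglongrightarrow> 0"
proof (rule tendstoI)
  fix e :: real assume "0 < e"
  \<comment> \<open>Chosen so that e/2 is the fixed point of x -> r x + d.\<close>
  define d where "d = e * (1 - r) / 2"
  have d: "0 < d" using \<open>0 < e\<close> r by (simp add: d_def)
  obtain K where K: "\<And>k. K \<le> k \<Longrightarrow> norm (w k) < d"
    using w d by (metis LIMSEQ_iff diff_zero)
  have bnd: "norm (x (K + j)) \<le> r ^ j * norm (x K) + e / 2" for j
  proof (induction j)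
    case 0 then show ?case using \<open>0 < e\<close> by simp
  next
    case (Suc j)
    have "norm (x (K + Suc j)) \<le> r * norm (x (K + j)) + d"
      using step[of "K + j"] K[of "K + j"] by simp
    also have "\<dots> \<le> r * (r ^ j * norm (x K) + e / 2) + d"
      using Suc r by (simp add: mult_left_mono)
    also have "\<dots> = r ^ Suc j * norm (x K) + e / 2"
      by (simp add: d_def field_simps)
    finally show ?case .
  qed
  have "(\<lambda>j. r ^ j * norm (x K)) \<longlonglongrightarrow> 0"
    using r by (intro tendsto_mult_left_zero LIMSEQ_power_zero) simp
  then obtain J where J: "\<And>j. J \<le> j \<Longrightarrow> r ^ j * norm (x K) < e / 2"
    using \<open>0 < e\<close> by (metis LIMSEQ_iff abs_less_iff diff_zero half_gt_zero real_norm_def)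
  show "\<forall>\<^sub>F k in sequentially. dist (x k) 0 < e"
    unfolding eventually_sequentially
  proof (intro exI[of _ "K + J"] allI impI)
    fix k assume "K + J \<le> k"
    then show "dist (x k) 0 < e"
      using bnd[of "k - K"] J[of "k - K"] by (simp add: le_diff_conv2)
  qed
qed

text \<open>The vector p(M) v. Applying the polynomial to one vector at a time allows an annihilator
  to be read off from a linear relation in the orbit of that vector.\<close>

definition poly_mat :: "'a::field poly \<Rightarrow> 'a^'n^'n \<Rightarrow> 'a^'n \<Rightarrow> 'a^'n" where
  "poly_mat p M v = (\<Sum>k\<le>degree p. coeff p k *s (((*v) M) ^^ k) v)"

lemma mat_funpow_linear:
  fixes M :: "'a::field^'n^'n"
  shows "((*v) M ^^ k) (u + v) = ((*v) M ^^ k) u + ((*v) M ^^ k) v"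
    "((*v) M ^^ k) (c *s u) = c *s ((*v) M ^^ k) u"
  by (induction k) (simp_all add: matrix_vector_right_distrib vector_scalar_commute)

lemma mat_funpow_sum:
  fixes M :: "'a::field^'n^'n"
  shows "((*v) M ^^ k) (\<Sum>i\<in>I. f i) = (\<Sum>i\<in>I. ((*v) M ^^ k) (f i))"
proof (induction I rule: infinite_finite_induct)
  case (insert x F) then show ?case by (simp add: mat_funpow_linear)
next
  have "((*v) M ^^ k) 0 = 0" by (induction k) auto
  then show "((*v) M ^^ k) (sum f {}) = (\<Sum>i\<in>{}. ((*v) M ^^ k) (f i))"
    "infinite A \<Longrightarrow> ((*v) M ^^ k) (sum f A) = (\<Sum>i\<in>A. ((*v) M ^^ k) (f i))" for A
    by simp_all
qed

lemma poly_mat_upto: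
  fixes M :: "'a::field^'n^'n"
  assumes "degree p \<le> n"
  shows "poly_mat p M v = (\<Sum>k\<le>n. coeff p k *s (((*v) M) ^^ k) v)"
  unfolding poly_mat_def using assms
  by (intro sum.mono_neutral_left) (auto simp: coeff_eq_0)

lemma poly_mat_linear_factor:
  fixes M :: "'a::field^'n^'n"
  shows "poly_mat ([:- c, 1:] * q) M v = M *v (poly_mat q M v) - c *s poly_mat q M v"
proof -
  let ?n = "Suc (degree q)"
  have deg: "degree ([:- c, 1:] * q) \<le> ?n"
    by (rule order_trans[OF degree_mult_le]) simp
  have co: "coeff ([:- c, 1:] * q) k = (case k of 0 \<Rightarrow> 0 | Suc j \<Rightarrow> coeff q j) - c * coeff q k" for k
    by (simp add: coeff_pCons split: nat.splits)
  have "poly_mat ([:- c, 1:] * q) M v = (\<Sum>k\<le>?n. coeff ([:- c, 1:] * q) k *s (((*v) M) ^^ k) v)"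
    by (rule poly_mat_upto[OF deg])
  also have "\<dots> = (\<Sum>k\<le>?n. (case k of 0 \<Rightarrow> 0 | Suc j \<Rightarrow> coeff q j) *s (((*v) M) ^^ k) v)
      - (\<Sum>k\<le>?n. (c * coeff q k) *s (((*v) M) ^^ k) v)"
    unfolding co by (simp only: sum_subtractf [symmetric] vector_sub_rdistrib)
  also have "(\<Sum>k\<le>?n. (case k of 0 \<Rightarrow> 0 | Suc j \<Rightarrow> coeff q j) *s (((*v) M) ^^ k) v)
      = (\<Sum>k\<le>degree q. coeff q k *s (M *v (((*v) M) ^^ k) v))"
    by (subst sum.atMost_Suc_shift) simp
  also have "\<dots> = M *v poly_mat q M v"
    unfolding poly_mat_def by (simp add: vec.sum vector_scalar_commute[symmetric])
  also have "(\<Sum>k\<le>?n. (c * coeff q k) *s (((*v) M) ^^ k) v) = c *s poly_mat q M v"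
    unfolding poly_mat_upto[of q ?n, OF le_SucI[OF order_refl]]
    by (simp add: vec.scale_sum_right vector_smult_assoc)
  finally show ?thesis .
qed

text \<open>Induction on the degree, splitting off a root c of p = (X - c) q. If c lies in the open
  unit disc, the orbit of v satisfies a contracting recursion whose input is the orbit of (M - c) v,
  and that vector is annihilated by q. Otherwise c is not an eigenvalue, so q already annihilates
  v.\<close>

lemma funpow_tendsto_0_of_annihilator:
  fixes M :: "complex^'n^'n"
  assumes ev: "\<And>c. is_eigenvalue M c \<Longrightarrow> cmod c < 1"
    and "p \<noteq> 0" "poly_mat p M v = 0"
  shows "(\<lambda>k. ((*v) M ^^ k) v) \<longlonglongrightarrow> 0"
  using assms(2,3)
proof (induction "degree p" arbitrary: p v)
  case 0
  then obtain a where "p = [:a:]" "a \<noteq> 0" by (metis degree_eq_zeroE pCons_eq_0_iff)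
  then have "v = 0" using 0 by (simp add: poly_mat_def vec_eq_iff)
  moreover have "((*v) M ^^ k) 0 = 0" for k by (induction k) auto
  ultimately show ?case by simp
next
  case (Suc d)
  have "\<exists>z. poly p z = 0"
    using Suc.hyps(2) by (intro fundamental_theorem_of_algebra) (auto simp: constant_degree)
  then obtain c where "poly p c = 0" ..
  then obtain q where q: "p = [:- c, 1:] * q"
    by (metis dvdE poly_eq_0_iff_dvd)
  have q0: "q \<noteq> 0" and dq: "d = degree q"
    using Suc.prems(1) Suc.hyps(2) unfolding q by (auto simp del: mult_pCons_left simp: degree_mult_eq)
  define v' where "v' = M *v v - c *s v"
  have comm: "poly_mat q M v' = M *v (poly_mat q M v) - c *s poly_mat q M v"
  proof -
    have 1: "((*v) M ^^ k) v' = M *v ((*v) M ^^ k) v - c *s ((*v) M ^^ k) v" for k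
      unfolding v'_def
      by (induction k) (simp_all add: matrix_vector_mult_diff_distrib vector_scalar_commute)
    show ?thesis unfolding poly_mat_def 1
      by (simp add: vec.sum vec.scale_sum_right vector_ssub_ldistrib sum_subtractf
          vector_scalar_commute[symmetric] vector_smult_assoc mult.commute)
  qed
  have zero: "poly_mat q M v' = 0"
    using Suc.prems(2) unfolding comm q poly_mat_linear_factor .
  show ?case
  proof (cases "cmod c < 1")
    case True
    have lim: "(\<lambda>k. ((*v) M ^^ k) v') \<longlonglongrightarrow> 0"
      using Suc.hyps(1)[OF dq q0 zero] .
    have "((*v) M ^^ Suc k) v = c *s ((*v) M ^^ k) v + ((*v) M ^^ k) v'" for k
      unfolding v'_def
      by (induction k) (simp_all add: matrix_vector_mult_diff_distrib matrix_vector_right_distrib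
          vector_scalar_commute)
    then have "norm (((*v) M ^^ Suc k) v) \<le> cmod c * norm (((*v) M ^^ k) v) + norm (((*v) M ^^ k) v')" for k
      by (metis norm_triangle_ineq norm_vector_smult)
    then show ?thesis
      using True lim by (rule_tac contracting_recursion_tendsto_0[where r = "cmod c" and w = "\<lambda>k. ((*v) M ^^ k) v'"]) auto
  next
    case False
    have "M *v (poly_mat q M v) = c *s poly_mat q M v"
      using comm zero by simp
    then have "poly_mat q M v = 0"
      using ev[of c] False unfolding is_eigenvalue_def by blast
    then show ?thesis using Suc.hyps(1)[OF dq q0] by blast
  qed
qed

text \<open>The vectors v, M v, ..., M^n v are one more than the dimension. If two of them coincide,
  they form too small a set for the dimension count, but then their difference is the required
  relation.\<close>

lemma annihilator_exists:
  fixes M :: "'a::field^'n^'n"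
  shows "\<exists>p. p \<noteq> 0 \<and> poly_mat p M v = 0"
proof -
  let ?u = "\<lambda>k. ((*v) M ^^ k) v"
  let ?N = "CARD('n)"
  have "\<exists>c. (\<exists>k\<le>?N. c k \<noteq> 0) \<and> (\<Sum>k\<le>?N. c k *s ?u k) = 0"
  proof (cases "inj_on ?u {..?N}")
    case True
    have "card (?u ` {..?N}) = Suc ?N" using True by (simp add: card_image)
    then have "vec.dependent (?u ` {..?N})"
      using vec.dim_subset_UNIV[of "?u ` {..?N}"]
      by (intro vec.dependent_biggerset_general) (simp add: vec.dimension_def card_cart_basis)
    then obtain f where f: "\<exists>x\<in>?u ` {..?N}. f x \<noteq> 0" "(\<Sum>x\<in>?u ` {..?N}. f x *s x) = 0"
      by (auto simp: vec.dependent_finite)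
    then show ?thesis
      using True by (intro exI[of _ "\<lambda>k. f (?u k)"]) (auto simp: sum.reindex o_def)
  next
    case False
    then obtain i j where ij: "i \<le> ?N" "j \<le> ?N" "i \<noteq> j" "?u i = ?u j"
      by (auto simp: inj_on_def)
    let ?c = "\<lambda>k. if k = i then 1 else if k = j then -1 else (0::'a)"
    have "(\<Sum>k\<le>?N. ?c k *s ?u k) = (\<Sum>k\<in>{i,j}. ?c k *s ?u k)"
      using ij by (intro sum.mono_neutral_right) auto
    also have "\<dots> = 0" using ij by (simp add: vec_eq_iff)
    finally show ?thesis using ij by (intro exI[of _ ?c]) auto
  qed
  then obtain c k where c: "k \<le> ?N" "c k \<noteq> 0" "(\<Sum>k\<le>?N. c k *s ?u k) = 0" by blast
  define p where "p = (\<Sum>k\<le>?N. monom (c k) k)"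
  have co: "coeff p k = (if k \<le> ?N then c k else 0)" for k
    unfolding p_def by (simp add: coeff_sum if_distrib cong: if_cong)
  have "degree p \<le> ?N" by (rule degree_le) (simp add: co)
  then have "poly_mat p M v = 0"
    using c(3) by (subst poly_mat_upto) (auto simp: co)
  moreover have "p \<noteq> 0" using c co by (metis coeff_0)
  ultimately show ?thesis by blast
qed

lemma funpow_tendsto_0:
  fixes M :: "complex^'n^'n"
  assumes "\<And>c. is_eigenvalue M c \<Longrightarrow> cmod c < 1"
  shows "(\<lambda>k. ((*v) M ^^ k) v) \<longlonglongrightarrow> 0"
  using funpow_tendsto_0_of_annihilator[OF assms] annihilator_exists by blast

definition cvec :: "real^'n \<Rightarrow> complex^'n" where
  "cvec v = (\<chi> i. of_real (v $ i))"

lemma cmat_mult_cvec: "cmat C *v cvec v = cvec (C *v v)"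
  by (simp add: cvec_def cmat_def matrix_vector_mult_def vec_eq_iff)

lemma cmat_funpow:
  fixes C :: "real^'n^'n"
  shows "((*v) (cmat C) ^^ k) (cvec v) = cvec (((*v) C ^^ k) v)"
  by (induction k) (simp_all add: cmat_mult_cvec)

lemma norm_le_sum_basis:
  fixes M :: "'a::real_normed_field^'n^'n"
  assumes "\<And>i. norm (((*v) M ^^ k) (axis i 1)) \<le> d"
  shows "norm (((*v) M ^^ k) v) \<le> real CARD('n) * d * norm v"
proof -
  have "v = (\<Sum>i\<in>UNIV. v $ i *s axis i 1)"
    by (simp add: vec_eq_iff axis_def if_distrib cong: if_cong)
  then have "((*v) M ^^ k) v = (\<Sum>i\<in>UNIV. v $ i *s ((*v) M ^^ k) (axis i 1))"
    by (metis (no_types, lifting) mat_funpow_linear(2) mat_funpow_sum sum.cong)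
  also have "norm \<dots> \<le> (\<Sum>i\<in>(UNIV::'n set). norm v * d)"
    by (rule order_trans[OF norm_sum], rule sum_mono)
      (auto simp: norm_vector_smult intro!: mult_mono assms Finite_Cartesian_Product.norm_nth_le)
  finally show ?thesis by (simp add: mult_ac)
qed

text \<open>Decay on the basis vectors provides a power m = Suc m0 that at least halves every norm:
  the threshold \<open>?d\<close> is 1/2 divided by the number of basis vectors. The rate is the
  m-th root of 1/2.\<close>

lemma funpow_geometric_bound:
  fixes C :: "real^'n^'n"
  assumes "\<And>c. is_eigenvalue (cmat C) c \<Longrightarrow> cmod c < 1"
  obtains K \<rho> where "0 \<le> K" "0 \<le> \<rho>" "\<rho> < 1" "\<And>k v. norm (((*v) C ^^ k) v) \<le> K * \<rho> ^ k * norm v"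
proof -
  let ?d = "1 / (2 * real CARD('n))"
  have lim: "(\<lambda>k. ((*v) C ^^ k) (axis i 1)) \<longlonglongrightarrow> 0" for i
  proof -
    have "(\<lambda>k. cvec (((*v) C ^^ k) (axis i 1))) \<longlonglongrightarrow> 0"
      using funpow_tendsto_0[OF assms] by (simp add: cmat_funpow[symmetric])
    then have "(\<lambda>k. Re (cvec (((*v) C ^^ k) (axis i 1)) $ j)) \<longlonglongrightarrow> Re (0 $ j)" for j
      by (intro tendsto_Re tendsto_vec_nth)
    then show ?thesis by (intro vec_tendstoI) (simp add: cvec_def)
  qed
  have "\<forall>\<^sub>F k in sequentially. \<forall>i\<in>UNIV. norm (((*v) C ^^ k) (axis i 1)) < ?d"
  proof (rule eventually_ball_finite)
    show "\<forall>i\<in>UNIV. \<forall>\<^sub>F k in sequentially. norm (((*v) C ^^ k) (axis i 1)) < ?d"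
      using tendstoD[OF lim, of ?d] by simp
  qed simp
  then obtain m0 where "\<And>k i. m0 \<le> k \<Longrightarrow> norm (((*v) C ^^ k) (axis i 1)) < ?d"
    by (auto simp: eventually_sequentially)
  then have m: "norm (((*v) C ^^ Suc m0) v) \<le> (1/2) * norm v" for v
    using norm_le_sum_basis[where k = "Suc m0" and M = C and d = ?d and v = v]
    by (simp add: less_imp_le del: funpow.simps)
  let ?m = "Suc m0"
  define \<rho> where "\<rho> = root ?m (1/2)"
  have \<rho>: "0 < \<rho>" "\<rho> < 1" "\<rho> ^ ?m = 1/2"
    unfolding \<rho>_def by (simp_all add: real_root_pow_pos2 del: power_Suc)
  define B where "B = max 1 (norm C)"
  have B: "1 \<le> B" "norm (C *v v) \<le> B * norm v" for v
    unfolding B_def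
    by (auto intro!: order_trans[OF norm_matrix_vector_le] mult_right_mono)
  have Bp: "norm (((*v) C ^^ k) v) \<le> B ^ k * norm v" for k v
  proof (induction k)
    case (Suc k)
    have "norm (((*v) C ^^ Suc k) v) \<le> B * norm (((*v) C ^^ k) v)" using B(2) by simp
    also have "\<dots> \<le> B * (B ^ k * norm v)" using Suc B(1) by (intro mult_left_mono) auto
    finally show ?case by (simp add: mult_ac)
  qed simp
  have mp: "norm (((*v) C ^^ (?m * q)) v) \<le> (1/2) ^ q * norm v" for q v
  proof (induction q)
    case (Suc q)
    have "((*v) C ^^ (?m * Suc q)) v = ((*v) C ^^ ?m) (((*v) C ^^ (?m * q)) v)"
      by (metis funpow_add mult_Suc_right o_apply)
    then have "norm (((*v) C ^^ (?m * Suc q)) v) \<le> (1/2) * norm (((*v) C ^^ (?m * q)) v)"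
      using m by metis
    also have "\<dots> \<le> (1/2) ^ Suc q * norm v" using Suc by simp
    finally show ?case .
  qed simp
  \<comment> \<open>For k = r + m q with r < m, the remainder costs B^r <= B^m, and 2^-q = \<rho>^(m
    q) = \<rho>^k / \<rho>^r <= \<rho>^k / \<rho>^m.\<close>
  define K where "K = B ^ ?m / \<rho> ^ ?m"
  have "norm (((*v) C ^^ k) v) \<le> K * \<rho> ^ k * norm v" for k v
  proof -
    let ?q = "k div ?m" and ?r = "k mod ?m"
    have k: "k = ?r + ?m * ?q" by (rule mod_mult_div_eq[symmetric])
    have "((*v) C ^^ k) v = ((*v) C ^^ ?r) (((*v) C ^^ (?m * ?q)) v)"
      by (metis funpow_add k o_apply)
    then have "norm (((*v) C ^^ k) v) \<le> B ^ ?r * norm (((*v) C ^^ (?m * ?q)) v)"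
      using Bp by metis
    also have "\<dots> \<le> B ^ ?m * ((1/2) ^ ?q * norm v)"
      using B(1) mp by (intro mult_mono power_increasing) (auto simp: less_imp_le)
    also have "(1/2) ^ ?q = \<rho> ^ (?m * ?q)" by (simp only: power_mult \<rho>(3))
    also have "B ^ ?m * (\<rho> ^ (?m * ?q) * norm v) \<le> B ^ ?m * ((\<rho> ^ ?r / \<rho> ^ ?m) * \<rho> ^ (?m * ?q) * norm v)"
    proof -
      have "\<rho> ^ ?m \<le> \<rho> ^ ?r" using \<rho> by (intro power_decreasing) (auto simp: less_imp_le)
      then have "1 \<le> \<rho> ^ ?r / \<rho> ^ ?m" using \<rho> by (simp add: field_simps del: power_Suc)
      then have "1 * (\<rho> ^ (?m * ?q) * norm v) \<le> (\<rho> ^ ?r / \<rho> ^ ?m) * (\<rho> ^ (?m * ?q) * norm v)"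
        using \<rho> by (intro mult_right_mono) auto
      then show ?thesis using B(1)
        by (intro mult_left_mono) (auto simp: mult.assoc)
    qed
    also have "\<dots> = K * (\<rho> ^ ?r * \<rho> ^ (?m * ?q)) * norm v" by (simp add: K_def)
    also have "\<rho> ^ ?r * \<rho> ^ (?m * ?q) = \<rho> ^ k" by (metis k power_add)
    finally show ?thesis .
  qed
  moreover have "0 \<le> K" using B(1) \<rho> by (simp add: K_def del: power_Suc)
  ultimately show ?thesis using that \<rho> by (meson less_imp_le)
qed

text \<open>Stability is an open condition. A fixed power m of the limit matrix has small columns;
  smallness of the columns of the m-th power persists under perturbation, and it forces |c|^m <= 1/2
  for every eigenvalue c.\<close>

lemma eventually_spectral_radius_less:
  fixes C :: "real^'n^'n"
  assumes "\<And>c. is_eigenvalue (cmat C) c \<Longrightarrow> cmod c < 1" and f: "(f \<longlongrightarrow> C) F"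
  shows "\<forall>\<^sub>F x in F. \<forall>c. is_eigenvalue (cmat (f x)) c \<longrightarrow> cmod c < 1"
proof -
  let ?d = "1 / (2 * real CARD('n))"
  have "(\<lambda>k. ((*v) (cmat C) ^^ k) v) \<longlonglongrightarrow> 0" for v
    by (rule funpow_tendsto_0[OF assms(1)])
  then have lim: "\<forall>\<^sub>F k in sequentially. norm (((*v) (cmat C) ^^ k) (axis i 1)) < ?d" for i
    using tendstoD[of "\<lambda>k. ((*v) (cmat C) ^^ k) (axis i 1)" 0 sequentially ?d] by simp
  have "\<forall>\<^sub>F k in sequentially. \<forall>i\<in>UNIV. norm (((*v) (cmat C) ^^ k) (axis i 1)) < ?d"
    by (rule eventually_ball_finite) (use lim in auto)
  then obtain m where m: "\<And>i. norm (((*v) (cmat C) ^^ m) (axis i 1)) < ?d"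
    by (auto simp: eventually_sequentially)
  have pow: "((\<lambda>x. ((*v) (cmat (f x)) ^^ k) v) \<longlongrightarrow> ((*v) (cmat C) ^^ k) v) F" for k v
    by (induction k) (simp_all add: tendsto_matrix_vector_mult tendsto_cmat f)
  have "\<forall>\<^sub>F x in F. \<forall>i\<in>UNIV. norm (((*v) (cmat (f x)) ^^ m) (axis i 1)) < ?d"
  proof (rule eventually_ball_finite)
    show "\<forall>i\<in>UNIV. \<forall>\<^sub>F x in F. norm (((*v) (cmat (f x)) ^^ m) (axis i 1)) < ?d"
      using order_tendstoD(2)[OF tendsto_norm[OF pow] m] by simp
  qed simp
  then show ?thesis
  proof eventually_elim
    case (elim x)
    show ?case
    proof (intro allI impI)
      fix c assume "is_eigenvalue (cmat (f x)) c"
      then obtain v where v: "v \<noteq> 0" "cmat (f x) *v v = c *s v"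
        unfolding is_eigenvalue_def by blast
      have "((*v) (cmat (f x)) ^^ k) v = (c ^ k) *s v" for k
        by (induction k) (simp_all add: v(2) vector_scalar_commute vector_smult_assoc mult.commute)
      then have "cmod c ^ m * norm v \<le> (1/2) * norm v"
        using norm_le_sum_basis[where k = m and M = "cmat (f x)" and d = ?d and v = v] elim
        by (simp add: norm_vector_smult norm_power less_imp_le)
      then have "cmod c ^ m \<le> 1/2" using v(1) by simp
      then show "cmod c < 1"
        using one_le_power[of "cmod c" m] by linarith
    qed
  qed
qed

section \<open>Block matrices\<close>

lemma sum_UNIV_Plus:
  fixes f :: "'x::finite + 'y::finite \<Rightarrow> 'a::comm_monoid_add"
  shows "(\<Sum>k\<in>UNIV. f k) = (\<Sum>i\<in>UNIV. f (Inl i)) + (\<Sum>j\<in>UNIV. f (Inr j))"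
  unfolding UNIV_Plus_UNIV[symmetric] by (subst sum.Plus) auto

lemma sub_xx_mult: "sub_xx (M ** N) = sub_xx M ** sub_xx N + sub_xy M ** sub_yx N"
  by (simp add: vec_eq_iff sub_xx_def sub_xy_def sub_yx_def matrix_matrix_mult_def sum_UNIV_Plus)

lemma sub_xy_mult: "sub_xy (M ** N) = sub_xx M ** sub_xy N + sub_xy M ** sub_yy N"
  by (simp add: vec_eq_iff sub_xx_def sub_xy_def sub_yy_def matrix_matrix_mult_def sum_UNIV_Plus)

lemma matrix_mult_zero [simp]:
  "0 ** (A :: 'a::semiring_1^'n^'m) = 0" "(A :: 'a::semiring_1^'n^'m) ** 0 = 0"
  by (simp_all add: vec_eq_iff matrix_matrix_mult_def)

lemma sub_blocks_mat_1: "sub_xx (mat 1) = mat 1" "sub_xy (mat 1) = 0"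
  by (simp_all add: vec_eq_iff sub_xx_def sub_xy_def mat_def)

lemma sub_xx_ctranspose: "sub_xx (ctranspose M) = ctranspose (sub_xx M)"
  and sub_yx_ctranspose: "sub_yx (ctranspose M) = ctranspose (sub_xy M)"
  by (simp_all add: vec_eq_iff sub_xx_def sub_xy_def sub_yx_def ctranspose_def)

lemma sub_xx_cmat: "sub_xx (cmat M) = cmat (sub_xx M)"
  by (simp add: vec_eq_iff sub_xx_def cmat_def)

lemma cmat_mult: "cmat (M ** N) = cmat M ** cmat N"
  by (simp add: vec_eq_iff cmat_def matrix_matrix_mult_def)

lemma cmat_mat_1: "cmat (mat 1) = mat 1"
  by (simp add: vec_eq_iff cmat_def mat_def)

lemma ctranspose_mult: "ctranspose (M ** N) = ctranspose N ** ctranspose M"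
  by (simp add: vec_eq_iff ctranspose_def matrix_matrix_mult_def mult.commute)

lemma ctranspose_cmat: "ctranspose (cmat M) = cmat (transpose M)"
  by (simp add: vec_eq_iff ctranspose_def cmat_def transpose_def)

lemma ctranspose_ctranspose [simp]: "ctranspose (ctranspose M) = M"
  by (simp add: vec_eq_iff ctranspose_def)

lemma ctranspose_mat_1 [simp]: "ctranspose (mat 1) = mat 1"
  by (simp add: vec_eq_iff ctranspose_def mat_def)

lemma ctranspose_zero [simp]: "ctranspose 0 = 0"
  by (simp add: vec_eq_iff ctranspose_def)

lemma det_ctranspose: "det (ctranspose M) = cnj (det M)"
proof -
  have "det (ctranspose M) = det (transpose (\<chi> i j. cnj (M $ i $ j)))"
    by (rule arg_cong[where f = det]) (simp add: vec_eq_iff ctranspose_def transpose_def)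
  also have "\<dots> = cnj (det M)"
    by (simp add: det_transpose) (simp add: det_def)
  finally show ?thesis .
qed

lemma det_hermitian_real: "ctranspose M = M \<Longrightarrow> complex_of_real (Re (det M)) = det M"
  using det_ctranspose[of M] by (simp add: complex_eq_iff)

lemma norm_trace_le:
  fixes M :: "'a::real_normed_field^'n^'n"
  shows "norm (trace M) \<le> real CARD('n) * norm M"
proof -
  have "norm (trace M) \<le> (\<Sum>i\<in>(UNIV::'n set). norm M)"
    unfolding trace_def
    by (rule sum_norm_le) (meson Finite_Cartesian_Product.norm_nth_le order_trans)
  then show ?thesis by simp
qed

lemma partial_cov_tendsto:
  assumes "(\<sigma> \<longlongrightarrow> S) F" "det (sub_xx S) \<noteq> 0"
  shows "((\<lambda>z. partial_cov (\<sigma> z)) \<longlongrightarrow> partial_cov S) F"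
  unfolding partial_cov_def by (intro tendsto_intros assms)

lemma pos_definite_sub_xx:
  assumes "pos_definite S"
  shows "pos_definite (sub_xx S)"
  unfolding pos_definite_def
proof (intro conjI allI impI)
  show "transpose (sub_xx S) = sub_xx S"
    using assms unfolding pos_definite_def by (auto simp: vec_eq_iff transpose_def sub_xx_def)
  fix v :: "real^'a" assume v: "v \<noteq> 0"
  define u :: "real^('a + 'b)" where "u = (\<chi> k. case k of Inl i \<Rightarrow> v $ i | Inr j \<Rightarrow> 0)"
  have "u \<noteq> 0"
  proof
    assume "u = 0"
    then have "v $ i = 0" for i by (metis u_def sum.case(1) vec_lambda_beta zero_index)
    then show False using v by (simp add: vec_eq_iff)
  qed
  then have "0 < u \<bullet> (S *v u)" using assms unfolding pos_definite_def by blast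
  also have "u \<bullet> (S *v u) = v \<bullet> (sub_xx S *v v)"
    by (simp add: inner_vec_def matrix_vector_mult_def sum_UNIV_Plus u_def sub_xx_def)
  finally show "0 < v \<bullet> (sub_xx S *v v)" .
qed

section \<open>First-order expansion of the log-determinant\<close>

text \<open>Product rule in the Leibniz formula. A permutation other than the identity moves at
  least two indices, so after one factor has been differentiated an off-diagonal zero of the
  identity matrix remains in the product.\<close>

lemma det_derivative:
  "((\<lambda>X. det (mat 1 - X)) has_derivative (\<lambda>H. - trace H)) (at (0 :: complex^'n^'n))"
proof -
  let ?U = "UNIV :: 'n set"
  let ?P = "{p. p permutes ?U}"
  have entry: "((\<lambda>X. (mat 1 - X) $ i $ j) has_derivative (\<lambda>H. - (H $ i $ j))) (at (0 :: complex^'n^'n))" for i j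
  proof -
    have bl: "bounded_linear (\<lambda>X :: complex^'n^'n. X $ i $ j)"
      by (rule bounded_linear_compose[OF bounded_linear_vec_nth bounded_linear_vec_nth])
    have "((\<lambda>X. mat 1 $ i $ j - X $ i $ j) has_derivative (\<lambda>H. 0 - H $ i $ j)) (at (0 :: complex^'n^'n))"
      by (intro has_derivative_diff has_derivative_const bounded_linear_imp_has_derivative bl)
    then show ?thesis by simp
  qed
  have "((\<lambda>X. det (mat 1 - X)) has_derivative (\<lambda>H. \<Sum>p\<in>?P. of_int (sign p) *
      (\<Sum>i\<in>?U. - (H $ i $ p i) * (\<Prod>j\<in>?U - {i}. (mat 1 - 0 :: complex^'n^'n) $ j $ p j)))) (at (0 :: complex^'n^'n))"
    unfolding det_def
    by (intro has_derivative_sum has_derivative_mult_right has_derivative_prod entry)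
  moreover have "(\<Sum>p\<in>?P. of_int (sign p) *
      (\<Sum>i\<in>?U. - (H $ i $ p i) * (\<Prod>j\<in>?U - {i}. (mat 1 - 0 :: complex^'n^'n) $ j $ p j))) = - trace H" for H :: "complex^'n^'n"
  proof -
    have zero: "(\<Prod>j\<in>?U - {i}. (mat 1 - 0 :: complex^'n^'n) $ j $ p j) = 0" if p: "p \<in> ?P" "p \<noteq> id" for p i
    proof -
      have "\<exists>j. j \<noteq> i \<and> p j \<noteq> j"
      proof (rule ccontr)
        assume "\<nexists>j. j \<noteq> i \<and> p j \<noteq> j"
        then have fix_j: "p j = j" if "j \<noteq> i" for j using that by blast
        moreover have "p i = i"
        proof (rule ccontr)
          assume "p i \<noteq> i"
          then have "p (p i) = p i" by (rule fix_j)
          then show False using p(1) \<open>p i \<noteq> i\<close> permutes_inj[of p ?U] by (auto dest: injD)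
        qed
        ultimately have "p = id" by (metis eq_id_iff)
        then show False using p(2) by simp
      qed
      then obtain j where "j \<noteq> i" "p j \<noteq> j" by blast
      then have "(mat 1 - 0 :: complex^'n^'n) $ j $ p j = 0" "j \<in> ?U - {i}" by (auto simp: mat_def)
      then show ?thesis by (auto intro!: prod_zero)
    qed
    have fin: "finite ?P" by (rule finite_permutations) simp
    have "(\<Sum>p\<in>?P. of_int (sign p) * (\<Sum>i\<in>?U. - (H $ i $ p i) * (\<Prod>j\<in>?U - {i}. (mat 1 - 0 :: complex^'n^'n) $ j $ p j))) =
        (\<Sum>p\<in>{id}. of_int (sign p) * (\<Sum>i\<in>?U. - (H $ i $ p i) * (\<Prod>j\<in>?U - {i}. (mat 1 - 0 :: complex^'n^'n) $ j $ p j)))"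
    proof (rule sum.mono_neutral_right)
      show "\<forall>p\<in>?P - {id}. of_int (sign p) * (\<Sum>i\<in>?U. - (H $ i $ p i) * (\<Prod>j\<in>?U - {i}. (mat 1 - 0 :: complex^'n^'n) $ j $ p j)) = 0"
      proof
        fix p assume "p \<in> ?P - {id}"
        then have z: "(\<Prod>j\<in>?U - {i}. (mat 1 - 0 :: complex^'n^'n) $ j $ p j) = 0" for i
          by (intro zero) auto
        show "of_int (sign p) * (\<Sum>i\<in>?U. - (H $ i $ p i) * (\<Prod>j\<in>?U - {i}. (mat 1 - 0 :: complex^'n^'n) $ j $ p j)) = 0"
          unfolding z by simp
      qed
    qed (auto simp: fin permutes_id)
    also have "\<dots> = - trace H"
      by (simp add: trace_def mat_def sum_negf)
    finally show ?thesis .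
  qed
  ultimately show ?thesis by simp
qed

text \<open>First order in \<open>X\<close> is enough for a second-order expansion of causality,
  because the \<open>X\<close> to be inserted is itself quadratic in the block
  \<open>sub_xy P\<close>.\<close>

lemma log_det_expansion:
  assumes "0 < e"
  obtains \<delta> where "0 < \<delta>" "\<And>X :: complex^'n^'n. norm X < \<delta> \<Longrightarrow>
    0 < Re (det (mat 1 - X)) \<and> \<bar>- ln (Re (det (mat 1 - X))) - Re (trace X)\<bar> \<le> e * norm X"
proof -
  let ?k = "\<lambda>X :: complex^'n^'n. - ln (Re (det (mat 1 - X)))"
  have d1: "((\<lambda>X :: complex^'n^'n. Re (det (mat 1 - X))) has_derivative (\<lambda>H. Re (- trace H))) (at 0)"
    by (intro bounded_linear.has_derivative[OF bounded_linear_Re] det_derivative)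
  have "(?k has_derivative (\<lambda>H. - (Re (- trace H) * inverse (Re (det (mat 1 - (0 :: complex^'n^'n))))))) (at 0)"
    by (rule has_derivative_minus[OF has_derivative_ln[OF _ d1]]) simp
  then have "(?k has_derivative (\<lambda>H. Re (trace H))) (at 0)" by simp
  then obtain d where d: "0 < d" "\<And>X. norm (X - 0) < d \<Longrightarrow> norm (?k X - ?k 0 - Re (trace (X - 0))) \<le> e * norm (X - 0)"
    using assms unfolding has_derivative_at_alt by blast
  have "isCont (\<lambda>X :: complex^'n^'n. Re (det (mat 1 - X))) 0"
    using d1 by (rule has_derivative_continuous)
  then have "\<forall>\<^sub>F X in nhds (0 :: complex^'n^'n). 0 < Re (det (mat 1 - X))"
    by (intro order_tendstoD(1)[where a = 0]) (auto simp: continuous_within tendsto_nhds_iff)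
  then obtain d' where d': "0 < d'" "\<And>X :: complex^'n^'n. norm X < d' \<Longrightarrow> 0 < Re (det (mat 1 - X))"
    unfolding eventually_nhds_metric by (auto simp: dist_norm)
  show ?thesis
    by (rule that[of "min d d'"]) (use d d' in \<open>auto simp: real_norm_def\<close>)
qed

section \<open>Quadratic approximation of spectral causality\<close>

text \<open>Spectral causality as a function of the matrix P = \<Phi>(\<omega>) alone, so that
  perturbing the coefficients and moving the frequency become the same kind of limit.\<close>

definition gc_of :: "complex^('x::finite + 'y::finite)^('x + 'y) \<Rightarrow> real^('x + 'y)^('x + 'y) \<Rightarrow> real" where
  "gc_of P S = (let \<Psi> = matrix_inv P; Sxx = sub_xx (\<Psi> ** cmat S ** ctranspose \<Psi>); Pxy = sub_xy \<Psi>
    in ln (Re (det Sxx) / Re (det (Sxx - Pxy ** cmat (partial_cov S) ** ctranspose Pxy))))"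

text \<open>The points at which \<open>gc_of\<close> is continuous in \<open>P\<close>, which later
  gives integrability over the band. Since division by zero yields zero, a positive ratio also says
  that its denominator does not vanish.\<close>

definition gc_regular :: "complex^('x::finite + 'y::finite)^('x + 'y) \<Rightarrow> real^('x + 'y)^('x + 'y) \<Rightarrow> bool" where
  "gc_regular P S \<longleftrightarrow> det P \<noteq> 0 \<and> det (sub_xx S) \<noteq> 0 \<and>
    (let \<Psi> = matrix_inv P; Sxx = sub_xx (\<Psi> ** cmat S ** ctranspose \<Psi>); Pxy = sub_xy \<Psi>
     in 0 < Re (det Sxx) / Re (det (Sxx - Pxy ** cmat (partial_cov S) ** ctranspose Pxy)))"

lemma spectral_gc_eq: "spectral_gc A S \<omega> = gc_of (var_Phi A \<omega>) S"
  by (simp add: spectral_gc_def gc_of_def cpsd_def transfer_def Let_def)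

lemma gc_of_tendsto:
  assumes "(P \<longlongrightarrow> P0) F" "gc_regular P0 S"
  shows "((\<lambda>z. gc_of (P z) S) \<longlongrightarrow> gc_of P0 S) F"
  using assms(2) unfolding gc_of_def gc_regular_def Let_def
  by (intro tendsto_ln tendsto_divide tendsto_Re tendsto_intros assms(1)) (auto simp: zero_less_divide_iff)

text \<open>
  Conjugating the residual term by \<open>P\<^sub>x\<^sub>x\<close> turns \<open>S\<^sub>x\<^sub>x\<^sup>-\<^sup>1\<close> into \<open>\<Sigma>\<^sub>x\<^sub>x\<^sup>-\<^sup>1\<close> in the limit, because
  \<open>S\<^sub>x\<^sub>x = P\<^sub>x\<^sub>x\<^sup>-\<^sup>1 \<Sigma>\<^sub>x\<^sub>x P\<^sub>x\<^sub>x\<^sup>-\<^sup>*\<close> under the null hypothesis.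
\<close>

lemma gc_of_expansion:
  fixes P :: "'z \<Rightarrow> complex^('x::finite + 'y::finite)^('x + 'y)"
  assumes P: "(P \<longlongrightarrow> P0) F" and \<sigma>: "(\<sigma> \<longlongrightarrow> S) F"
    and sym: "\<forall>\<^sub>F z in F. transpose (\<sigma> z) = \<sigma> z"
    and P0: "det P0 \<noteq> 0" "sub_xy P0 = 0" and S: "pos_definite S" and e: "0 < e"
  defines "W \<equiv> sub_yy (matrix_inv P0) ** cmat (partial_cov S) ** ctranspose (sub_yy (matrix_inv P0))"
  shows "\<forall>\<^sub>F z in F. gc_regular (P z) (\<sigma> z) \<and>
    \<bar>gc_of (P z) (\<sigma> z) - Re (trace (cmat (matrix_inv (sub_xx S)) ** sub_xy (P z) ** W ** ctranspose (sub_xy (P z))))\<bar>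
      \<le> e * (norm (sub_xy (P z)))\<^sup>2"
proof -
  define \<Psi> where "\<Psi> z = matrix_inv (P z)" for z
  define \<Psi>0 where "\<Psi>0 = matrix_inv P0"
  define Si where "Si = cmat (matrix_inv (sub_xx S))"
  define Q where "Q z = sub_xx (P z)" for z
  define Q0 where "Q0 = sub_xx P0"
  define B where "B z = sub_xy (P z)" for z
  define \<Sigma>p where "\<Sigma>p z = cmat (partial_cov (\<sigma> z))" for z
  define Sxx where "Sxx z = sub_xx (\<Psi> z ** cmat (\<sigma> z) ** ctranspose (\<Psi> z))" for z
  define Sxx0 where "Sxx0 = sub_xx (\<Psi>0 ** cmat S ** ctranspose \<Psi>0)"
  define R where "R z = sub_xy (\<Psi> z) ** \<Sigma>p z ** ctranspose (sub_xy (\<Psi> z))" for z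
  define X where "X z = matrix_inv (Sxx z) ** R z" for z
  \<comment> \<open>By cyclicity of the trace (\<open>trX\<close>), the trace of \<open>X\<close>
    equals that of C1 B C2 B^*. The smallness sits in the two factors B, while C1 and C2 converge to
    \<open>Si\<close> and \<open>W\<close>.\<close>
  define C1 where "C1 z = ctranspose (matrix_inv (Q z)) ** matrix_inv (Sxx z) ** matrix_inv (Q z)" for z
  define C2 where "C2 z = sub_yy (\<Psi> z) ** \<Sigma>p z ** ctranspose (sub_yy (\<Psi> z))" for z
  have dS: "det (sub_xx S) \<noteq> 0"
    by (intro pos_definite_det_nonzero pos_definite_sub_xx S)
  have cSi: "cmat (sub_xx S) ** Si = mat 1"
    unfolding Si_def cmat_mult[symmetric] by (simp add: matrix_inv_mult[OF dS] cmat_mat_1)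
  have P\<Psi>0: "P0 ** \<Psi>0 = mat 1" unfolding \<Psi>0_def by (rule matrix_inv_mult[OF P0(1)])
  have Q\<Psi>0: "Q0 ** sub_xx \<Psi>0 = mat 1"
    using arg_cong[OF P\<Psi>0, of sub_xx] P0(2)
    by (simp add: sub_xx_mult sub_blocks_mat_1 Q0_def)
  then have \<Psi>Q0: "sub_xx \<Psi>0 ** Q0 = mat 1" using matrix_left_right_inverse by blast
  have dQ0: "det Q0 \<noteq> 0" using Q\<Psi>0 by (rule det_nonzeroI)
  have Qi0: "matrix_inv Q0 = sub_xx \<Psi>0" using Q\<Psi>0 by (rule matrix_inv_eqI)
  \<comment> \<open>\<open>P0\<close> is block triangular, hence so is its inverse, with the inverse
    of \<open>Q0\<close> as its xx block.\<close>
  have "Q0 ** sub_xy \<Psi>0 = 0"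
    using arg_cong[OF P\<Psi>0, of sub_xy] P0(2)
    by (simp add: sub_xy_mult sub_blocks_mat_1 Q0_def)
  then have "sub_xx \<Psi>0 ** (Q0 ** sub_xy \<Psi>0) = 0" by simp
  then have \<Psi>xy0: "sub_xy \<Psi>0 = 0" by (simp add: matrix_mul_assoc \<Psi>Q0)
  have Sxx0: "Sxx0 = sub_xx \<Psi>0 ** cmat (sub_xx S) ** ctranspose (sub_xx \<Psi>0)"
  proof -
    have "sub_xx (\<Psi>0 ** cmat S ** ctranspose \<Psi>0) =
        (sub_xx \<Psi>0 ** cmat (sub_xx S) + 0 ** sub_yx (cmat S)) ** ctranspose (sub_xx \<Psi>0)
        + sub_xy (\<Psi>0 ** cmat S) ** ctranspose 0"
      by (simp only: sub_xx_mult sub_xx_ctranspose sub_yx_ctranspose \<Psi>xy0 sub_xx_cmat)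
    then show ?thesis
      unfolding Sxx0_def by (simp add: ctranspose_zero)
  qed
  have Sxx0_inv: "Sxx0 ** (ctranspose Q0 ** Si ** Q0) = mat 1"
  proof -
    have "Sxx0 ** (ctranspose Q0 ** Si ** Q0) =
        sub_xx \<Psi>0 ** (cmat (sub_xx S) ** (ctranspose (Q0 ** sub_xx \<Psi>0) ** Si)) ** Q0"
      unfolding Sxx0 ctranspose_mult by (simp only: matrix_mul_assoc)
    also have "\<dots> = mat 1" by (simp add: Q\<Psi>0 cSi \<Psi>Q0)
    finally show ?thesis .
  qed
  have dSxx0: "det Sxx0 \<noteq> 0" using Sxx0_inv by (rule det_nonzeroI)
  have C10: "ctranspose (matrix_inv Q0) ** matrix_inv Sxx0 ** matrix_inv Q0 = Si"
  proof -
    have "ctranspose (matrix_inv Q0) ** matrix_inv Sxx0 ** matrix_inv Q0 =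
        ctranspose (Q0 ** sub_xx \<Psi>0) ** Si ** (Q0 ** sub_xx \<Psi>0)"
      unfolding matrix_inv_eqI[OF Sxx0_inv] Qi0 ctranspose_mult by (simp only: matrix_mul_assoc)
    then show ?thesis by (simp add: Q\<Psi>0)
  qed
  have lims: "(\<Psi> \<longlongrightarrow> \<Psi>0) F" "(Q \<longlongrightarrow> Q0) F" "(\<Sigma>p \<longlongrightarrow> cmat (partial_cov S)) F"
    unfolding \<Psi>_def \<Psi>0_def Q_def Q0_def \<Sigma>p_def
    by (intro tendsto_matrix_inv tendsto_sub_blocks tendsto_cmat partial_cov_tendsto P \<sigma> P0 dS)+
  have lSxx: "(Sxx \<longlongrightarrow> Sxx0) F"
    unfolding Sxx_def Sxx0_def by (intro tendsto_intros lims \<sigma>)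
  have lC1: "(C1 \<longlongrightarrow> Si) F"
    unfolding C1_def C10[symmetric] by (intro tendsto_intros lims lSxx dSxx0 dQ0)
  have lC2: "(C2 \<longlongrightarrow> W) F"
    unfolding C2_def W_def \<Psi>0_def[symmetric] by (intro tendsto_intros lims)
  have lX: "(X \<longlongrightarrow> 0) F"
  proof -
    have "(X \<longlongrightarrow> matrix_inv Sxx0 ** (sub_xy \<Psi>0 ** cmat (partial_cov S) ** ctranspose (sub_xy \<Psi>0))) F"
      unfolding X_def R_def by (intro tendsto_intros lims lSxx dSxx0)
    then show ?thesis by (simp add: \<Psi>xy0)
  qed
  \<comment> \<open>A bound for the norm of \<open>X\<close> relative to the squared norm of
    \<open>B\<close> (\<open>Xnorm\<close>); it converges, so it is eventually below \<beta>0 +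
    1.\<close>
  define \<beta> where "\<beta> z = norm (matrix_inv (Sxx z)) * ((norm (matrix_inv (Q z)) * norm (sub_yy (\<Psi> z)))\<^sup>2 * norm (\<Sigma>p z))" for z
  define \<beta>0 where "\<beta>0 = norm (matrix_inv Sxx0) * ((norm (matrix_inv Q0) * norm (sub_yy \<Psi>0))\<^sup>2 * norm (cmat (partial_cov S)))"
  have l\<beta>: "(\<beta> \<longlongrightarrow> \<beta>0) F"
    unfolding \<beta>_def \<beta>0_def by (intro tendsto_intros lims lSxx dSxx0 dQ0)
  have \<beta>0: "0 \<le> \<beta>0" unfolding \<beta>0_def by simp
  define \<gamma> where "\<gamma> z = real CARD('x) * (norm (C1 z - Si) * norm (C2 z) + norm Si * norm (C2 z - W))" for z
  have l\<gamma>: "(\<gamma> \<longlongrightarrow> 0) F"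
  proof -
    have "(\<gamma> \<longlongrightarrow> real CARD('x) * (norm (Si - Si) * norm W + norm Si * norm (W - W))) F"
      unfolding \<gamma>_def by (intro tendsto_intros lC1 lC2)
    then show ?thesis by simp
  qed
  \<comment> \<open>Half of \<open>e\<close> pays for linearising the logarithm, where norm X <=
    (\<beta>0 + 1) |B|^2; the other half pays for replacing C1 and C2 by their limits.\<close>
  obtain \<delta> where \<delta>: "0 < \<delta>" "\<And>Y :: complex^'x^'x. norm Y < \<delta> \<Longrightarrow>
    0 < Re (det (mat 1 - Y)) \<and> \<bar>- ln (Re (det (mat 1 - Y))) - Re (trace Y)\<bar> \<le> (e / (2 * (\<beta>0 + 1))) * norm Y"
    using log_det_expansion[of "e / (2 * (\<beta>0 + 1))"] e \<beta>0 by auto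
  have ev: "\<forall>\<^sub>F z in F. det (P z) \<noteq> 0" "\<forall>\<^sub>F z in F. det (Q z) \<noteq> 0" "\<forall>\<^sub>F z in F. det (Sxx z) \<noteq> 0"
    "\<forall>\<^sub>F z in F. det (sub_xx (\<sigma> z)) \<noteq> 0"
    using tendsto_imp_eventually_ne[OF tendsto_det[OF P] P0(1)]
      tendsto_imp_eventually_ne[OF tendsto_det[OF lims(2)] dQ0]
      tendsto_imp_eventually_ne[OF tendsto_det[OF lSxx] dSxx0]
      tendsto_imp_eventually_ne[OF tendsto_det[OF tendsto_sub_blocks(1)[OF \<sigma>]] dS] by auto
  have ev2: "\<forall>\<^sub>F z in F. norm (X z) < \<delta>" "\<forall>\<^sub>F z in F. \<beta> z < \<beta>0 + 1" "\<forall>\<^sub>F z in F. \<gamma> z < e / 2"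
    using tendstoD[OF lX \<delta>(1)] order_tendstoD(2)[OF l\<beta>, of "\<beta>0 + 1"] order_tendstoD(2)[OF l\<gamma>, of "e / 2"] e
    by auto
  show ?thesis using ev ev2 sym
  proof eventually_elim
    case (elim z)
    \<comment> \<open>The xy block of P \<Psi> = 1. It makes the numerator perturbation
      \<open>R\<close> quadratic in \<open>B\<close>.\<close>
    have \<Psi>xy: "sub_xy (\<Psi> z) = - (matrix_inv (Q z) ** B z ** sub_yy (\<Psi> z))"
    proof -
      have "P z ** \<Psi> z = mat 1" unfolding \<Psi>_def by (rule matrix_inv_mult[OF elim(1)])
      then have "Q z ** sub_xy (\<Psi> z) + B z ** sub_yy (\<Psi> z) = 0"
        using sub_xy_mult[of "P z" "\<Psi> z"] by (simp add: Q_def B_def sub_blocks_mat_1)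
      then have eq: "Q z ** sub_xy (\<Psi> z) = - (B z ** sub_yy (\<Psi> z))" by (simp add: eq_neg_iff_add_eq_0)
      have "sub_xy (\<Psi> z) = matrix_inv (Q z) ** (Q z ** sub_xy (\<Psi> z))"
        by (simp add: matrix_mul_assoc matrix_inv_mult[OF elim(2)])
      also have "\<dots> = - (matrix_inv (Q z) ** (B z ** sub_yy (\<Psi> z)))"
        unfolding eq by (simp add: vec_eq_iff matrix_matrix_mult_def sum_negf)
      finally show ?thesis by (simp only: matrix_mul_assoc)
    qed
    have Xeq: "X z = matrix_inv (Sxx z) ** (matrix_inv (Q z) ** B z ** C2 z ** ctranspose (B z) ** ctranspose (matrix_inv (Q z)))"
    proof -
      let ?V = "matrix_inv (Q z) ** B z ** sub_yy (\<Psi> z)"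
      have "R z = ?V ** \<Sigma>p z ** ctranspose ?V"
        unfolding R_def \<Psi>xy by (simp add: vec_eq_iff matrix_matrix_mult_def ctranspose_def sum_negf)
      then show ?thesis unfolding X_def C2_def by (simp only: ctranspose_mult matrix_mul_assoc)
    qed
    have Xnorm: "norm (X z) \<le> \<beta> z * (norm (B z))\<^sup>2"
    proof -
      have v: "norm (sub_xy (\<Psi> z)) \<le> norm (matrix_inv (Q z)) * norm (B z) * norm (sub_yy (\<Psi> z))"
        unfolding \<Psi>xy norm_minus_cancel
        by (intro order_trans[OF norm_matrix_mult_le] mult_right_mono norm_matrix_mult_le) simp
      have "norm (R z) \<le> norm (sub_xy (\<Psi> z)) * norm (\<Sigma>p z) * norm (sub_xy (\<Psi> z))"
        unfolding R_def
        by (rule order_trans[OF norm_matrix_mult_le]) (simp add: mult_right_mono norm_matrix_mult_le)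
      also have "\<dots> = (norm (sub_xy (\<Psi> z)))\<^sup>2 * norm (\<Sigma>p z)" by (simp add: power2_eq_square)
      also have "\<dots> \<le> (norm (matrix_inv (Q z)) * norm (B z) * norm (sub_yy (\<Psi> z)))\<^sup>2 * norm (\<Sigma>p z)"
        by (intro mult_right_mono power_mono v) auto
      finally have "norm (X z) \<le> norm (matrix_inv (Sxx z)) *
          ((norm (matrix_inv (Q z)) * norm (B z) * norm (sub_yy (\<Psi> z)))\<^sup>2 * norm (\<Sigma>p z))"
        unfolding X_def by (intro order_trans[OF norm_matrix_mult_le] mult_left_mono) auto
      also have "\<dots> = \<beta> z * (norm (B z))\<^sup>2" by (simp add: \<beta>_def power_mult_distrib)
      finally show ?thesis .
    qed
    have trX: "trace (X z) = trace (C1 z ** B z ** C2 z ** ctranspose (B z))"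
    proof -
      have "trace (X z) = trace ((matrix_inv (Sxx z) ** matrix_inv (Q z) ** B z ** C2 z ** ctranspose (B z)) ** ctranspose (matrix_inv (Q z)))"
        unfolding Xeq by (simp only: matrix_mul_assoc)
      also have "\<dots> = trace (ctranspose (matrix_inv (Q z)) ** (matrix_inv (Sxx z) ** matrix_inv (Q z) ** B z ** C2 z ** ctranspose (B z)))"
        by (rule trace_mul_sym)
      finally show ?thesis unfolding C1_def by (simp only: matrix_mul_assoc)
    qed
    have tr_diff: "norm (trace (X z) - trace (Si ** B z ** W ** ctranspose (B z))) \<le> (e / 2) * (norm (B z))\<^sup>2"
    proof -
      have split: "C1 z ** B z ** C2 z ** ctranspose (B z) - Si ** B z ** W ** ctranspose (B z) =
          (C1 z - Si) ** B z ** C2 z ** ctranspose (B z) + Si ** B z ** (C2 z - W) ** ctranspose (B z)"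
        by (simp add: matrix_diff_mult matrix_mult_diff)
      have n3: "norm (M1 ** B z ** M2 ** ctranspose (B z)) \<le> norm M1 * norm M2 * (norm (B z))\<^sup>2" for M1 M2
      proof -
        have "norm (M1 ** B z ** M2 ** ctranspose (B z)) \<le> norm (M1 ** B z ** M2) * norm (B z)"
          using norm_matrix_mult_le[of "M1 ** B z ** M2" "ctranspose (B z)"] by simp
        also have "\<dots> \<le> (norm (M1 ** B z) * norm M2) * norm (B z)"
          by (intro mult_right_mono norm_matrix_mult_le) simp
        also have "\<dots> \<le> ((norm M1 * norm (B z)) * norm M2) * norm (B z)"
          by (intro mult_right_mono norm_matrix_mult_le) auto
        finally show ?thesis by (simp add: power2_eq_square mult_ac)
      qed
      have "norm (trace (X z) - trace (Si ** B z ** W ** ctranspose (B z))) =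
          norm (trace ((C1 z - Si) ** B z ** C2 z ** ctranspose (B z) + Si ** B z ** (C2 z - W) ** ctranspose (B z)))"
        unfolding trX trace_sub[symmetric] split ..
      also have "\<dots> \<le> real CARD('x) * norm ((C1 z - Si) ** B z ** C2 z ** ctranspose (B z) + Si ** B z ** (C2 z - W) ** ctranspose (B z))"
        by (rule norm_trace_le)
      also have "\<dots> \<le> real CARD('x) * (norm (C1 z - Si) * norm (C2 z) * (norm (B z))\<^sup>2 + norm Si * norm (C2 z - W) * (norm (B z))\<^sup>2)"
        by (intro mult_left_mono order_trans[OF norm_triangle_ineq] add_mono n3) simp
      also have "\<dots> = \<gamma> z * (norm (B z))\<^sup>2" by (simp add: \<gamma>_def algebra_simps)
      also have "\<dots> \<le> (e / 2) * (norm (B z))\<^sup>2" using elim by (intro mult_right_mono) auto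
      finally show ?thesis .
    qed
    \<comment> \<open>The real part of a determinant is multiplicative here only because det Sxx is
      real, which is where the symmetry of \<sigma> enters.\<close>
    have herm: "ctranspose (Sxx z) = Sxx z"
    proof -
      have "ctranspose (Sxx z) = sub_xx (ctranspose (\<Psi> z ** cmat (\<sigma> z) ** ctranspose (\<Psi> z)))"
        unfolding Sxx_def by (rule sub_xx_ctranspose[symmetric])
      also have "\<dots> = Sxx z"
        unfolding Sxx_def by (simp add: ctranspose_mult ctranspose_cmat elim matrix_mul_assoc)
      finally show ?thesis .
    qed
    have det_split: "Re (det (Sxx z - R z)) = Re (det (Sxx z)) * Re (det (mat 1 - X z))"
    proof -
      have "Sxx z - R z = Sxx z ** (mat 1 - X z)"
      proof -
        have "Sxx z ** (mat 1 - X z) = Sxx z ** mat 1 - Sxx z ** X z"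
          by (rule matrix_mult_diff)
        also have "Sxx z ** X z = R z"
          unfolding X_def by (simp add: matrix_mul_assoc matrix_inv_mult[OF elim(3)])
        finally show ?thesis by simp
      qed
      then have "det (Sxx z - R z) = of_real (Re (det (Sxx z))) * det (mat 1 - X z)"
        by (simp add: det_mul det_hermitian_real[OF herm])
      then show ?thesis by simp
    qed
    have d0: "Re (det (Sxx z)) \<noteq> 0"
      using det_hermitian_real[OF herm] elim(3) by (metis of_real_0)
    have exp1: "0 < Re (det (mat 1 - X z))"
      "\<bar>- ln (Re (det (mat 1 - X z))) - Re (trace (X z))\<bar> \<le> (e / (2 * (\<beta>0 + 1))) * norm (X z)"
      using \<delta>(2)[of "X z"] elim by auto
    have ratio: "Re (det (Sxx z)) / Re (det (Sxx z - R z)) = inverse (Re (det (mat 1 - X z)))"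
      unfolding det_split using d0 by (simp add: divide_simps)
    have gc: "gc_of (P z) (\<sigma> z) = - ln (Re (det (mat 1 - X z)))"
    proof -
      have "gc_of (P z) (\<sigma> z) = ln (Re (det (Sxx z)) / Re (det (Sxx z - R z)))"
        unfolding gc_of_def Let_def Sxx_def R_def \<Psi>_def \<Sigma>p_def ..
      then show ?thesis unfolding ratio using exp1(1) by (simp add: ln_inverse)
    qed
    have reg: "gc_regular (P z) (\<sigma> z)"
    proof -
      have "0 < Re (det (Sxx z)) / Re (det (Sxx z - R z))" unfolding ratio using exp1(1) by simp
      then show ?thesis
        unfolding gc_regular_def Let_def using elim(1,4) unfolding Sxx_def R_def \<Psi>_def \<Sigma>p_def by simp
    qed
    have "(e / (2 * (\<beta>0 + 1))) * norm (X z) \<le> (e / (2 * (\<beta>0 + 1))) * ((\<beta>0 + 1) * (norm (B z))\<^sup>2)"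
    proof (rule mult_left_mono)
      have "\<beta> z * (norm (B z))\<^sup>2 \<le> (\<beta>0 + 1) * (norm (B z))\<^sup>2" using elim by (intro mult_right_mono) auto
      then show "norm (X z) \<le> (\<beta>0 + 1) * (norm (B z))\<^sup>2" using Xnorm by linarith
    qed (use e \<beta>0 in simp)
    also have "\<dots> = (e / 2) * (norm (B z))\<^sup>2" using \<beta>0 by (simp add: field_simps)
    finally have fin: "(e / (2 * (\<beta>0 + 1))) * norm (X z) \<le> (e / 2) * (norm (B z))\<^sup>2" .
    have "\<bar>gc_of (P z) (\<sigma> z) - Re (trace (X z))\<bar> \<le> (e / 2) * (norm (B z))\<^sup>2"
      unfolding gc using exp1(2) fin by linarith
    moreover have "\<bar>Re (trace (X z)) - Re (trace (Si ** B z ** W ** ctranspose (B z)))\<bar> \<le> (e / 2) * (norm (B z))\<^sup>2"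
      using tr_diff abs_Re_le_cmod[of "trace (X z) - trace (Si ** B z ** W ** ctranspose (B z))"] by simp
    ultimately have "\<bar>gc_of (P z) (\<sigma> z) - Re (trace (Si ** B z ** W ** ctranspose (B z)))\<bar> \<le> e * (norm (B z))\<^sup>2"
      by linarith
    then show ?case using reg unfolding Si_def B_def by simp
  qed
qed

section \<open>The transfer function of a stable model\<close>

lemma lag_ge_1: "1 \<le> lag k"
  unfolding lag_def by (metis One_nat_def Suc_leI atMost_iff card_gt_0_iff empty_iff finite order_refl)

lemma lag_strict_mono: "a < b \<Longrightarrow> lag a < lag b"
  unfolding lag_def by (rule psubset_card_mono) auto

lemma lag_inj: "lag a = lag b \<longleftrightarrow> a = b"
  by (metis lag_strict_mono less_irrefl linorder_neqE)

lemma lag_le_card: "lag (k :: 'p::{finite,linorder}) \<le> CARD('p)"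
  unfolding lag_def by (rule card_mono) auto

lemma range_lag: "range (lag :: 'p::{finite,linorder} \<Rightarrow> nat) = {1..CARD('p)}"
proof (rule card_subset_eq)
  show "range (lag :: 'p \<Rightarrow> nat) \<subseteq> {1..CARD('p)}"
    by (rule image_subsetI) (simp only: atLeastAtMost_iff lag_ge_1 lag_le_card simp_thms)
  show "card (range (lag :: 'p \<Rightarrow> nat)) = card {1..CARD('p)}"
    using card_image[of "lag :: 'p \<Rightarrow> nat" UNIV] by (simp add: inj_on_def lag_inj)
qed simp

lemma lag_pred:
  fixes k :: "'p::{finite,linorder}"
  assumes "lag k \<noteq> 1"
  obtains k' :: 'p where "lag k = lag k' + 1"
proof -
  have "lag k - 1 \<in> {1..CARD('p)}"
    using assms lag_ge_1[of k] lag_le_card[of k] by auto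
  then obtain k' :: 'p where "lag k' = lag k - 1" unfolding range_lag[symmetric] by (metis imageE)
  then show ?thesis using lag_ge_1[of k] by (intro that[of k']) simp
qed

lemma companion_first_row:
  "lag k = 1 \<Longrightarrow> companion A $ (k, i) $ b = A $ fst b $ i $ snd b"
  by (simp add: companion_def)

lemma companion_shift_row:
  "lag k = lag k' + 1 \<Longrightarrow> companion A $ (k, i) $ b = (if b = (k', i) then 1 else 0)"
  using lag_ge_1[of k'] by (cases b) (auto simp: companion_def lag_inj)

definition phase :: "'p::{finite,linorder} \<Rightarrow> real \<Rightarrow> complex" where
  "phase k \<omega> = exp (- \<i> * of_real \<omega> * of_nat (lag k))"

lemma phase_eq_cis: "phase k \<omega> = cis (- \<omega> * real (lag k))"
  by (simp add: phase_def cis_conv_exp mult_ac)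

lemma norm_phase [simp]: "norm (phase k \<omega>) = 1"
  by (simp add: phase_eq_cis)

lemma tendsto_phase [tendsto_intros]: "(w \<longlongrightarrow> \<omega>) F \<Longrightarrow> ((\<lambda>z. phase k (w z)) \<longlongrightarrow> phase k \<omega>) F"
  unfolding phase_def by (intro tendsto_intros)

lemma phase_mult_cnj:
  "phase k \<omega> * cnj (phase k' \<omega>) = exp (- \<i> * of_real \<omega> * (of_nat (lag k) - of_nat (lag k')))"
proof -
  have "cnj (phase k' \<omega>) = exp (\<i> * of_real \<omega> * of_nat (lag k'))"
    by (simp add: phase_def exp_cnj)
  then show ?thesis by (simp add: phase_def exp_add[symmetric] algebra_simps)
qed

lemma var_Phi_nth: "var_Phi A \<omega> $ i $ j = mat 1 $ i $ j - (\<Sum>k\<in>UNIV. of_real (A $ k $ i $ j) * phase k \<omega>)"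
  by (simp add: var_Phi_def phase_def)

lemma tendsto_var_Phi:
  assumes "(a \<longlongrightarrow> A) F" "(w \<longlongrightarrow> \<omega>) F"
  shows "((\<lambda>z. var_Phi (a z) (w z)) \<longlongrightarrow> var_Phi A \<omega>) F"
  unfolding var_Phi_def phase_def[symmetric]
proof (intro tendsto_diff tendsto_const tendsto_sum mat_tendstoI)
  fix k i j
  have "((\<lambda>z. a z $ k $ i $ j) \<longlongrightarrow> A $ k $ i $ j) F" by (intro tendsto_vec_nth assms(1))
  then show "((\<lambda>z. (\<chi> i j. of_real (a z $ k $ i $ j) * phase k (w z)) $ i $ j) \<longlongrightarrow>
      (\<chi> i j. of_real (A $ k $ i $ j) * phase k \<omega>) $ i $ j) F"
    by (simp add: tendsto_mult tendsto_of_real tendsto_phase assms(2))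
qed

lemma sum_UNIV_Times: "(\<Sum>b\<in>UNIV. f b) = (\<Sum>k\<in>UNIV. \<Sum>j\<in>UNIV. f (k, j))"
  for f :: "'p::finite \<times> 'n::finite \<Rightarrow> 'a::comm_monoid_add"
  unfolding UNIV_Times_UNIV[symmetric] by (simp add: sum.cartesian_product)

text \<open>A kernel vector v of \<Phi>(\<omega>) would give an eigenvector of the companion matrix,
  with blocks exp(-i \<omega> k) v, for the eigenvalue exp(i \<omega>) on the unit circle.\<close>

lemma det_var_Phi_nonzero:
  fixes A :: "('p::{finite,linorder}, 'n::finite) var_coeffs"
  assumes "var_stable A"
  shows "det (var_Phi A \<omega>) \<noteq> 0"
proof (rule det_nonzero_ker)
  fix v assume v: "var_Phi A \<omega> *v v = 0"
  define u :: "complex^('p \<times> 'n)" where "u = (\<chi> b. phase (fst b) \<omega> * v $ snd b)"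
  have Av: "(\<Sum>k\<in>UNIV. \<Sum>j\<in>UNIV. of_real (A $ k $ i $ j) * (phase k \<omega> * v $ j)) = v $ i" for i
  proof -
    have "0 = (var_Phi A \<omega> *v v) $ i" using v by simp
    also have "\<dots> = (mat 1 *v v) $ i - (\<Sum>j\<in>UNIV. \<Sum>k\<in>UNIV. of_real (A $ k $ i $ j) * (phase k \<omega> * v $ j))"
      by (simp add: matrix_vector_mult_def var_Phi_nth left_diff_distrib sum_subtractf sum_distrib_right mult.assoc)
    finally show ?thesis by (subst sum.swap) simp
  qed
  have "(cmat (companion A) *v u) $ (k, i) = (cis \<omega> *s u) $ (k, i)" for k i
  proof (cases "lag k = 1")
    case True
    have "(cmat (companion A) *v u) $ (k, i) = v $ i"
      using Av[of i] by (simp add: matrix_vector_mult_def cmat_def companion_first_row[OF True] u_def sum_UNIV_Times)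
    moreover have "cis \<omega> * phase k \<omega> = 1"
      by (simp add: phase_eq_cis cis_mult True)
    then have "cis \<omega> * (phase k \<omega> * v $ i) = v $ i" by (simp add: mult.assoc[symmetric])
    ultimately show ?thesis by (simp add: u_def)
  next
    case False
    then obtain k' :: 'p where k': "lag k = lag k' + 1" by (rule lag_pred)
    have "(cmat (companion A) *v u) $ (k, i) = phase k' \<omega> * v $ i"
      by (simp add: matrix_vector_mult_def cmat_def companion_shift_row[OF k'] u_def if_distrib if_distribR cong: if_cong)
    moreover have "cis \<omega> * phase k \<omega> = phase k' \<omega>"
      by (simp add: phase_eq_cis cis_mult k' algebra_simps)
    then have "cis \<omega> * (phase k \<omega> * v $ i) = phase k' \<omega> * v $ i" by (simp add: mult.assoc[symmetric])
    ultimately show ?thesis by (auto simp: u_def)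
  qed
  then have ev: "cmat (companion A) *v u = cis \<omega> *s u" by (simp add: vec_eq_iff)
  have "u = 0"
  proof (rule ccontr)
    assume "u \<noteq> 0"
    then have "is_eigenvalue (cmat (companion A)) (cis \<omega>)" using ev unfolding is_eigenvalue_def by blast
    then show False using assms unfolding var_stable_def by fastforce
  qed
  have "v $ i = 0" for i
  proof -
    have "u $ (undefined, i) = 0" using \<open>u = 0\<close> by simp
    then have "phase (undefined :: 'p) \<omega> * v $ i = 0" by (simp add: u_def)
    then show ?thesis by (simp add: phase_def)
  qed
  then show "v = 0" by (simp add: vec_eq_iff)
qed

definition xy_coeffs :: "('p::{finite,linorder}, 'x::finite + 'y::finite) var_coeffs \<Rightarrow> real^('p \<times> 'y)^'x" where
  "xy_coeffs A = (\<chi> i b. A $ fst b $ Inl i $ Inr (snd b))"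

definition phase_sum :: "real^('p::{finite,linorder} \<times> 'y::finite) \<Rightarrow> real \<Rightarrow> complex^'y" where
  "phase_sum s \<omega> = (\<chi> v. \<Sum>k\<in>UNIV. of_real (s $ (k, v)) * phase k \<omega>)"

lemma sub_xy_var_Phi: "sub_xy (var_Phi A \<omega>) $ i = - phase_sum (xy_coeffs A $ i) \<omega>"
  by (simp add: vec_eq_iff sub_xy_def var_Phi_nth mat_def phase_sum_def xy_coeffs_def)

lemma norm_phase_sum_le:
  fixes s :: "real^('p::{finite,linorder} \<times> 'y::finite)"
  shows "norm (phase_sum s \<omega>) \<le> real CARD('y) * real CARD('p) * norm s"
proof -
  have "norm (phase_sum s \<omega> $ v) \<le> (\<Sum>k\<in>(UNIV :: 'p set). norm s)" for v
    unfolding phase_sum_def vec_lambda_beta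
  proof (rule sum_norm_le)
    fix k
    have "\<bar>s $ (k, v)\<bar> \<le> norm s" using Finite_Cartesian_Product.norm_nth_le[of s "(k, v)"] by simp
    then show "norm (of_real (s $ (k, v)) * phase k \<omega>) \<le> norm s" by (simp add: norm_mult)
  qed
  then have "norm (phase_sum s \<omega>) \<le> (\<Sum>v\<in>(UNIV :: 'y set). real CARD('p) * norm s)"
    unfolding norm_vec_def[of "phase_sum s \<omega>"]
    by (intro order_trans[OF L2_set_le_sum] sum_mono) auto
  then show ?thesis by simp
qed

lemma norm_sub_xy_var_Phi_le:
  fixes A :: "('p::{finite,linorder}, 'x::finite + 'y::finite) var_coeffs"
  shows "norm (sub_xy (var_Phi A \<omega>)) \<le> real CARD('x) * (real CARD('y) * real CARD('p)) * norm (xy_coeffs A)"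
proof -
  have "norm (sub_xy (var_Phi A \<omega>)) \<le> (\<Sum>i\<in>(UNIV :: 'x set). norm (sub_xy (var_Phi A \<omega>) $ i))"
    unfolding norm_vec_def[of "sub_xy (var_Phi A \<omega>)"] by (rule L2_set_le_sum) simp
  also have "\<dots> \<le> (\<Sum>i\<in>(UNIV :: 'x set). real CARD('y) * real CARD('p) * norm (xy_coeffs A))"
  proof (rule sum_mono)
    fix i :: 'x
    have "norm (sub_xy (var_Phi A \<omega>) $ i) \<le> real CARD('y) * real CARD('p) * norm (xy_coeffs A $ i)"
      unfolding sub_xy_var_Phi norm_minus_cancel by (rule norm_phase_sum_le)
    also have "\<dots> \<le> real CARD('y) * real CARD('p) * norm (xy_coeffs A)"
      by (intro mult_left_mono Finite_Cartesian_Product.norm_nth_le) simp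
    finally show "norm (sub_xy (var_Phi A \<omega>) $ i) \<le> real CARD('y) * real CARD('p) * norm (xy_coeffs A)" .
  qed
  finally show ?thesis by simp
qed

section \<open>Positivity of the quadratic form\<close>

text \<open>The Schur complement is the quadratic form of \<open>S\<close> with its x part minimised
  out. The vector \<open>u\<close> below is v completed by the minimiser -S_xx^-1 S_xy v, and the
  form of \<open>S\<close> at \<open>u\<close> is the claimed one at v.\<close>

lemma psd_partial_cov:
  assumes S: "pos_definite S"
  shows "psd (partial_cov (S :: real^('x::finite + 'y::finite)^('x + 'y)))"
  unfolding psd_def
proof (intro conjI allI)
  have sym: "S $ i $ j = S $ j $ i" for i j
    using psd_nth_commute[OF pos_definite_imp_psd[OF S]] .
  have tr: "transpose (sub_yx S) = sub_xy S" "transpose (sub_xy S) = sub_yx S" "transpose (sub_yy S) = sub_yy S"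
    using sym by (auto simp: vec_eq_iff transpose_def sub_yx_def sub_xy_def sub_yy_def)
  have pd: "pos_definite (sub_xx S)" using S by (rule pos_definite_sub_xx)
  then have d: "det (sub_xx S) \<noteq> 0" by (rule pos_definite_det_nonzero)
  have trxx: "transpose (sub_xx S) = sub_xx S" using pd unfolding pos_definite_def by blast
  have tri: "transpose (matrix_inv (sub_xx S)) = matrix_inv (sub_xx S)"
  proof -
    have "sub_xx S ** transpose (matrix_inv (sub_xx S)) = transpose (matrix_inv (sub_xx S) ** sub_xx S)"
      by (simp add: matrix_transpose_mul trxx)
    also have "\<dots> = mat 1" by (simp add: matrix_inv_mult[OF d])
    finally show ?thesis by (rule matrix_inv_eqI[symmetric])
  qed
  have tdiff: "transpose (M - N) = transpose M - transpose N" for M N :: "real^'y^'y"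
    by (simp add: vec_eq_iff transpose_def)
  show "transpose (partial_cov S) = partial_cov S"
    unfolding partial_cov_def by (simp add: tdiff matrix_transpose_mul tr tri matrix_mul_assoc)
  fix v
  define w where "w = matrix_inv (sub_xx S) *v (sub_xy S *v v)"
  define u :: "real^('x + 'y)" where "u = (\<chi> k. case k of Inl i \<Rightarrow> - w $ i | Inr j \<Rightarrow> v $ j)"
  have Sxx_w: "sub_xx S *v w = sub_xy S *v v"
    unfolding w_def by (simp add: matrix_vector_mul_assoc matrix_mul_assoc matrix_inv_mult[OF d])
  have up: "(S *v u) $ Inl i = - (sub_xx S *v w) $ i + (sub_xy S *v v) $ i" for i
    by (simp add: matrix_vector_mult_def sum_UNIV_Plus u_def sub_xx_def sub_xy_def sum_negf)
  have down: "(S *v u) $ Inr j = - (sub_yx S *v w) $ j + (sub_yy S *v v) $ j" for j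
    by (simp add: matrix_vector_mult_def sum_UNIV_Plus u_def sub_yx_def sub_yy_def sum_negf)
  have "0 \<le> u \<bullet> (S *v u)"
    using pos_definite_imp_psd[OF S] unfolding psd_def by blast
  also have "u \<bullet> (S *v u) = (\<Sum>i\<in>UNIV. - w $ i * (S *v u) $ Inl i) + (\<Sum>j\<in>UNIV. v $ j * (S *v u) $ Inr j)"
    by (simp add: inner_vec_def sum_UNIV_Plus u_def)
  also have "\<dots> = v \<bullet> (sub_yy S *v v - sub_yx S *v w)"
    unfolding up down Sxx_w by (simp add: inner_vec_def algebra_simps)
  also have "\<dots> = v \<bullet> (partial_cov S *v v)"
    unfolding partial_cov_def w_def
    by (simp add: matrix_vector_mult_diff_rdistrib matrix_vector_mul_assoc matrix_mul_assoc)
  finally show "0 \<le> v \<bullet> (partial_cov S *v v)" .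
qed

lemma block_Syy_x_nth:
  "block_Syy_x A S \<omega> $ a $ b = Syy_x A S \<omega> $ snd a $ snd b * (phase (fst a) \<omega> * cnj (phase (fst b) \<omega>))"
  unfolding phase_mult_cnj by (simp add: block_Syy_x_def)

text \<open>The block entries depend on the lags only through a product of phases, so the sums over
  lags factor into two trigonometric polynomials and a form in the y indices remains.\<close>

lemma block_Syy_x_form:
  fixes s t :: "real^('p::{finite,linorder} \<times> 'y::finite)"
  shows "(\<Sum>a\<in>UNIV. \<Sum>b\<in>UNIV. of_real (s $ a * t $ b) * block_Syy_x A S \<omega> $ a $ b) =
    (\<Sum>v\<in>UNIV. \<Sum>v'\<in>UNIV. phase_sum s \<omega> $ v * Syy_x A S \<omega> $ v $ v' * cnj (phase_sum t \<omega> $ v'))"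
proof -
  let ?f = "\<lambda>k v k' v'. (of_real (s $ (k, v)) * phase k \<omega>) * Syy_x A S \<omega> $ v $ v' * cnj (of_real (t $ (k', v')) * phase k' \<omega>)"
  have "(\<Sum>a\<in>UNIV. \<Sum>b\<in>UNIV. of_real (s $ a * t $ b) * block_Syy_x A S \<omega> $ a $ b) =
      (\<Sum>k\<in>UNIV. \<Sum>v\<in>UNIV. \<Sum>k'\<in>UNIV. \<Sum>v'\<in>UNIV. ?f k v k' v')"
    unfolding sum_UNIV_Times block_Syy_x_nth by (simp add: mult_ac)
  also have "\<dots> = (\<Sum>v\<in>UNIV. \<Sum>k\<in>UNIV. \<Sum>k'\<in>UNIV. \<Sum>v'\<in>UNIV. ?f k v k' v')"
    by (rule sum.swap)
  also have "\<dots> = (\<Sum>v\<in>UNIV. \<Sum>k\<in>UNIV. \<Sum>v'\<in>UNIV. \<Sum>k'\<in>UNIV. ?f k v k' v')"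
    by (intro sum.cong refl sum.swap)
  also have "\<dots> = (\<Sum>v\<in>UNIV. \<Sum>v'\<in>UNIV. \<Sum>k\<in>UNIV. \<Sum>k'\<in>UNIV. ?f k v k' v')"
    by (intro sum.cong refl sum.swap)
  also have "\<dots> = (\<Sum>v\<in>UNIV. \<Sum>v'\<in>UNIV. \<Sum>k'\<in>UNIV. \<Sum>k\<in>UNIV. ?f k v k' v')"
    by (intro sum.cong refl sum.swap)
  also have "\<dots> = (\<Sum>v\<in>UNIV. \<Sum>v'\<in>UNIV. phase_sum s \<omega> $ v * Syy_x A S \<omega> $ v $ v' * cnj (phase_sum t \<omega> $ v'))"
    unfolding phase_sum_def vec_lambda_beta cnj_sum sum_distrib_left sum_distrib_right
    by (intro sum.cong refl)
  finally show ?thesis .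
qed

text \<open>With u = \<Psi>_yy^T z the form becomes that of the partial covariance at
  \<open>u\<close>. Since that matrix is real, the real part splits into its form at Re u plus its
  form at Im u.\<close>

lemma Syy_x_form_nonneg:
  assumes S: "pos_definite S"
  shows "0 \<le> Re (\<Sum>v\<in>UNIV. \<Sum>v'\<in>UNIV. z $ v * Syy_x A S \<omega> $ v $ v' * cnj (z $ v'))"
proof -
  let ?\<Psi> = "sub_yy (transfer A \<omega>)" and ?P = "partial_cov S"
  let ?g = "\<lambda>v v' i j. (z $ v * ?\<Psi> $ v $ i) * of_real (?P $ i $ j) * cnj (z $ v' * ?\<Psi> $ v' $ j)"
  define u where "u = transpose ?\<Psi> *v z"
  have u: "u $ i = (\<Sum>v\<in>UNIV. z $ v * ?\<Psi> $ v $ i)" for i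
    by (simp add: u_def matrix_vector_mult_def transpose_def mult.commute del: transpose_matrix_vector)
  have "(\<Sum>v\<in>UNIV. \<Sum>v'\<in>UNIV. z $ v * Syy_x A S \<omega> $ v $ v' * cnj (z $ v')) =
      (\<Sum>v\<in>UNIV. \<Sum>v'\<in>UNIV. \<Sum>j\<in>UNIV. \<Sum>i\<in>UNIV. ?g v v' i j)"
    unfolding Syy_x_def matrix_matrix_mult_def ctranspose_def cmat_def vec_lambda_beta
      sum_distrib_left sum_distrib_right by (intro sum.cong refl) (simp add: mult_ac)
  also have "\<dots> = (\<Sum>v\<in>UNIV. \<Sum>j\<in>UNIV. \<Sum>v'\<in>UNIV. \<Sum>i\<in>UNIV. ?g v v' i j)"
    by (intro sum.cong refl sum.swap)
  also have "\<dots> = (\<Sum>v\<in>UNIV. \<Sum>j\<in>UNIV. \<Sum>i\<in>UNIV. \<Sum>v'\<in>UNIV. ?g v v' i j)"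
    by (intro sum.cong refl sum.swap)
  also have "\<dots> = (\<Sum>j\<in>UNIV. \<Sum>v\<in>UNIV. \<Sum>i\<in>UNIV. \<Sum>v'\<in>UNIV. ?g v v' i j)"
    by (rule sum.swap)
  also have "\<dots> = (\<Sum>j\<in>UNIV. \<Sum>i\<in>UNIV. \<Sum>v\<in>UNIV. \<Sum>v'\<in>UNIV. ?g v v' i j)"
    by (intro sum.cong refl sum.swap)
  also have "\<dots> = (\<Sum>j\<in>UNIV. \<Sum>i\<in>UNIV. \<Sum>v'\<in>UNIV. \<Sum>v\<in>UNIV. ?g v v' i j)"
    by (intro sum.cong refl sum.swap)
  also have "\<dots> = (\<Sum>j\<in>UNIV. \<Sum>i\<in>UNIV. u $ i * of_real (?P $ i $ j) * cnj (u $ j))"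
    unfolding u cnj_sum sum_distrib_left sum_distrib_right by (intro sum.cong refl)
  finally have eq: "(\<Sum>v\<in>UNIV. \<Sum>v'\<in>UNIV. z $ v * Syy_x A S \<omega> $ v $ v' * cnj (z $ v')) =
      (\<Sum>j\<in>UNIV. \<Sum>i\<in>UNIV. u $ i * of_real (?P $ i $ j) * cnj (u $ j))" .
  define re im where "re = (\<chi> i. Re (u $ i))" and "im = (\<chi> i. Im (u $ i))"
  have "Re (\<Sum>j\<in>UNIV. \<Sum>i\<in>UNIV. u $ i * of_real (?P $ i $ j) * cnj (u $ j)) =
      (\<Sum>j\<in>UNIV. \<Sum>i\<in>UNIV. re $ i * ?P $ i $ j * re $ j) + (\<Sum>j\<in>UNIV. \<Sum>i\<in>UNIV. im $ i * ?P $ i $ j * im $ j)"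
    unfolding Re_sum sum.distrib[symmetric] by (intro sum.cong refl) (simp add: re_def im_def algebra_simps)
  also have "\<dots> = re \<bullet> (?P *v re) + im \<bullet> (?P *v im)"
  proof -
    have "(\<Sum>j\<in>UNIV. \<Sum>i\<in>UNIV. w $ i * ?P $ i $ j * w $ j) = w \<bullet> (?P *v w)" for w
      unfolding quadratic_form_sum by (rule sum.swap)
    then show ?thesis by simp
  qed
  also have "0 \<le> \<dots>" using psd_partial_cov[OF S] unfolding psd_def by (intro add_nonneg_nonneg) auto
  finally show ?thesis unfolding eq .
qed

lemma Syy_x_hermitian:
  assumes S: "pos_definite S"
  shows "Syy_x A S \<omega> $ i $ j = cnj (Syy_x A S \<omega> $ j $ i)"
proof -
  have "transpose (partial_cov S) = partial_cov S" using psd_partial_cov[OF S] unfolding psd_def by blast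
  then have "ctranspose (Syy_x A S \<omega>) = Syy_x A S \<omega>"
    by (simp add: Syy_x_def ctranspose_mult ctranspose_cmat matrix_mul_assoc)
  then have "Syy_x A S \<omega> $ i $ j = ctranspose (Syy_x A S \<omega>) $ i $ j" by simp
  then show ?thesis by (simp add: ctranspose_def)
qed

section \<open>Integration over the frequency band\<close>

lemma set_integrable_continuous_on:
  fixes f :: "real \<Rightarrow> 'b::{banach, second_countable_topology}"
  assumes "continuous_on {a..b} f" "F \<in> sets lebesgue" "F \<subseteq> {a..b}"
  shows "set_integrable lebesgue F f"
proof -
  have "integrable lborel (\<lambda>x. indicator {a..b} x *\<^sub>R f x)"
    by (intro borel_integrable_compact assms(1)) simp
  then have "set_integrable lebesgue {a..b} f"
    unfolding set_integrable_def
    by (subst integrable_completion) (auto dest: borel_measurable_integrable)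
  then show ?thesis by (rule set_integrable_subset) (use assms in auto)
qed

lemma set_integral_vec_nth2:
  fixes f :: "real \<Rightarrow> complex^'n^'m"
  assumes "set_integrable lebesgue F f"
  shows "(LINT \<omega>:F|lebesgue. f \<omega>) $ a $ b = (LINT \<omega>:F|lebesgue. f \<omega> $ a $ b)"
proof -
  have bl: "bounded_linear (\<lambda>X :: complex^'n^'m. X $ a $ b)"
    by (rule bounded_linear_compose[OF bounded_linear_vec_nth bounded_linear_vec_nth])
  show ?thesis
    using integral_bounded_linear[OF bl assms[unfolded set_integrable_def]]
    unfolding set_lebesgue_integral_def by simp
qed

lemma set_integral_Re:
  fixes f :: "real \<Rightarrow> complex"
  assumes "set_integrable lebesgue F f"
  shows "Re (LINT \<omega>:F|lebesgue. f \<omega>) = (LINT \<omega>:F|lebesgue. Re (f \<omega>))"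
  using integral_bounded_linear[OF bounded_linear_Re assms[unfolded set_integrable_def]]
  unfolding set_lebesgue_integral_def by simp

lemma set_integral_double_sum:
  fixes f :: "'i \<Rightarrow> 'j \<Rightarrow> real \<Rightarrow> real"
  assumes "\<And>i j. set_integrable L F (f i j)"
  shows "(LINT \<omega>:F|L. (\<Sum>i\<in>I. \<Sum>j\<in>J. c i j * f i j \<omega>)) = (\<Sum>i\<in>I. \<Sum>j\<in>J. c i j * (LINT \<omega>:F|L. f i j \<omega>))"
proof -
  have int: "integrable L (\<lambda>\<omega>. c i j * (indicator F \<omega> *\<^sub>R f i j \<omega>))" for i j
    using assms unfolding set_integrable_def by (intro integrable_mult_right)
  have "(LINT \<omega>:F|L. (\<Sum>i\<in>I. \<Sum>j\<in>J. c i j * f i j \<omega>)) =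
      (LINT \<omega>|L. (\<Sum>i\<in>I. \<Sum>j\<in>J. c i j * (indicator F \<omega> *\<^sub>R f i j \<omega>)))"
    unfolding set_lebesgue_integral_def by (simp add: sum_distrib_left mult.left_commute)
  also have "\<dots> = (\<Sum>i\<in>I. \<Sum>j\<in>J. (LINT \<omega>|L. c i j * (indicator F \<omega> *\<^sub>R f i j \<omega>)))"
    by (simp only: Bochner_Integration.integral_sum Bochner_Integration.integrable_sum int)
  finally show ?thesis unfolding set_lebesgue_integral_def by simp
qed

text \<open>The tube lemma, for an arbitrary filter in place of the neighbourhoods of a point.\<close>

lemma eventually_ball_compact:
  fixes K :: "'b::topological_space set"
  assumes "compact K" and "\<And>y. y \<in> K \<Longrightarrow> \<forall>\<^sub>F z in F \<times>\<^sub>F nhds y. P (fst z) (snd z)"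
  shows "\<forall>\<^sub>F x in F. \<forall>y\<in>K. P x y"
proof -
  have "\<forall>y\<in>K. \<exists>Q W. eventually Q F \<and> open W \<and> y \<in> W \<and> (\<forall>x y'. Q x \<longrightarrow> y' \<in> W \<longrightarrow> P x y')"
  proof
    fix y assume "y \<in> K"
    from assms(2)[OF this] obtain Q R where QR: "eventually Q F" "eventually R (nhds y)"
      "\<And>x y'. Q x \<Longrightarrow> R y' \<Longrightarrow> P x y'"
      unfolding eventually_prod_filter by auto
    then obtain W where "open W" "y \<in> W" "\<And>y'. y' \<in> W \<Longrightarrow> R y'" unfolding eventually_nhds by blast
    then show "\<exists>Q W. eventually Q F \<and> open W \<and> y \<in> W \<and> (\<forall>x y'. Q x \<longrightarrow> y' \<in> W \<longrightarrow> P x y')"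
      using QR by blast
  qed
  then obtain Q W where QW: "\<And>y. y \<in> K \<Longrightarrow> eventually (Q y) F" "\<And>y. y \<in> K \<Longrightarrow> open (W y)"
    "\<And>y. y \<in> K \<Longrightarrow> y \<in> W y" "\<And>y x y'. y \<in> K \<Longrightarrow> Q y x \<Longrightarrow> y' \<in> W y \<Longrightarrow> P x y'"
    by metis
  obtain C where C: "C \<subseteq> K" "finite C" "K \<subseteq> (\<Union>y\<in>C. W y)"
    by (rule compactE_image[OF assms(1), of K W]) (use QW in auto)
  have "\<forall>\<^sub>F x in F. \<forall>y\<in>C. Q y x"
    using C QW by (intro eventually_ball_finite) auto
  then show ?thesis
    by (rule eventually_mono) (use C QW(4) in blast)
qed

section \<open>Expansion of the band-limited causality around a parameter satisfying the null
  hypothesis\<close>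

locale null_model =
  fixes A :: "('p::{finite,linorder}, 'x::finite + 'y::finite) var_coeffs"
    and S :: "real^('x + 'y)^('x + 'y)" and F :: "real set"
  assumes null: "(A, S) \<in> null_params"
    and F: "F \<in> sets lebesgue" "F \<subseteq> {0..2 * pi}" "measure lebesgue F > 0"
begin

lemma stable: "var_stable A" and pos_def: "pos_definite S" and xy_zero: "sub_xy (A $ k) = 0"
  using null unfolding null_params_def var_params_def by auto

definition Sxx_inv :: "real^'x^'x" where "Sxx_inv = matrix_inv (sub_xx S)"

definition gc_form :: "real^('p \<times> 'y)^('p \<times> 'y)" where "gc_form = Re_mat (band_block_Syy_x F A S)"

text \<open>The trace of Sxx_inv T gc_form T^T written in entries. At the x-from-y coefficients of
  the estimate it is the second-order approximation of band-limited causality.\<close>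

definition gc_quad :: "real^('p \<times> 'y)^'x \<Rightarrow> real" where
  "gc_quad T = (\<Sum>i\<in>UNIV. \<Sum>j\<in>UNIV. Sxx_inv $ i $ j * (T $ j \<bullet> (gc_form *v T $ i)))"

lemma tendsto_Syy_x:
  assumes "(w \<longlongrightarrow> \<omega>) G"
  shows "((\<lambda>z. Syy_x A S (w z)) \<longlongrightarrow> Syy_x A S \<omega>) G"
  unfolding Syy_x_def transfer_def
  by (intro tendsto_intros tendsto_var_Phi assms det_var_Phi_nonzero stable)

lemma continuous_block: "continuous_on {0..2 * pi} (\<lambda>\<omega>. block_Syy_x A S \<omega>)"
  unfolding continuous_on_def block_Syy_x_def[abs_def]
proof (intro ballI mat_tendstoI)
  fix \<omega> and a b :: "'p \<times> 'y"
  show "((\<lambda>\<omega>. (\<chi> a b. Syy_x A S \<omega> $ snd a $ snd b *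
      exp (- \<i> * of_real \<omega> * (of_nat (lag (fst a)) - of_nat (lag (fst b))))) $ a $ b) \<longlongrightarrow>
      (\<chi> a b. Syy_x A S \<omega> $ snd a $ snd b *
      exp (- \<i> * of_real \<omega> * (of_nat (lag (fst a)) - of_nat (lag (fst b))))) $ a $ b) (at \<omega> within {0..2 * pi})"
    unfolding vec_lambda_beta by (intro tendsto_intros tendsto_vec_nth2 tendsto_Syy_x)
qed

lemma set_integrable_block: "set_integrable lebesgue F (\<lambda>\<omega>. block_Syy_x A S \<omega>)"
  by (rule set_integrable_continuous_on[OF continuous_block F(1,2)])

lemma set_integrable_block_nth: "set_integrable lebesgue F (\<lambda>\<omega>. block_Syy_x A S \<omega> $ a $ b)"
  by (rule set_integrable_continuous_on[OF _ F(1,2)]) (intro continuous_intros continuous_block)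

lemma set_integrable_Re_block_nth: "set_integrable lebesgue F (\<lambda>\<omega>. Re (block_Syy_x A S \<omega> $ a $ b))"
  by (rule set_integrable_continuous_on[OF _ F(1,2)]) (intro continuous_intros continuous_block)

lemma gc_form_nth:
  "gc_form $ a $ b = (1 / measure lebesgue F) * (LINT \<omega>:F|lebesgue. Re (block_Syy_x A S \<omega> $ a $ b))"
  unfolding gc_form_def band_block_Syy_x_def Re_mat_def
  by (simp add: set_integral_vec_nth2[OF set_integrable_block] set_integral_Re[OF set_integrable_block_nth])

lemma gc_form_bilinear:
  "s \<bullet> (gc_form *v t) = (1 / measure lebesgue F) *
    (LINT \<omega>:F|lebesgue. Re (\<Sum>a\<in>UNIV. \<Sum>b\<in>UNIV. of_real (s $ a * t $ b) * block_Syy_x A S \<omega> $ a $ b))"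
proof -
  have "(LINT \<omega>:F|lebesgue. Re (\<Sum>a\<in>UNIV. \<Sum>b\<in>UNIV. of_real (s $ a * t $ b) * block_Syy_x A S \<omega> $ a $ b)) =
      (LINT \<omega>:F|lebesgue. (\<Sum>a\<in>UNIV. \<Sum>b\<in>UNIV. (s $ a * t $ b) * Re (block_Syy_x A S \<omega> $ a $ b)))"
    by simp
  also have "\<dots> = (\<Sum>a\<in>UNIV. \<Sum>b\<in>UNIV. (s $ a * t $ b) * (LINT \<omega>:F|lebesgue. Re (block_Syy_x A S \<omega> $ a $ b)))"
    by (rule set_integral_double_sum[OF set_integrable_Re_block_nth])
  finally show ?thesis
    unfolding quadratic_form_sum gc_form_nth by (simp add: sum_distrib_left mult_ac)
qed

lemma psd_gc_form: "psd gc_form"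
  unfolding psd_def
proof (intro conjI allI)
  have "Re (block_Syy_x A S \<omega> $ a $ b) = Re (block_Syy_x A S \<omega> $ b $ a)" for \<omega> a b
  proof -
    have "block_Syy_x A S \<omega> $ a $ b = cnj (block_Syy_x A S \<omega> $ b $ a)"
      unfolding block_Syy_x_nth using Syy_x_hermitian[OF pos_def, of A \<omega> "snd a" "snd b"] by (simp add: mult_ac)
    then show ?thesis by simp
  qed
  then show "transpose gc_form = gc_form" by (simp add: vec_eq_iff transpose_def gc_form_nth)
  fix v
  have "0 \<le> (LINT \<omega>:F|lebesgue. Re (\<Sum>a\<in>UNIV. \<Sum>b\<in>UNIV. of_real (v $ a * v $ b) * block_Syy_x A S \<omega> $ a $ b))"
    unfolding set_lebesgue_integral_def block_Syy_x_form
    by (intro Bochner_Integration.integral_nonneg scaleR_nonneg_nonneg Syy_x_form_nonneg pos_def) simp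
  then show "0 \<le> v \<bullet> (gc_form *v v)"
    unfolding gc_form_bilinear using F(3) by simp
qed

definition local_quad :: "real^('p \<times> 'y)^'x \<Rightarrow> real \<Rightarrow> real" where
  "local_quad T \<omega> = (\<Sum>i\<in>UNIV. \<Sum>j\<in>UNIV. Sxx_inv $ i $ j *
    Re (\<Sum>a\<in>UNIV. \<Sum>b\<in>UNIV. of_real (T $ j $ a * T $ i $ b) * block_Syy_x A S \<omega> $ a $ b))"

lemma local_quad_trace:
  "local_quad (xy_coeffs a) \<omega> = Re (trace (cmat Sxx_inv ** sub_xy (var_Phi a \<omega>) ** Syy_x A S \<omega> ** ctranspose (sub_xy (var_Phi a \<omega>))))"
proof -
  let ?B = "sub_xy (var_Phi a \<omega>)" and ?W = "Syy_x A S \<omega>"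
  have B: "?B $ i $ v = - phase_sum (xy_coeffs a $ i) \<omega> $ v" for i v
    by (simp add: sub_xy_var_Phi)
  have inner: "(?B ** ?W ** ctranspose ?B) $ j $ i =
      (\<Sum>u\<in>UNIV. \<Sum>b\<in>UNIV. of_real (xy_coeffs a $ j $ u * xy_coeffs a $ i $ b) * block_Syy_x A S \<omega> $ u $ b)" for i j
  proof -
    have "(?B ** ?W ** ctranspose ?B) $ j $ i = (\<Sum>v'\<in>UNIV. \<Sum>v\<in>UNIV. ?B $ j $ v * ?W $ v $ v' * cnj (?B $ i $ v'))"
      by (simp add: matrix_matrix_mult_def ctranspose_def sum_distrib_right)
    also have "\<dots> = (\<Sum>v\<in>UNIV. \<Sum>v'\<in>UNIV. ?B $ j $ v * ?W $ v $ v' * cnj (?B $ i $ v'))"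
      by (rule sum.swap)
    finally show ?thesis unfolding block_Syy_x_form B by simp
  qed
  have "trace (cmat Sxx_inv ** ?B ** ?W ** ctranspose ?B) = trace (cmat Sxx_inv ** (?B ** ?W ** ctranspose ?B))"
    by (simp only: matrix_mul_assoc)
  also have "\<dots> = (\<Sum>i\<in>UNIV. \<Sum>j\<in>UNIV. of_real (Sxx_inv $ i $ j) * (?B ** ?W ** ctranspose ?B) $ j $ i)"
  proof -
    have "cmat Sxx_inv $ i $ j = of_real (Sxx_inv $ i $ j)" for i j by (simp add: cmat_def)
    then show ?thesis unfolding trace_def matrix_matrix_mult_def[of "cmat Sxx_inv"] by simp
  qed
  also have "Re \<dots> = local_quad (xy_coeffs a) \<omega>"
    unfolding inner local_quad_def Re_sum by simp
  finally show ?thesis ..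
qed

lemma set_integrable_local_quad: "set_integrable lebesgue F (local_quad T)"
  unfolding local_quad_def[abs_def]
  by (rule set_integrable_continuous_on[OF _ F(1,2)]) (intro continuous_intros continuous_block)

lemma gc_quad_integral: "gc_quad T = (1 / measure lebesgue F) * (LINT \<omega>:F|lebesgue. local_quad T \<omega>)"
proof -
  have int: "set_integrable lebesgue F (\<lambda>\<omega>. Re (\<Sum>a\<in>UNIV. \<Sum>b\<in>UNIV. of_real (s $ a * t $ b) * block_Syy_x A S \<omega> $ a $ b))"
    for s t :: "real^('p \<times> 'y)"
    by (rule set_integrable_continuous_on[OF _ F(1,2)]) (intro continuous_intros continuous_block)
  have "(LINT \<omega>:F|lebesgue. local_quad T \<omega>) = (\<Sum>i\<in>UNIV. \<Sum>j\<in>UNIV. Sxx_inv $ i $ j *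
      (LINT \<omega>:F|lebesgue. Re (\<Sum>a\<in>UNIV. \<Sum>b\<in>UNIV. of_real (T $ j $ a * T $ i $ b) * block_Syy_x A S \<omega> $ a $ b)))"
    unfolding local_quad_def by (rule set_integral_double_sum[OF int])
  then show ?thesis
    unfolding gc_quad_def gc_form_bilinear by (simp add: sum_distrib_left mult_ac)
qed

text \<open>Uniformity comes from letting the estimate and the frequency vary together: around each
  frequency the expansion holds along the product of \<open>G\<close> with the neighbourhood filter,
  and compactness of the interval joins finitely many of these pieces.\<close>

lemma spectral_gc_expansion:
  fixes a :: "'z \<Rightarrow> ('p, 'x + 'y) var_coeffs"
  assumes a: "(a \<longlongrightarrow> A) G" and \<sigma>: "(\<sigma> \<longlongrightarrow> S) G" and sym: "\<forall>\<^sub>F z in G. transpose (\<sigma> z) = \<sigma> z" and e: "0 < e"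
  shows "\<forall>\<^sub>F z in G. \<forall>\<omega>\<in>{0..2 * pi}. gc_regular (var_Phi (a z) \<omega>) (\<sigma> z) \<and>
    \<bar>spectral_gc (a z) (\<sigma> z) \<omega> - local_quad (xy_coeffs (a z)) \<omega>\<bar> \<le> e * (norm (sub_xy (var_Phi (a z) \<omega>)))\<^sup>2"
proof (rule eventually_ball_compact)
  fix \<omega> assume "\<omega> \<in> {0..2 * pi}"
  let ?H = "G \<times>\<^sub>F nhds \<omega>"
  let ?B = "\<lambda>z. sub_xy (var_Phi (a (fst z)) (snd z))"
  have la: "((\<lambda>z. a (fst z)) \<longlongrightarrow> A) ?H" "((\<lambda>z. \<sigma> (fst z)) \<longlongrightarrow> S) ?H" "(snd \<longlongrightarrow> \<omega>) ?H"
    using filterlim_compose[OF a filterlim_fst] filterlim_compose[OF \<sigma> filterlim_fst] filterlim_snd by auto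
  have lP: "((\<lambda>z. var_Phi (a (fst z)) (snd z)) \<longlongrightarrow> var_Phi A \<omega>) ?H"
    by (intro tendsto_var_Phi la)
  have sym': "\<forall>\<^sub>F z in ?H. transpose (\<sigma> (fst z)) = \<sigma> (fst z)"
    using sym filterlim_fst unfolding filterlim_iff by blast
  have xy0: "sub_xy (var_Phi A \<omega>) = 0"
  proof -
    have "A $ k $ Inl i $ Inr j = 0" for k i j
      using arg_cong[OF xy_zero[of k], of "\<lambda>M. M $ i $ j"] by (simp add: sub_xy_def)
    then show ?thesis by (simp add: vec_eq_iff sub_xy_def var_Phi_nth mat_def)
  qed
  \<comment> \<open>The expansion freezes the spectral factor at the centre \<omega>, whereas
    \<open>local_quad\<close> uses the moving frequency. The exchange costs at most this constant
    times the change of \<open>Syy_x\<close>, for which e/2 is reserved.\<close>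
  let ?c = "real CARD('x) * norm (cmat Sxx_inv)"
  have "((\<lambda>z. ?c * norm (Syy_x A S (snd z) - Syy_x A S \<omega>)) \<longlongrightarrow> ?c * norm (Syy_x A S \<omega> - Syy_x A S \<omega>)) ?H"
    by (intro tendsto_intros tendsto_Syy_x la)
  then have evW: "\<forall>\<^sub>F z in ?H. ?c * norm (Syy_x A S (snd z) - Syy_x A S \<omega>) < e / 2"
    by (rule order_tendstoD) (use e in simp)
  have "\<forall>\<^sub>F z in ?H. gc_regular (var_Phi (a (fst z)) (snd z)) (\<sigma> (fst z)) \<and>
    \<bar>gc_of (var_Phi (a (fst z)) (snd z)) (\<sigma> (fst z)) - Re (trace (cmat Sxx_inv ** ?B z ** Syy_x A S \<omega> ** ctranspose (?B z)))\<bar>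
      \<le> (e / 2) * (norm (?B z))\<^sup>2"
    using gc_of_expansion[OF lP la(2) sym' det_var_Phi_nonzero[OF stable] xy0 pos_def, of "e / 2"] e
    unfolding Sxx_inv_def Syy_x_def transfer_def by simp
  then show "\<forall>\<^sub>F z in ?H. gc_regular (var_Phi (a (fst z)) (snd z)) (\<sigma> (fst z)) \<and>
    \<bar>spectral_gc (a (fst z)) (\<sigma> (fst z)) (snd z) - local_quad (xy_coeffs (a (fst z))) (snd z)\<bar> \<le> e * (norm (?B z))\<^sup>2"
    using evW
  proof eventually_elim
    case (elim z)
    let ?D = "Syy_x A S (snd z) - Syy_x A S \<omega>"
    have "cmat Sxx_inv ** ?B z ** Syy_x A S (snd z) ** ctranspose (?B z) - cmat Sxx_inv ** ?B z ** Syy_x A S \<omega> ** ctranspose (?B z)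
        = cmat Sxx_inv ** ?B z ** ?D ** ctranspose (?B z)"
      by (simp add: matrix_diff_mult matrix_mult_diff)
    then have "local_quad (xy_coeffs (a (fst z))) (snd z) - Re (trace (cmat Sxx_inv ** ?B z ** Syy_x A S \<omega> ** ctranspose (?B z))) =
        Re (trace (cmat Sxx_inv ** ?B z ** ?D ** ctranspose (?B z)))"
      unfolding local_quad_trace by (metis minus_complex.sel(1) trace_sub)
    also have "\<bar>\<dots>\<bar> \<le> norm (trace (cmat Sxx_inv ** ?B z ** ?D ** ctranspose (?B z)))"
      by (rule abs_Re_le_cmod)
    also have "\<dots> \<le> real CARD('x) * norm (cmat Sxx_inv ** ?B z ** ?D ** ctranspose (?B z))"
      by (rule norm_trace_le)
    also have "\<dots> \<le> real CARD('x) * (norm (cmat Sxx_inv) * norm (?B z) * norm ?D * norm (ctranspose (?B z)))"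
      by (intro mult_left_mono order_trans[OF norm_matrix_mult_le] mult_right_mono norm_matrix_mult_le) auto
    also have "\<dots> = (?c * norm ?D) * (norm (?B z))\<^sup>2" by (simp add: power2_eq_square)
    also have "\<dots> \<le> (e / 2) * (norm (?B z))\<^sup>2" using elim by (intro mult_right_mono) auto
    finally have "\<bar>local_quad (xy_coeffs (a (fst z))) (snd z) - Re (trace (cmat Sxx_inv ** ?B z ** Syy_x A S \<omega> ** ctranspose (?B z)))\<bar>
      \<le> (e / 2) * (norm (?B z))\<^sup>2" .
    moreover have "\<bar>spectral_gc (a (fst z)) (\<sigma> (fst z)) (snd z) - Re (trace (cmat Sxx_inv ** ?B z ** Syy_x A S \<omega> ** ctranspose (?B z)))\<bar>
      \<le> (e / 2) * (norm (?B z))\<^sup>2" using elim unfolding spectral_gc_eq by blast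
    ultimately show ?case using elim by linarith
  qed
qed simp

theorem band_gc_expansion:
  fixes a :: "'z \<Rightarrow> ('p, 'x + 'y) var_coeffs"
  assumes a: "(a \<longlongrightarrow> A) G" and \<sigma>: "(\<sigma> \<longlongrightarrow> S) G" and sym: "\<forall>\<^sub>F z in G. transpose (\<sigma> z) = \<sigma> z" and e: "0 < e"
  shows "\<forall>\<^sub>F z in G. \<bar>band_gc F (a z) (\<sigma> z) - gc_quad (xy_coeffs (a z))\<bar> \<le> e * (norm (xy_coeffs (a z)))\<^sup>2"
proof -
  \<comment> \<open>The constant of \<open>norm_sub_xy_var_Phi_le\<close>. Starting from e/c^2 turns
    the bound at each frequency into one by the norm of the coefficients.\<close>
  define c where "c = real CARD('x) * (real CARD('y) * real CARD('p))"
  have c: "0 < c" unfolding c_def by simp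
  have "0 < e / c\<^sup>2" using e c by simp
  from spectral_gc_expansion[OF a \<sigma> sym this] show ?thesis
  proof eventually_elim
    case (elim z)
    let ?f = "spectral_gc (a z) (\<sigma> z)" and ?q = "local_quad (xy_coeffs (a z))"
    let ?r = "e * (norm (xy_coeffs (a z)))\<^sup>2"
    have "continuous_on {0..2 * pi} ?f"
      unfolding continuous_on_def spectral_gc_eq
      by (intro ballI gc_of_tendsto tendsto_var_Phi tendsto_const tendsto_ident_at) (use elim in auto)
    then have f_int: "set_integrable lebesgue F ?f"
      by (rule set_integrable_continuous_on[OF _ F(1,2)])
    have le: "\<bar>?f \<omega> - ?q \<omega>\<bar> \<le> ?r" if "\<omega> \<in> F" for \<omega>
    proof -
      have "\<bar>?f \<omega> - ?q \<omega>\<bar> \<le> (e / c\<^sup>2) * (norm (sub_xy (var_Phi (a z) \<omega>)))\<^sup>2"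
        using elim that F(2) by auto
      also have "\<dots> \<le> (e / c\<^sup>2) * (c * norm (xy_coeffs (a z)))\<^sup>2"
        using e by (intro mult_left_mono power_mono) (auto simp: c_def norm_sub_xy_var_Phi_le)
      also have "\<dots> = ?r" using c by (simp add: power_mult_distrib)
      finally show ?thesis .
    qed
    have "\<bar>(LINT \<omega>:F|lebesgue. ?f \<omega>) - (LINT \<omega>:F|lebesgue. ?q \<omega>)\<bar> = \<bar>LINT \<omega>:F|lebesgue. ?f \<omega> - ?q \<omega>\<bar>"
      by (simp add: set_integral_diff(2)[OF f_int set_integrable_local_quad])
    also have "\<dots> \<le> (LINT \<omega>|lebesgue. norm (indicator F \<omega> *\<^sub>R (?f \<omega> - ?q \<omega>)))"
      unfolding set_lebesgue_integral_def using integral_norm_bound[of lebesgue "\<lambda>\<omega>. indicator F \<omega> *\<^sub>R (?f \<omega> - ?q \<omega>)"] by simp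
    also have "\<dots> \<le> (LINT \<omega>|lebesgue. ?r * indicator F \<omega>)"
    proof (rule integral_mono)
      show "integrable lebesgue (\<lambda>\<omega>. norm (indicator F \<omega> *\<^sub>R (?f \<omega> - ?q \<omega>)))"
        using set_integral_diff(1)[OF f_int set_integrable_local_quad] unfolding set_integrable_def
        by (rule integrable_norm)
      \<comment> \<open>The real-valued measure of a set of infinite measure is 0 by convention, so
        its positivity implies finiteness.\<close>
      have "emeasure lebesgue F < \<infinity>"
        using F(3) by (metis infinity_ennreal_def less_irrefl measure_zero_top top.not_eq_extremum)
      then show "integrable lebesgue (\<lambda>\<omega>. ?r * indicator F \<omega>)"
        using F(1) by (intro integrable_mult_right integrable_real_indicator)
      show "norm (indicator F \<omega> *\<^sub>R (?f \<omega> - ?q \<omega>)) \<le> ?r * indicator F \<omega>" for \<omega>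
        using le[of \<omega>] by (auto simp: indicator_def)
    qed
    also have "\<dots> = ?r * measure lebesgue F" using F(1) by simp
    finally have "\<bar>(LINT \<omega>:F|lebesgue. ?f \<omega>) - (LINT \<omega>:F|lebesgue. ?q \<omega>)\<bar> \<le> ?r * measure lebesgue F" .
    moreover have "band_gc F (a z) (\<sigma> z) - gc_quad (xy_coeffs (a z)) =
        ((LINT \<omega>:F|lebesgue. ?f \<omega>) - (LINT \<omega>:F|lebesgue. ?q \<omega>)) / measure lebesgue F"
      unfolding band_gc_def gc_quad_integral by (simp add: diff_divide_distrib)
    ultimately show ?case using F(3) by (simp add: abs_divide divide_le_eq)
  qed
qed

end

section \<open>Gaussian vectors\<close>

lemma Basis_cart_real: "(Basis :: (real^'m) set) = range (\<lambda>i. axis i 1)"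
  by (auto simp: Basis_vec_def)

text \<open>Lebesgue measure on a Euclidean space is the image of a product measure indexed by basis
  vectors; \<open>idx\<close> translates a basis vector back into its coordinate, and then Fubini
  applies.\<close>

lemma lborel_integral_prod_cart:
  fixes g :: "'m::finite \<Rightarrow> real \<Rightarrow> complex"
  assumes g: "\<And>i. integrable lborel (g i)"
  shows "(LINT z|(lborel :: (real^'m) measure). (\<Prod>i\<in>UNIV. g i (z $ i))) =
    (\<Prod>i\<in>UNIV. LINT x|lborel. g i x)"
proof -
  interpret product_sigma_finite "\<lambda>_::real^'m. lborel :: real measure" ..
  have inj: "inj (\<lambda>i::'m. axis i (1::real))"
    by (auto simp: inj_on_def axis_eq_axis)
  define idx where "idx = inv (\<lambda>i::'m. axis i (1::real))"
  have idx: "idx (axis i 1) = i" for i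
    unfolding idx_def using inj by (rule inv_f_f)
  have [measurable]: "g i \<in> borel_measurable borel" for i
    using borel_measurable_integrable[OF g[of i]] by simp
  have nth: "(\<Sum>b\<in>Basis. f b *\<^sub>R b) $ i = f (axis i 1)" for f :: "real^'m \<Rightarrow> real" and i
    unfolding Basis_cart_real
    by (subst sum.reindex[OF inj]) (simp add: axis_def if_distrib cong: if_cong)
  have "(LINT z|(lborel :: (real^'m) measure). (\<Prod>i\<in>UNIV. g i (z $ i))) =
      (LINT f|Pi\<^sub>M Basis (\<lambda>_. lborel). (\<Prod>i\<in>UNIV. g i ((\<Sum>b\<in>Basis. f b *\<^sub>R b :: real^'m) $ i)))"
    by (subst lborel_eq) (rule integral_distr; measurable)
  also have "\<dots> = (LINT f|Pi\<^sub>M (Basis::(real^'m) set) (\<lambda>_. lborel). (\<Prod>i\<in>UNIV. g i (f (axis i 1))))"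
    by (simp only: nth)
  also have "\<dots> = (LINT f|Pi\<^sub>M Basis (\<lambda>_. lborel). (\<Prod>b\<in>(Basis::(real^'m) set). g (idx b) (f b)))"
    unfolding Basis_cart_real by (subst prod.reindex[OF inj]) (simp add: idx)
  also have "\<dots> = (\<Prod>b\<in>(Basis::(real^'m) set). LINT x|lborel. g (idx b) x)"
    by (rule product_integral_prod) (auto intro: g)
  also have "\<dots> = (\<Prod>i\<in>UNIV. LINT x|lborel. g i x)"
    unfolding Basis_cart_real by (subst prod.reindex[OF inj]) (simp add: idx)
  finally show ?thesis .
qed

lemma sets_std_mvnormal [measurable_cong, simp]: "sets (std_mvnormal :: (real^'m) measure) = sets borel"
  by (simp add: std_mvnormal_def)

lemma space_std_mvnormal [simp]: "space (std_mvnormal :: (real^'m) measure) = UNIV"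
  by (simp add: std_mvnormal_def)

lemma measurable_std_normal_prod [measurable]:
  "(\<lambda>z::real^'m. \<Prod>i\<in>UNIV. std_normal_density (z $ i)) \<in> borel_measurable borel"
  by measurable

lemma char_std_mvnormal:
  "(LINT z|(std_mvnormal :: (real^'m) measure). iexp (u \<bullet> z)) = of_real (exp (- (u \<bullet> u) / 2))"
proof -
  have int: "integrable lborel (\<lambda>x. complex_of_real (std_normal_density x) * iexp (t * x))" for t
  proof -
    have "integrable lborel (\<lambda>x. complex_of_real (std_normal_density x))"
      using integrable_std_normal_moment[of 0] by (auto intro: integrable_of_real)
    then show ?thesis
      by (rule Bochner_Integration.integrable_bound) (auto simp: norm_mult)
  qed
  have ch: "(LINT x|lborel. complex_of_real (std_normal_density x) * iexp (t * x)) = exp (- (t\<^sup>2) / 2)" for t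
  proof -
    have "char std_normal_distribution t = (LINT x|lborel. std_normal_density x *\<^sub>R iexp (t * x))"
      unfolding char_def by (subst integral_density) auto
    then show ?thesis
      by (simp add: char_std_normal_distribution scaleR_conv_of_real)
  qed
  have "(LINT z|(std_mvnormal :: (real^'m) measure). iexp (u \<bullet> z)) =
      (LINT z|lborel. (\<Prod>i\<in>UNIV. std_normal_density (z $ i)) *\<^sub>R iexp (u \<bullet> z))"
    unfolding std_mvnormal_def by (subst integral_density) (auto intro!: AE_I2 prod_nonneg)
  also have "\<dots> = (LINT z|(lborel::(real^'m) measure).
      (\<Prod>i\<in>UNIV. complex_of_real (std_normal_density (z $ i)) * iexp (u $ i * z $ i)))"
    by (simp add: scaleR_conv_of_real prod.distrib inner_vec_def sum_distrib_left exp_sum)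
  also have "\<dots> = (\<Prod>i\<in>UNIV. LINT x|lborel. complex_of_real (std_normal_density x) * iexp (u $ i * x))"
    by (rule lborel_integral_prod_cart) (rule int)
  also have "\<dots> = (\<Prod>i\<in>UNIV. complex_of_real (exp (- ((u $ i)\<^sup>2) / 2)))"
    unfolding ch by simp
  also have "\<dots> = of_real (exp (- (u \<bullet> u) / 2))"
    by (simp add: inner_vec_def exp_sum[symmetric] sum_negf[symmetric] sum_divide_distrib
        power2_eq_square flip: of_real_prod)
  finally show ?thesis .
qed

lemma prob_space_std_mvnormal: "prob_space (std_mvnormal :: (real^'m) measure)"
proof
  have "(LINT z|(std_mvnormal :: (real^'m) measure). (1::complex)) = 1"
    using char_std_mvnormal[of "0 :: real^'m"] by simp
  then have "measure (std_mvnormal :: (real^'m) measure) UNIV = 1"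
    by (simp add: scaleR_conv_of_real)
  then have "emeasure (std_mvnormal :: (real^'m) measure) UNIV = 1"
    by (metis emeasure_eq_ennreal_measure ennreal_1 infinity_ennreal_def measure_zero_top zero_neq_one)
  then show "emeasure (std_mvnormal :: (real^'m) measure) (space std_mvnormal) = 1" by simp
qed

lemma mvnormal_factor:
  fixes B :: "real^'m^'m"
  assumes "psd B"
  obtains L :: "real^'m^'m" where "L ** transpose L = B"
    "mvnormal B = distr std_mvnormal borel (\<lambda>w. L *v w)"
proof -
  have "\<exists>L :: real^'m^'m. L ** transpose L = B"
    using psd_factor[OF assms] by metis
  then have "(SOME L :: real^'m^'m. L ** transpose L = B) ** transpose (SOME L. L ** transpose L = B) = B"
    by (rule someI_ex)
  then show ?thesis using that unfolding mvnormal_def by blast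
qed

lemma measurable_matrix_vector [measurable]:
  "(\<lambda>w. (L :: real^'n^'m) *v w) \<in> borel_measurable borel"
  by (intro borel_measurable_continuous_onI linear_continuous_on matrix_vector_mul_bounded_linear)

lemma sets_mvnormal [measurable_cong, simp]: "sets (mvnormal B) = sets borel"
  by (simp add: mvnormal_def)

lemma space_mvnormal [simp]: "space (mvnormal B) = UNIV"
  by (simp add: mvnormal_def)

lemma prob_space_mvnormal: "prob_space (mvnormal B)"
proof -
  interpret prob_space std_mvnormal by (rule prob_space_std_mvnormal)
  show ?thesis unfolding mvnormal_def by (rule prob_space_distr) measurable
qed

lemma char_mvnormal:
  assumes "psd B"
  shows "(LINT z|mvnormal B. iexp (u \<bullet> z)) = of_real (exp (- (u \<bullet> (B *v u)) / 2))"
proof -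
  obtain L :: "real^'a^'a" where L: "L ** transpose L = B"
    "mvnormal B = distr std_mvnormal borel (\<lambda>w. L *v w)"
    by (rule mvnormal_factor[OF assms])
  have tr: "u \<bullet> (L *v w) = (transpose L *v u) \<bullet> w" for w
    by (simp add: dot_lmul_matrix)
  have "(LINT z|mvnormal B. iexp (u \<bullet> z)) = (LINT w|std_mvnormal. iexp ((transpose L *v u) \<bullet> w))"
    unfolding L(2) by (subst integral_distr) (auto simp only: tr, measurable)
  also have "\<dots> = of_real (exp (- ((transpose L *v u) \<bullet> (transpose L *v u)) / 2))"
    by (rule char_std_mvnormal)
  also have "(transpose L *v u) \<bullet> (transpose L *v u) = u \<bullet> (B *v u)"
    by (simp only: tr[symmetric] matrix_vector_mul_assoc L(1))
  finally show ?thesis .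
qed

text \<open>Reduces all moments of a possibly degenerate Gaussian vector to those of the standard
  normal law on the line. Both sides have the same characteristic function.\<close>

lemma distr_inner_mvnormal:
  assumes B: "psd B"
  shows "distr (mvnormal B) borel (\<lambda>z. u \<bullet> z) =
    distr std_normal_distribution borel (\<lambda>x. sqrt (u \<bullet> (B *v u)) * x)"
proof (rule Levy_uniqueness)
  interpret N: prob_space "mvnormal B" by (rule prob_space_mvnormal)
  interpret Z: real_distribution std_normal_distribution by (rule real_dist_normal_dist)
  have nn: "0 \<le> u \<bullet> (B *v u)" using B unfolding psd_def by blast
  show "real_distribution (distr (mvnormal B) borel (\<lambda>z. u \<bullet> z))"
    by (intro N.real_distribution_distr) measurable
  show "real_distribution (distr std_normal_distribution borel (\<lambda>x. sqrt (u \<bullet> (B *v u)) * x))"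
    by (intro Z.real_distribution_distr) measurable
  show "char (distr (mvnormal B) borel (\<lambda>z. u \<bullet> z)) =
      char (distr std_normal_distribution borel (\<lambda>x. sqrt (u \<bullet> (B *v u)) * x))"
  proof
    fix t
    have "char (distr (mvnormal B) borel (\<lambda>z. u \<bullet> z)) t = (LINT z|mvnormal B. iexp ((t *\<^sub>R u) \<bullet> z))"
      unfolding char_def by (subst integral_distr) auto
    also have "\<dots> = of_real (exp (- (t\<^sup>2 * (u \<bullet> (B *v u))) / 2))"
      unfolding char_mvnormal[OF B] by (simp add: matrix_vector_mult_scaleR power2_eq_square mult.assoc)
    also have "\<dots> = char std_normal_distribution (t * sqrt (u \<bullet> (B *v u)))"
      using nn by (simp add: char_std_normal_distribution power_mult_distrib)
    also have "\<dots> = char (distr std_normal_distribution borel (\<lambda>x. sqrt (u \<bullet> (B *v u)) * x)) t"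
      unfolding char_def by (subst integral_distr) (auto simp: mult.assoc)
    finally show "char (distr (mvnormal B) borel (\<lambda>z. u \<bullet> z)) t =
      char (distr std_normal_distribution borel (\<lambda>x. sqrt (u \<bullet> (B *v u)) * x)) t" .
  qed
qed

lemma mvnormal_moment:
  assumes B: "psd B"
  shows "integrable (mvnormal B) (\<lambda>z. (u \<bullet> z) ^ k)"
    "(LINT z|mvnormal B. (u \<bullet> z) ^ k) =
      (sqrt (u \<bullet> (B *v u))) ^ k * (LINT x|std_normal_distribution. x ^ k)"
proof -
  let ?s = "sqrt (u \<bullet> (B *v u))"
  have "integrable (distr std_normal_distribution borel (\<lambda>x. ?s * x)) (\<lambda>x. x ^ k)"
    by (subst integrable_distr_eq)
      (auto simp: power_mult_distrib intro!: integrable_mult_right integrable_std_normal_distribution_moment)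
  then have "integrable (distr (mvnormal B) borel (\<lambda>z. u \<bullet> z)) (\<lambda>x. x ^ k)"
    by (simp only: distr_inner_mvnormal[OF B])
  then show "integrable (mvnormal B) (\<lambda>z. (u \<bullet> z) ^ k)"
    by (subst (asm) integrable_distr_eq) auto
  have "(LINT z|mvnormal B. (u \<bullet> z) ^ k) = (LINT x|distr (mvnormal B) borel (\<lambda>z. u \<bullet> z). x ^ k)"
    by (subst integral_distr) auto
  also have "\<dots> = (LINT x|std_normal_distribution. (?s * x) ^ k)"
    unfolding distr_inner_mvnormal[OF B] by (subst integral_distr) auto
  finally show "(LINT z|mvnormal B. (u \<bullet> z) ^ k) = ?s ^ k * (LINT x|std_normal_distribution. x ^ k)"
    by (simp add: power_mult_distrib)
qed

lemma mvnormal_mean: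
  assumes "psd B"
  shows "(LINT z|mvnormal B. u \<bullet> z) = 0"
  using mvnormal_moment(2)[OF assms, of u 1] integral_std_normal_distribution_moment_odd[of 1] by simp

lemma mvnormal_second_moment:
  assumes B: "psd B"
  shows "(LINT z|mvnormal B. (u \<bullet> z)\<^sup>2) = u \<bullet> (B *v u)"
proof -
  have "0 \<le> u \<bullet> (B *v u)" using B unfolding psd_def by blast
  then show ?thesis
    using mvnormal_moment(2)[OF B, of u 2] std_normal_distribution_even_moments(1)[of 1]
    by (simp add: fact_numeral)
qed

section \<open>Weak convergence to a generalised chi-squared law\<close>

text \<open>
  For a positive semidefinite quadratic form, \<open>exp (- s q)\<close> is an average of characters
  \<open>exp (\<i> w \<bullet> x)\<close> over a Gaussian \<open>w\<close>; hence convergence of characteristic functions gives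
  convergence of the Laplace transforms of \<open>q\<close>.
\<close>

lemma exp_quadratic_form:
  fixes R :: "real^'m^'m"
  assumes Q: "R ** transpose R = Q" and s: "0 \<le> s"
  shows "of_real (exp (- s * (x \<bullet> (Q *v x)))) =
    (LINT w|(std_mvnormal :: (real^'m) measure). iexp ((sqrt (2 * s) *\<^sub>R (R *v w)) \<bullet> x))"
proof -
  let ?u = "sqrt (2 * s) *\<^sub>R (transpose R *v x)"
  have tr: "(R *v w) \<bullet> x = (transpose R *v x) \<bullet> w" for w
    by (metis dot_lmul_matrix inner_commute transpose_matrix_vector)
  have "(transpose R *v x) \<bullet> (transpose R *v x) = x \<bullet> (Q *v x)"
    unfolding Q[symmetric] by (metis dot_lmul_matrix matrix_vector_mul_assoc transpose_matrix_vector)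
  then have "- (?u \<bullet> ?u) / 2 = - s * (x \<bullet> (Q *v x))" using s by simp
  then show ?thesis
    using char_std_mvnormal[of ?u] by (simp only: inner_scaleR_left tr)
qed

lemma (in prob_space) laplace_quadratic_form:
  fixes X :: "'a \<Rightarrow> real^'m" and R :: "real^'m^'m"
  assumes X [measurable]: "X \<in> borel_measurable M" and Q: "R ** transpose R = Q" and s: "0 \<le> s"
  shows "of_real (expectation (\<lambda>\<omega>. exp (- s * (X \<omega> \<bullet> (Q *v X \<omega>))))) =
    (LINT w|(std_mvnormal :: (real^'m) measure). LINT \<omega>|M. iexp ((sqrt (2 * s) *\<^sub>R (R *v w)) \<bullet> X \<omega>))"
proof -
  interpret N: prob_space "std_mvnormal :: (real^'m) measure" by (rule prob_space_std_mvnormal)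
  interpret P: pair_prob_space M "std_mvnormal :: (real^'m) measure" ..
  have "of_real (expectation (\<lambda>\<omega>. exp (- s * (X \<omega> \<bullet> (Q *v X \<omega>))))) =
      (LINT \<omega>|M. complex_of_real (exp (- s * (X \<omega> \<bullet> (Q *v X \<omega>)))))"
    by (rule integral_complex_of_real[symmetric])
  also have "\<dots> = (LINT \<omega>|M. LINT w|(std_mvnormal :: (real^'m) measure).
      iexp ((sqrt (2 * s) *\<^sub>R (R *v w)) \<bullet> X \<omega>))"
    by (simp only: exp_quadratic_form[OF Q s])
  also have "\<dots> = (LINT w|(std_mvnormal :: (real^'m) measure). LINT \<omega>|M.
      iexp ((sqrt (2 * s) *\<^sub>R (R *v w)) \<bullet> X \<omega>))"
    by (rule P.Fubini_integral[symmetric], rule P.P.integrable_const_bound[where B = 1]) auto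
  finally show ?thesis .
qed

text \<open>The substitution y = exp(-x) maps the half-line into [0,1] and turns exp(-k x) into the
  monomial y^k. A continuous step becomes a continuous function of y, which Weierstrass approximates
  by polynomials, so integer values of the Laplace variable suffice.\<close>

lemma laplace_convergence_imp_cts_step:
  fixes \<mu> :: "nat \<Rightarrow> real measure"
  assumes \<mu>: "\<And>n. real_distribution (\<mu> n)" and \<nu>: "real_distribution \<nu>"
    and nn: "\<And>n. AE x in \<mu> n. 0 \<le> x" "AE x in \<nu>. 0 \<le> x"
    and L: "\<And>k::nat. (\<lambda>n. LINT x|\<mu> n. exp (- real k * x)) \<longlonglongrightarrow> (LINT x|\<nu>. exp (- real k * x))"
    and ab: "a < b"
  shows "(\<lambda>n. LINT x|\<mu> n. cts_step a b x) \<longlonglongrightarrow> (LINT x|\<nu>. cts_step a b x)"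
proof (rule tendstoI)
  fix e :: real assume e: "0 < e"
  \<comment> \<open>The value 0 at y = 0 is the continuous one: the step vanishes for x >= b, that
    is for 0 < y <= exp(-b).\<close>
  define h where "h y = (if y = 0 then 0 else cts_step a b (- ln y))" for y :: real
  have cont_step: "continuous_on UNIV (cts_step a b)"
    using cts_step_uniformly_continuous[OF ab] by (rule uniformly_continuous_imp_continuous)
  have h_exp: "h (exp (- x)) = cts_step a b x" for x
    by (simp add: h_def)
  have "continuous_on {0..1} h"
  proof (rule continuous_at_imp_continuous_on, rule ballI)
    fix y :: real assume y: "y \<in> {0..1}"
    show "isCont h y"
    proof (cases "y = 0")
      case True
      have "h z = 0" if "\<bar>z\<bar> < exp (- b)" for z
      proof -
        have "b \<le> - ln \<bar>z\<bar>" if "z \<noteq> 0"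
        proof -
          have "ln \<bar>z\<bar> < ln (exp (- b))"
            using \<open>\<bar>z\<bar> < exp (- b)\<close> that by (subst ln_less_cancel_iff) auto
          then show ?thesis by simp
        qed
        \<comment> \<open>A neighbourhood of 0 also contains negative z, where the real logarithm is
          that of the absolute value.\<close>
        moreover have "ln \<bar>z\<bar> = ln z" by (simp add: ln_real_def abs_if)
        ultimately show ?thesis using ab by (cases "z = 0") (auto simp: h_def cts_step_def)
      qed
      then have "\<forall>\<^sub>F z in nhds 0. h z = 0"
        by (auto simp: eventually_nhds_metric dist_real_def intro!: exI[of _ "exp (- b)"])
      then have "\<forall>\<^sub>F z in at 0. h z = 0"
        unfolding eventually_at_filter by (rule eventually_mono) simp
      then have "(h \<longlongrightarrow> 0) (at 0)" by (rule tendsto_eventually)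
      moreover have "h 0 = 0" by (simp add: h_def)
      ultimately have "isCont h 0" by (simp add: isCont_def)
      then show ?thesis using True by simp
    next
      case False
      then have "0 < y" using y by simp
      have "\<forall>\<^sub>F z in nhds y. z \<in> {0<..}"
        using \<open>0 < y\<close> by (intro eventually_nhds_in_open) auto
      then have "\<forall>\<^sub>F z in at y. cts_step a b (- ln z) = h z"
        unfolding eventually_at_filter by (rule eventually_mono) (simp add: h_def)
      moreover have "isCont (\<lambda>z. - ln z) y"
        using \<open>0 < y\<close> by (intro isCont_minus isCont_ln) auto
      then have "isCont (\<lambda>z. cts_step a b (- ln z)) y"
        by (rule isCont_o2) (use cont_step in \<open>simp add: continuous_on_eq_continuous_at\<close>)
      then have "((\<lambda>z. cts_step a b (- ln z)) \<longlongrightarrow> h y) (at y)"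
        using \<open>0 < y\<close> by (simp add: isCont_def h_def)
      ultimately have "(h \<longlongrightarrow> h y) (at y)"
        by (rule Lim_transform_eventually[rotated])
      then show ?thesis by (simp add: isCont_def)
    qed
  qed
  \<comment> \<open>Three errors of e/4 arise: the approximation under \<mu> n, the approximation
    under \<nu>, and the convergence of the finitely many Laplace transforms.\<close>
  then obtain g where g: "real_polynomial_function g" "\<And>y. y \<in> {0..1} \<Longrightarrow> \<bar>h y - g y\<bar> < e / 4"
    using Stone_Weierstrass_real_polynomial_function[of "{0..1}" h "e / 4"] e by auto
  obtain c N where gs: "g = (\<lambda>y. \<Sum>k\<le>(N::nat). c k * y ^ k)"
    using g(1) real_polynomial_function_iff_sum by blast
  have g_exp: "g (exp (- x)) = (\<Sum>k\<le>N. c k * exp (- real k * x))" for x :: real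
    by (simp add: gs exp_of_nat_mult[symmetric])
  have int_exp: "integrable \<kappa> (\<lambda>x. exp (- real k * x))"
    if "real_distribution \<kappa>" "AE x in \<kappa>. 0 \<le> x" for \<kappa> k
  proof -
    interpret real_distribution \<kappa> by fact
    show ?thesis
      using that(2) by (intro integrable_const_bound[where B = 1]) (auto elim!: eventually_mono)
  qed
  have approx: "\<bar>(LINT x|\<kappa>. cts_step a b x) - (\<Sum>k\<le>N. c k * (LINT x|\<kappa>. exp (- real k * x)))\<bar> \<le> e / 4"
    if \<kappa>: "real_distribution \<kappa>" "AE x in \<kappa>. 0 \<le> x" for \<kappa>
  proof -
    interpret real_distribution \<kappa> by fact
    note int = int_exp[OF \<kappa>]
    have "(\<Sum>k\<le>N. c k * (LINT x|\<kappa>. exp (- real k * x))) = (LINT x|\<kappa>. g (exp (- x)))"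
      unfolding g_exp using int by (simp add: Bochner_Integration.integral_sum)
    moreover have int_g: "integrable \<kappa> (\<lambda>x. g (exp (- x)))"
      unfolding g_exp using int by simp
    moreover note integrable_cts_step[OF ab]
    ultimately have "(LINT x|\<kappa>. cts_step a b x) - (\<Sum>k\<le>N. c k * (LINT x|\<kappa>. exp (- real k * x)))
        = (LINT x|\<kappa>. cts_step a b x - g (exp (- x)))"
      by simp
    also have "\<bar>\<dots>\<bar> \<le> (LINT x|\<kappa>. \<bar>cts_step a b x - g (exp (- x))\<bar>)"
      by (rule integral_abs_bound)
    also have "\<dots> \<le> (LINT x|\<kappa>. e / 4)"
    proof (rule integral_mono_AE)
      show "AE x in \<kappa>. \<bar>cts_step a b x - g (exp (- x))\<bar> \<le> e / 4"
        using \<kappa>(2)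
      proof eventually_elim
        case (elim x)
        then show ?case using g(2)[of "exp (- x)"] by (simp add: h_exp less_imp_le)
      qed
    qed (use int_g integrable_cts_step[OF ab] in auto)
    also have "\<dots> = e / 4" using prob_space by simp
    finally show ?thesis .
  qed
  have "(\<lambda>n. \<Sum>k\<le>N. c k * (LINT x|\<mu> n. exp (- real k * x))) \<longlonglongrightarrow>
      (\<Sum>k\<le>N. c k * (LINT x|\<nu>. exp (- real k * x)))"
    by (intro tendsto_intros L)
  then have "\<forall>\<^sub>F n in sequentially. dist (\<Sum>k\<le>N. c k * (LINT x|\<mu> n. exp (- real k * x)))
      (\<Sum>k\<le>N. c k * (LINT x|\<nu>. exp (- real k * x))) < e / 4"
    using e by (intro tendstoD) auto
  then show "\<forall>\<^sub>F n in sequentially. dist (LINT x|\<mu> n. cts_step a b x) (LINT x|\<nu>. cts_step a b x) < e"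
  proof eventually_elim
    case (elim n)
    then show ?case
      using approx[OF \<mu> nn(1), of n] approx[OF \<nu> nn(2)] e unfolding dist_real_def by linarith
  qed
qed

theorem (in prob_space) weak_conv_gen_chi2:
  fixes X :: "nat \<Rightarrow> 'a \<Rightarrow> real^'m" and Q B :: "real^'m^'m"
  assumes X [measurable]: "\<And>n. X n \<in> borel_measurable M"
    and CF: "\<And>u. (\<lambda>n. LINT \<omega>|M. iexp (u \<bullet> X n \<omega>)) \<longlonglongrightarrow> of_real (exp (- (u \<bullet> (B *v u)) / 2))"
    and Q: "psd Q" and B: "psd B"
  shows "weak_conv_m (\<lambda>n. distr M borel (\<lambda>\<omega>. X n \<omega> \<bullet> (Q *v X n \<omega>))) (gen_chi2 Q B)"
proof -
  obtain R :: "real^'m^'m" where R: "R ** transpose R = Q"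
    using psd_factor[OF Q] .
  have Qnn: "0 \<le> x \<bullet> (Q *v x)" for x using Q unfolding psd_def by blast
  interpret N: prob_space "std_mvnormal :: (real^'m) measure" by (rule prob_space_std_mvnormal)
  interpret Z: prob_space "mvnormal B" by (rule prob_space_mvnormal)
  have rd: "real_distribution (distr M borel (\<lambda>\<omega>. X n \<omega> \<bullet> (Q *v X n \<omega>)))" for n
    by (intro real_distribution_distr) measurable
  have rg: "real_distribution (gen_chi2 Q B)"
    unfolding gen_chi2_def by (intro Z.real_distribution_distr) measurable
  have lap: "(\<lambda>n. LINT x|distr M borel (\<lambda>\<omega>. X n \<omega> \<bullet> (Q *v X n \<omega>)). exp (- real k * x)) \<longlonglongrightarrow>
      (LINT x|gen_chi2 Q B. exp (- real k * x))" for k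
  proof -
    have 1: "(LINT x|distr M borel (\<lambda>\<omega>. X n \<omega> \<bullet> (Q *v X n \<omega>)). exp (- real k * x)) =
      expectation (\<lambda>\<omega>. exp (- real k * (X n \<omega> \<bullet> (Q *v X n \<omega>))))" for n
      by (subst integral_distr) auto
    have 2: "(LINT x|gen_chi2 Q B. exp (- real k * x)) =
      Z.expectation (\<lambda>z. exp (- real k * (z \<bullet> (Q *v z))))"
      unfolding gen_chi2_def by (subst integral_distr) auto
    have "(\<lambda>n. LINT w|(std_mvnormal :: (real^'m) measure). LINT \<omega>|M.
          iexp ((sqrt (2 * real k) *\<^sub>R (R *v w)) \<bullet> X n \<omega>))
      \<longlonglongrightarrow> (LINT w|(std_mvnormal :: (real^'m) measure). LINT z|mvnormal B.
          iexp ((sqrt (2 * real k) *\<^sub>R (R *v w)) \<bullet> z))"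
    proof (rule integral_dominated_convergence[where w = "\<lambda>_. 1"])
      show "AE w in std_mvnormal. (\<lambda>n. LINT \<omega>|M. iexp ((sqrt (2 * real k) *\<^sub>R (R *v w)) \<bullet> X n \<omega>))
          \<longlonglongrightarrow> (LINT z|mvnormal B. iexp ((sqrt (2 * real k) *\<^sub>R (R *v w)) \<bullet> z))"
        unfolding char_mvnormal[OF B] by (intro AE_I2 CF)
      show "AE w in std_mvnormal. norm (LINT \<omega>|M. iexp ((sqrt (2 * real k) *\<^sub>R (R *v w)) \<bullet> X n \<omega>)) \<le> 1" for n
      proof (intro AE_I2)
        fix w :: "real^'m"
        have "norm (LINT \<omega>|M. iexp ((sqrt (2 * real k) *\<^sub>R (R *v w)) \<bullet> X n \<omega>)) \<le>
          (LINT \<omega>|M. norm (iexp ((sqrt (2 * real k) *\<^sub>R (R *v w)) \<bullet> X n \<omega>)))"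
          by (rule integral_norm_bound)
        also have "\<dots> = 1" by (simp add: prob_space)
        finally show "norm (LINT \<omega>|M. iexp ((sqrt (2 * real k) *\<^sub>R (R *v w)) \<bullet> X n \<omega>)) \<le> 1" .
      qed
    qed auto
    then have "(\<lambda>n. complex_of_real (expectation (\<lambda>\<omega>. exp (- real k * (X n \<omega> \<bullet> (Q *v X n \<omega>))))))
      \<longlonglongrightarrow> complex_of_real (Z.expectation (\<lambda>z. exp (- real k * (z \<bullet> (Q *v z)))))"
      by (subst laplace_quadratic_form[OF X R], simp, subst Z.laplace_quadratic_form[OF _ R]) auto
    then show ?thesis unfolding 1 2 by (simp only: tendsto_of_real_iff)
  qed
  have gnn: "AE x in gen_chi2 Q B. 0 \<le> x"
    unfolding gen_chi2_def by (subst AE_distr_iff) (auto simp: Qnn)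
  show ?thesis
  proof (rule integral_cts_step_conv_imp_weak_conv[OF rd rg])
    fix a b :: real assume "a < b"
    then show "(\<lambda>n. LINT x|distr M borel (\<lambda>\<omega>. X n \<omega> \<bullet> (Q *v X n \<omega>)). cts_step a b x)
      \<longlonglongrightarrow> (LINT x|gen_chi2 Q B. cts_step a b x)"
      by (intro laplace_convergence_imp_cts_step rd rg lap gnn) (auto simp: AE_distr_iff Qnn)
  qed
qed

section \<open>Convergence in probability as a filter\<close>

text \<open>
  With this filter on pairs (sample size, outcome), limits in probability are ordinary limits.
  No measurability is required of the random elements, which matters because the least
  squares estimator is an arbitrary minimiser.
\<close>

definition in_prob :: "'a measure \<Rightarrow> (nat \<times> 'a) filter" where
  "in_prob M = Abs_filter (\<lambda>P. \<forall>\<delta>>0. \<forall>\<^sub>F n in sequentially.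
     \<exists>B\<in>sets M. measure M B \<le> \<delta> \<and> (\<forall>\<omega>\<in>space M - B. P (n, \<omega>)))"

context prob_space
begin

lemma eventually_in_prob:
  "eventually P (in_prob M) \<longleftrightarrow> (\<forall>\<delta>>0. \<forall>\<^sub>F n in sequentially.
     \<exists>B\<in>events. prob B \<le> \<delta> \<and> (\<forall>\<omega>\<in>space M - B. P (n, \<omega>)))"
  unfolding in_prob_def
proof (rule eventually_Abs_filter, rule is_filter.intro)
  show "\<forall>\<delta>>0. \<forall>\<^sub>F n in sequentially. \<exists>B\<in>events. prob B \<le> \<delta> \<and> (\<forall>\<omega>\<in>space M - B. True)"
    by (auto intro!: always_eventually bexI[of _ "{}"])
next
  fix P Q
  assume P: "\<forall>\<delta>>0. \<forall>\<^sub>F n in sequentially. \<exists>B\<in>events. prob B \<le> \<delta> \<and> (\<forall>\<omega>\<in>space M - B. P (n, \<omega>))"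
    and Q: "\<forall>\<delta>>0. \<forall>\<^sub>F n in sequentially. \<exists>B\<in>events. prob B \<le> \<delta> \<and> (\<forall>\<omega>\<in>space M - B. Q (n, \<omega>))"
  show "\<forall>\<delta>>0. \<forall>\<^sub>F n in sequentially. \<exists>B\<in>events. prob B \<le> \<delta> \<and>
      (\<forall>\<omega>\<in>space M - B. P (n, \<omega>) \<and> Q (n, \<omega>))"
  proof (intro allI impI)
    fix \<delta> :: real assume "0 < \<delta>"
    then have "\<forall>\<^sub>F n in sequentially. \<exists>B\<in>events. prob B \<le> \<delta> / 2 \<and> (\<forall>\<omega>\<in>space M - B. P (n, \<omega>))"
      "\<forall>\<^sub>F n in sequentially. \<exists>B\<in>events. prob B \<le> \<delta> / 2 \<and> (\<forall>\<omega>\<in>space M - B. Q (n, \<omega>))"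
      using P Q half_gt_zero by blast+
    then show "\<forall>\<^sub>F n in sequentially. \<exists>B\<in>events. prob B \<le> \<delta> \<and>
      (\<forall>\<omega>\<in>space M - B. P (n, \<omega>) \<and> Q (n, \<omega>))"
    proof eventually_elim
      case (elim n)
      then obtain B1 B2 where B: "B1 \<in> events" "prob B1 \<le> \<delta> / 2" "\<forall>\<omega>\<in>space M - B1. P (n, \<omega>)"
        "B2 \<in> events" "prob B2 \<le> \<delta> / 2" "\<forall>\<omega>\<in>space M - B2. Q (n, \<omega>)" by blast
      have "prob (B1 \<union> B2) \<le> \<delta>"
        using measure_Un_le[OF B(1,4)] B(2,5) by linarith
      then show ?case using B by (intro bexI[of _ "B1 \<union> B2"]) auto
    qed
  qed
next
  fix P Q :: "nat \<times> 'a \<Rightarrow> bool"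
  assume PQ: "\<forall>x. P x \<longrightarrow> Q x"
    and P: "\<forall>\<delta>>0. \<forall>\<^sub>F n in sequentially. \<exists>B\<in>events. prob B \<le> \<delta> \<and> (\<forall>\<omega>\<in>space M - B. P (n, \<omega>))"
  show "\<forall>\<delta>>0. \<forall>\<^sub>F n in sequentially. \<exists>B\<in>events. prob B \<le> \<delta> \<and> (\<forall>\<omega>\<in>space M - B. Q (n, \<omega>))"
  proof (intro allI impI)
    fix \<delta> :: real assume "0 < \<delta>"
    with P have "\<forall>\<^sub>F n in sequentially. \<exists>B\<in>events. prob B \<le> \<delta> \<and> (\<forall>\<omega>\<in>space M - B. P (n, \<omega>))" by blast
    then show "\<forall>\<^sub>F n in sequentially. \<exists>B\<in>events. prob B \<le> \<delta> \<and> (\<forall>\<omega>\<in>space M - B. Q (n, \<omega>))"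
      by (rule eventually_mono) (use PQ in blast)
  qed
qed

lemma filterlim_fst_in_prob: "filterlim fst sequentially (in_prob M)"
  unfolding filterlim_iff eventually_in_prob
  by (auto elim!: eventually_mono intro!: bexI[of _ "{}"])

lemma tendsto_seq_in_prob: "a \<longlonglongrightarrow> l \<Longrightarrow> ((\<lambda>s. a (fst s)) \<longlongrightarrow> l) (in_prob M)"
  using filterlim_compose filterlim_fst_in_prob by blast

lemma eventually_seq_in_prob:
  "eventually P sequentially \<Longrightarrow> \<forall>\<^sub>F s in in_prob M. P (fst s)"
  using filterlim_fst_in_prob unfolding filterlim_iff by blast

lemma eventually_in_prob_space: "\<forall>\<^sub>F s in in_prob M. snd s \<in> space M"
  unfolding eventually_in_prob by (auto intro!: always_eventually bexI[of _ "{}"])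

lemma eventually_in_prob_AE:
  assumes "AE \<omega> in M. \<forall>n. P n \<omega>"
  shows "\<forall>\<^sub>F s in in_prob M. P (fst s) (snd s)"
proof -
  obtain N where N: "N \<in> null_sets M" "{\<omega> \<in> space M. \<not> (\<forall>n. P n \<omega>)} \<subseteq> N"
    using assms by (auto simp: eventually_ae_filter)
  have "prob N = 0" using N(1) by (simp add: null_sets_def measure_def)
  then show ?thesis unfolding eventually_in_prob
    using N by (auto intro!: always_eventually bexI[of _ N])
qed

lemma tendsto_in_prob_markov:
  fixes X :: "nat \<Rightarrow> 'a \<Rightarrow> real"
  assumes int: "\<And>n. integrable M (X n)" and nn: "\<And>n \<omega>. \<omega> \<in> space M \<Longrightarrow> 0 \<le> X n \<omega>"
    and lim: "(\<lambda>n. expectation (X n)) \<longlonglongrightarrow> 0"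
  shows "((\<lambda>s. X (fst s) (snd s)) \<longlongrightarrow> 0) (in_prob M)"
proof (rule tendstoI)
  fix e :: real assume e: "0 < e"
  show "\<forall>\<^sub>F s in in_prob M. dist (X (fst s) (snd s)) 0 < e"
    unfolding eventually_in_prob
  proof (intro allI impI)
    fix \<delta> :: real assume \<delta>: "0 < \<delta>"
    have "\<forall>\<^sub>F n in sequentially. expectation (X n) < \<delta> * e"
      using lim e \<delta> by (intro order_tendstoD(2)) auto
    then show "\<forall>\<^sub>F n in sequentially. \<exists>B\<in>events. prob B \<le> \<delta> \<and>
        (\<forall>\<omega>\<in>space M - B. dist (X (fst (n, \<omega>)) (snd (n, \<omega>))) 0 < e)"
    proof eventually_elim
      case (elim n)
      have [measurable]: "X n \<in> borel_measurable M" using int by simp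
      have "prob {\<omega> \<in> space M. e \<le> X n \<omega>} \<le> expectation (X n) / e"
        using int nn e by (intro integral_Markov_inequality_measure[where A = "space M", simplified]) auto
      also have "\<dots> \<le> \<delta>" using elim e by (simp add: field_simps)
      finally show ?case
        using nn by (intro bexI[of _ "{\<omega> \<in> space M. e \<le> X n \<omega>}"]) auto
    qed
  qed
qed

lemma bounded_convergence_in_prob:
  fixes X :: "nat \<Rightarrow> 'a \<Rightarrow> 'b::{banach, second_countable_topology}"
  assumes [measurable]: "\<And>n. X n \<in> borel_measurable M"
    and bnd: "\<And>n \<omega>. \<omega> \<in> space M \<Longrightarrow> norm (X n \<omega>) \<le> K"
    and lim: "((\<lambda>s. X (fst s) (snd s)) \<longlongrightarrow> 0) (in_prob M)"
  shows "(\<lambda>n. expectation (X n)) \<longlonglongrightarrow> 0"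
proof (rule tendstoI)
  fix e :: real assume e: "0 < e"
  have K: "0 \<le> K"
    using bnd not_empty by (metis ex_in_conv norm_ge_zero order_trans)
  \<comment> \<open>Outside the exceptional event the integrand is below e/2; on it,
    \<open>K\<close> times the probability stays below e/2. Adding 1 keeps the quotient meaningful
    for K = 0.\<close>
  define \<delta> where "\<delta> = e / (2 * (K + 1))"
  have \<delta>: "0 < \<delta>" "K * \<delta> < e / 2"
    unfolding \<delta>_def using e K by (simp_all add: field_simps)
  have "\<forall>\<^sub>F s in in_prob M. dist (X (fst s) (snd s)) 0 < e / 2"
    using lim e by (intro tendstoD) auto
  then have "\<forall>\<^sub>F n in sequentially. \<exists>B\<in>events. prob B \<le> \<delta> \<and> (\<forall>\<omega>\<in>space M - B. norm (X n \<omega>) < e / 2)"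
    using \<delta>(1) unfolding eventually_in_prob by simp
  then show "\<forall>\<^sub>F n in sequentially. dist (expectation (X n)) 0 < e"
  proof eventually_elim
    case (elim n)
    then obtain B where B: "B \<in> events" "prob B \<le> \<delta>" "\<And>\<omega>. \<omega> \<in> space M - B \<Longrightarrow> norm (X n \<omega>) < e / 2"
      by blast
    have int: "integrable M (X n)"
      using bnd by (intro integrable_const_bound[where B = K]) auto
    have "norm (expectation (X n)) \<le> expectation (\<lambda>\<omega>. norm (X n \<omega>))"
      by (rule integral_norm_bound)
    also have "\<dots> \<le> expectation (\<lambda>\<omega>. e / 2 + K * indicator B \<omega>)"
    proof (rule integral_mono)
      show "norm (X n \<omega>) \<le> e / 2 + K * indicator B \<omega>" if "\<omega> \<in> space M" for \<omega>
      proof (cases "\<omega> \<in> B")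
        case True then show ?thesis using bnd[OF that, of n] e by simp
      next
        case False then show ?thesis using B(3)[of \<omega>] that by simp
      qed
    qed (use int B(1) in \<open>auto intro!: integrable_mult_right integrable_real_indicator
        simp: emeasure_eq_measure\<close>)
    also have "\<dots> = e / 2 + K * prob B"
      using B(1) by (subst Bochner_Integration.integral_add)
        (auto intro!: integrable_mult_right integrable_real_indicator simp: emeasure_eq_measure prob_space)
    also have "\<dots> \<le> e / 2 + K * \<delta>"
      using B(2) K by (intro add_left_mono mult_left_mono)
    also have "\<dots> < e" using \<delta>(2) by simp
    finally show ?case by simp
  qed
qed

text \<open>Weak convergence is tested on continuous steps. These are bounded and uniformly
  continuous, so a difference that vanishes in probability does not affect the limit of their
  expectations.\<close>

lemma slutsky_weak_conv:
  fixes X Y :: "nat \<Rightarrow> 'a \<Rightarrow> real"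
  assumes [measurable]: "\<And>n. X n \<in> borel_measurable M" "\<And>n. Y n \<in> borel_measurable M"
    and weak: "weak_conv_m (\<lambda>n. distr M borel (Y n)) \<mu>" and \<mu>: "real_distribution \<mu>"
    and lim: "((\<lambda>s. X (fst s) (snd s) - Y (fst s) (snd s)) \<longlongrightarrow> 0) (in_prob M)"
  shows "weak_conv_m (\<lambda>n. distr M borel (X n)) \<mu>"
proof (rule integral_cts_step_conv_imp_weak_conv)
  show rX: "real_distribution (distr M borel (X n))" for n by simp
  have rY: "real_distribution (distr M borel (Y n))" for n by simp
  show "real_distribution \<mu>" by fact
  fix a b :: real assume ab: "a < b"
  have uc: "uniformly_continuous_on UNIV (cts_step a b)"
    using ab by (rule cts_step_uniformly_continuous)
  then have cont: "continuous_on UNIV (cts_step a b)"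
    by (rule uniformly_continuous_imp_continuous)
  have [measurable]: "cts_step a b \<in> borel_measurable borel"
    using cont by (rule borel_measurable_continuous_onI)
  have b1: "\<bar>cts_step a b x\<bar> \<le> 1" for x
    using ab by (auto simp: cts_step_def field_simps)
  have int: "integrable M (\<lambda>\<omega>. cts_step a b (Z \<omega>))" if [measurable]: "Z \<in> borel_measurable M" for Z
    using b1 by (intro integrable_const_bound[where B = 1]) auto
  have "((\<lambda>s. cts_step a b (X (fst s) (snd s)) - cts_step a b (Y (fst s) (snd s))) \<longlongrightarrow> 0) (in_prob M)"
  proof (rule tendstoI)
    fix e :: real assume "0 < e"
    then obtain d where d: "0 < d" "\<And>x y. dist x y < d \<Longrightarrow> dist (cts_step a b x) (cts_step a b y) < e"
      using uc unfolding uniformly_continuous_on_def by (metis UNIV_I)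
    have "\<forall>\<^sub>F s in in_prob M. dist (X (fst s) (snd s) - Y (fst s) (snd s)) 0 < d"
      using lim d(1) by (rule tendstoD)
    then show "\<forall>\<^sub>F s in in_prob M. dist (cts_step a b (X (fst s) (snd s)) - cts_step a b (Y (fst s) (snd s))) 0 < e"
      by (rule eventually_mono) (use d(2) in \<open>simp add: dist_real_def\<close>)
  qed
  then have "(\<lambda>n. expectation (\<lambda>\<omega>. cts_step a b (X n \<omega>) - cts_step a b (Y n \<omega>))) \<longlonglongrightarrow> 0"
  proof (rule bounded_convergence_in_prob[rotated 2])
    show "norm (cts_step a b (X n \<omega>) - cts_step a b (Y n \<omega>)) \<le> 2" for n \<omega>
      using b1[of "X n \<omega>"] b1[of "Y n \<omega>"] unfolding real_norm_def by linarith
  qed measurable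
  then have "(\<lambda>n. expectation (\<lambda>\<omega>. cts_step a b (X n \<omega>)) - expectation (\<lambda>\<omega>. cts_step a b (Y n \<omega>))) \<longlonglongrightarrow> 0"
    by (simp add: int)
  moreover have "(\<lambda>n. LINT x|distr M borel (Y n). cts_step a b x) \<longlonglongrightarrow> (LINT x|\<mu>. cts_step a b x)"
    using cont b1 by (intro weak_conv_imp_integral_bdd_continuous_conv[OF rY \<mu> weak])
      (auto simp: continuous_on_eq_continuous_at)
  then have "(\<lambda>n. expectation (\<lambda>\<omega>. cts_step a b (Y n \<omega>))) \<longlonglongrightarrow> (LINT x|\<mu>. cts_step a b x)"
    by (subst (asm) integral_distr) auto
  ultimately have "(\<lambda>n. expectation (\<lambda>\<omega>. cts_step a b (X n \<omega>))) \<longlonglongrightarrow> (LINT x|\<mu>. cts_step a b x)"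
    using tendsto_add by fastforce
  then show "(\<lambda>n. LINT x|distr M borel (X n). cts_step a b x) \<longlonglongrightarrow> (LINT x|\<mu>. cts_step a b x)"
    by (subst integral_distr) auto
qed

text \<open>Boundedness in probability for large n. Like \<open>in_prob\<close> it is phrased with
  exceptional events, so it speaks about arbitrary functions of the outcome, the estimator
  included.\<close>

definition tight_in_prob :: "(nat \<times> 'a \<Rightarrow> 'b::real_normed_vector) \<Rightarrow> bool" where
  "tight_in_prob X \<longleftrightarrow> (\<forall>\<delta>>0. \<exists>K. \<forall>\<^sub>F n in sequentially.
     \<exists>B\<in>events. prob B \<le> \<delta> \<and> (\<forall>\<omega>\<in>space M - B. norm (X (n, \<omega>)) \<le> K))"

text \<open>Lets an argument in probability proceed as if \<open>X\<close> were bounded by a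
  constant: outside an event of small probability it is.\<close>

lemma tight_in_prob_eventually:
  assumes X: "tight_in_prob X" and P: "\<And>K. \<forall>\<^sub>F s in in_prob M. norm (X s) \<le> K \<longrightarrow> P s"
  shows "eventually P (in_prob M)"
  unfolding eventually_in_prob
proof (intro allI impI)
  fix \<delta> :: real assume "0 < \<delta>"
  then have \<delta>2: "0 < \<delta> / 2" by simp
  obtain K where K: "\<forall>\<^sub>F n in sequentially. \<exists>B\<in>events. prob B \<le> \<delta> / 2 \<and> (\<forall>\<omega>\<in>space M - B. norm (X (n, \<omega>)) \<le> K)"
    using X \<delta>2 unfolding tight_in_prob_def by blast
  have "\<forall>\<^sub>F n in sequentially. \<exists>B\<in>events. prob B \<le> \<delta> / 2 \<and>
      (\<forall>\<omega>\<in>space M - B. norm (X (n, \<omega>)) \<le> K \<longrightarrow> P (n, \<omega>))"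
    using P[of K] \<delta>2 unfolding eventually_in_prob by blast
  with K show "\<forall>\<^sub>F n in sequentially. \<exists>B\<in>events. prob B \<le> \<delta> \<and> (\<forall>\<omega>\<in>space M - B. P (n, \<omega>))"
  proof eventually_elim
    case (elim n)
    then obtain B1 B2 where B: "B1 \<in> events" "prob B1 \<le> \<delta> / 2" "\<forall>\<omega>\<in>space M - B1. norm (X (n, \<omega>)) \<le> K"
      "B2 \<in> events" "prob B2 \<le> \<delta> / 2" "\<forall>\<omega>\<in>space M - B2. norm (X (n, \<omega>)) \<le> K \<longrightarrow> P (n, \<omega>)" by blast
    have "prob (B1 \<union> B2) \<le> \<delta>" using measure_Un_le[OF B(1,4)] B(2,5) by linarith
    then show ?case using B by (intro bexI[of _ "B1 \<union> B2"]) auto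
  qed
qed

lemma tight_in_prob_mult:
  assumes "tight_in_prob X" "tight_in_prob Y"
    and "\<forall>\<^sub>F s in in_prob M. norm (Z s) \<le> norm (X s) * norm (Y s)"
  shows "tight_in_prob Z"
  unfolding tight_in_prob_def
proof (intro allI impI)
  fix \<delta> :: real assume \<delta>: "0 < \<delta>"
  then have \<delta>3: "0 < \<delta> / 3" by simp
  obtain K where K: "\<forall>\<^sub>F n in sequentially. \<exists>B\<in>events. prob B \<le> \<delta> / 3 \<and> (\<forall>\<omega>\<in>space M - B. norm (X (n, \<omega>)) \<le> K)"
    using assms(1) \<delta>3 unfolding tight_in_prob_def by blast
  obtain L where L: "\<forall>\<^sub>F n in sequentially. \<exists>B\<in>events. prob B \<le> \<delta> / 3 \<and> (\<forall>\<omega>\<in>space M - B. norm (Y (n, \<omega>)) \<le> L)"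
    using assms(2) \<delta>3 unfolding tight_in_prob_def by blast
  have Z: "\<forall>\<^sub>F n in sequentially. \<exists>B\<in>events. prob B \<le> \<delta> / 3 \<and>
      (\<forall>\<omega>\<in>space M - B. norm (Z (n, \<omega>)) \<le> norm (X (n, \<omega>)) * norm (Y (n, \<omega>)))"
    using assms(3) \<delta>3 unfolding eventually_in_prob by blast
  show "\<exists>K. \<forall>\<^sub>F n in sequentially. \<exists>B\<in>events. prob B \<le> \<delta> \<and> (\<forall>\<omega>\<in>space M - B. norm (Z (n, \<omega>)) \<le> K)"
  proof (intro exI[of _ "K * L"])
    show "\<forall>\<^sub>F n in sequentially. \<exists>B\<in>events. prob B \<le> \<delta> \<and> (\<forall>\<omega>\<in>space M - B. norm (Z (n, \<omega>)) \<le> K * L)"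
      using K L Z
    proof eventually_elim
      case (elim n)
      then obtain B1 B2 B3 where B: "B1 \<in> events" "prob B1 \<le> \<delta> / 3" "B2 \<in> events" "prob B2 \<le> \<delta> / 3"
        "B3 \<in> events" "prob B3 \<le> \<delta> / 3" "\<forall>\<omega>\<in>space M - B1. norm (X (n, \<omega>)) \<le> K"
        "\<forall>\<omega>\<in>space M - B2. norm (Y (n, \<omega>)) \<le> L"
        "\<forall>\<omega>\<in>space M - B3. norm (Z (n, \<omega>)) \<le> norm (X (n, \<omega>)) * norm (Y (n, \<omega>))" by blast
      have "prob (B1 \<union> B2 \<union> B3) \<le> prob (B1 \<union> B2) + prob B3"
        using B by (intro measure_Un_le) auto
      also have "prob (B1 \<union> B2) \<le> prob B1 + prob B2"
        using B by (intro measure_Un_le) auto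
      finally have "prob (B1 \<union> B2 \<union> B3) \<le> \<delta>" using B by linarith
      moreover have "norm (Z (n, \<omega>)) \<le> K * L" if "\<omega> \<in> space M - (B1 \<union> B2 \<union> B3)" for \<omega>
      proof -
        have b: "norm (X (n, \<omega>)) \<le> K" "norm (Y (n, \<omega>)) \<le> L"
          "norm (Z (n, \<omega>)) \<le> norm (X (n, \<omega>)) * norm (Y (n, \<omega>))"
          using that B by auto
        have "norm (X (n, \<omega>)) * norm (Y (n, \<omega>)) \<le> K * L"
          using b by (intro mult_mono) (auto intro: order_trans[OF norm_ge_zero])
        then show ?thesis using b by linarith
      qed
      ultimately show ?case using B by (intro bexI[of _ "B1 \<union> B2 \<union> B3"]) auto
    qed
  qed
qed

lemma tendsto_imp_tight_in_prob:
  assumes "(X \<longlongrightarrow> l) (in_prob M)"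
  shows "tight_in_prob X"
  unfolding tight_in_prob_def
proof (intro allI impI exI[of _ "norm l + 1"])
  fix \<delta> :: real assume \<delta>: "0 < \<delta>"
  have "\<forall>\<^sub>F s in in_prob M. norm (X s) \<le> norm l + 1"
  proof (rule eventually_mono)
    show "\<forall>\<^sub>F s in in_prob M. dist (X s) l < 1" using assms by (rule tendstoD) simp
    show "norm (X s) \<le> norm l + 1" if "dist (X s) l < 1" for s
      using that norm_triangle_sub[of "X s" l] by (simp add: dist_norm)
  qed
  then show "\<forall>\<^sub>F n in sequentially. \<exists>B\<in>events. prob B \<le> \<delta> \<and> (\<forall>\<omega>\<in>space M - B. norm (X (n, \<omega>)) \<le> norm l + 1)"
    using \<delta> unfolding eventually_in_prob by blast
qed

lemma tight_in_prob_const: "tight_in_prob (\<lambda>s. c)"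
  by (rule tendsto_imp_tight_in_prob[OF tendsto_const])

lemma tight_in_prob_bound:
  assumes X: "tight_in_prob X" and "\<forall>\<^sub>F s in in_prob M. norm (Z s) \<le> c * norm (X s)"
  shows "tight_in_prob Z"
proof (rule tight_in_prob_mult[OF X tight_in_prob_const[of "\<bar>c\<bar>"]])
  show "\<forall>\<^sub>F s in in_prob M. norm (Z s) \<le> norm (X s) * norm \<bar>c\<bar>"
    using assms(2)
  proof eventually_elim
    case (elim s)
    have "c * norm (X s) \<le> \<bar>c\<bar> * norm (X s)" by (intro mult_right_mono) auto
    then show ?case using elim by (simp add: mult.commute)
  qed
qed

text \<open>Reduced to products by a + b <= (1 + a) (1 + b) for nonnegative a and b.\<close>

lemma tight_in_prob_add:
  assumes "tight_in_prob X" "tight_in_prob Y"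
  shows "tight_in_prob (\<lambda>s. X s + Y s)"
proof -
  have *: "tight_in_prob (\<lambda>s. 1 + norm (V s))" if V: "tight_in_prob V" for V :: "nat \<times> 'a \<Rightarrow> 'c::real_normed_vector"
    unfolding tight_in_prob_def
  proof (intro allI impI)
    fix \<delta> :: real assume "0 < \<delta>"
    then obtain K where "\<forall>\<^sub>F n in sequentially. \<exists>B\<in>events. prob B \<le> \<delta> \<and> (\<forall>\<omega>\<in>space M - B. norm (V (n, \<omega>)) \<le> K)"
      using V unfolding tight_in_prob_def by blast
    then show "\<exists>K. \<forall>\<^sub>F n in sequentially. \<exists>B\<in>events. prob B \<le> \<delta> \<and> (\<forall>\<omega>\<in>space M - B. norm (1 + norm (V (n, \<omega>))) \<le> K)"
      by (intro exI[of _ "1 + K"]) (auto elim!: eventually_mono)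
  qed
  show ?thesis
  proof (rule tight_in_prob_mult[OF *[OF assms(1)] *[OF assms(2)]], rule always_eventually, rule allI)
    fix s
    have "norm (X s + Y s) \<le> norm (X s) + norm (Y s)" by (rule norm_triangle_ineq)
    also have "\<dots> \<le> norm (1 + norm (X s)) * norm (1 + norm (Y s))"
      by (simp add: algebra_simps)
    finally show "norm (X s + Y s) \<le> norm (1 + norm (X s)) * norm (1 + norm (Y s))" .
  qed
qed

lemma tight_in_prob_second_moment:
  fixes X :: "nat \<Rightarrow> 'a \<Rightarrow> 'b::{banach, second_countable_topology}"
  assumes [measurable]: "\<And>n. X n \<in> borel_measurable M"
    and int: "\<And>n. integrable M (\<lambda>\<omega>. (norm (X n \<omega>))\<^sup>2)"
    and bnd: "\<And>n. expectation (\<lambda>\<omega>. (norm (X n \<omega>))\<^sup>2) \<le> K"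
  shows "tight_in_prob (\<lambda>s. X (fst s) (snd s))"
  unfolding tight_in_prob_def
proof (intro allI impI)
  fix \<delta> :: real assume \<delta>: "0 < \<delta>"
  have K: "0 \<le> K" using bnd[of 0] by (rule order_trans[rotated]) simp
  let ?c = "(K + 1) / \<delta>"
  have c: "0 < ?c" using K \<delta> by simp
  show "\<exists>L. \<forall>\<^sub>F n in sequentially. \<exists>B\<in>events. prob B \<le> \<delta> \<and>
      (\<forall>\<omega>\<in>space M - B. norm (X (fst (n, \<omega>)) (snd (n, \<omega>))) \<le> L)"
  proof (intro exI[of _ "sqrt ?c"] always_eventually allI)
    fix n
    have "prob {\<omega> \<in> space M. ?c \<le> (norm (X n \<omega>))\<^sup>2} \<le> expectation (\<lambda>\<omega>. (norm (X n \<omega>))\<^sup>2) / ?c"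
      using int c by (intro integral_Markov_inequality_measure[where A = "space M", simplified]) auto
    also have "\<dots> \<le> K / ?c" using bnd c by (intro divide_right_mono) auto
    also have "\<dots> \<le> \<delta>" using K \<delta> by (simp add: field_simps)
    finally show "\<exists>B\<in>events. prob B \<le> \<delta> \<and> (\<forall>\<omega>\<in>space M - B. norm (X (fst (n, \<omega>)) (snd (n, \<omega>))) \<le> sqrt ?c)"
      by (intro bexI[of _ "{\<omega> \<in> space M. ?c \<le> (norm (X n \<omega>))\<^sup>2}"])
        (auto intro!: real_le_rsqrt simp: not_le less_imp_le)
  qed
qed

lemma tendsto_zero_mult_tight:
  assumes X: "tight_in_prob X" and Y: "(Y \<longlongrightarrow> 0) (in_prob M)"
    and Z: "\<forall>\<^sub>F s in in_prob M. norm (Z s) \<le> norm (X s) * norm (Y s)"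
  shows "(Z \<longlongrightarrow> 0) (in_prob M)"
proof (rule tendstoI, rule tight_in_prob_eventually[OF X])
  fix e K :: real assume e: "0 < e"
  have "\<forall>\<^sub>F s in in_prob M. dist (Y s) 0 < e / (\<bar>K\<bar> + 1)"
    using Y e by (intro tendstoD) auto
  with Z show "\<forall>\<^sub>F s in in_prob M. norm (X s) \<le> K \<longrightarrow> dist (Z s) 0 < e"
  proof eventually_elim
    case (elim s)
    show ?case
    proof
      assume "norm (X s) \<le> K"
      then have "norm (X s) * norm (Y s) \<le> \<bar>K\<bar> * (e / (\<bar>K\<bar> + 1))"
        using elim by (intro mult_mono) auto
      also have "\<dots> < e" using e by (simp add: field_simps)
      finally show "dist (Z s) 0 < e" using elim by simp
    qed
  qed
qed

text \<open>The form in which second-order expansions are used: a remainder that is small compared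
  with the square of a tight quantity vanishes in probability.\<close>

lemma tendsto_zero_small_multiple:
  fixes Z :: "nat \<times> 'a \<Rightarrow> 'b::real_normed_vector"
  assumes X: "tight_in_prob X"
    and Z: "\<And>e. 0 < e \<Longrightarrow> \<forall>\<^sub>F s in in_prob M. norm (Z s) \<le> e * (norm (X s))\<^sup>2"
  shows "(Z \<longlongrightarrow> 0) (in_prob M)"
proof (rule tendstoI, rule tight_in_prob_eventually[OF X])
  fix e K :: real assume e: "0 < e"
  have K: "0 < K\<^sup>2 + 1" by (simp add: add_nonneg_pos)
  then have "0 < e / (K\<^sup>2 + 1)" using e by simp
  from Z[OF this] show "\<forall>\<^sub>F s in in_prob M. norm (X s) \<le> K \<longrightarrow> dist (Z s) 0 < e"
  proof eventually_elim
    case (elim s)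
    show ?case
    proof
      assume "norm (X s) \<le> K"
      then have "(e / (K\<^sup>2 + 1)) * (norm (X s))\<^sup>2 \<le> (e / (K\<^sup>2 + 1)) * K\<^sup>2"
        using e by (intro mult_left_mono power_mono) auto
      also have "\<dots> < e" using e K by (simp add: field_simps)
      finally show "dist (Z s) 0 < e" using elim by simp
    qed
  qed
qed

end

section \<open>Linear processes driven by Gaussian noise\<close>

text \<open>A deterministic function of the noise sequence, so that the random state can be written
  as a measurable function of finitely many noise variables. The state at j uses the inputs with
  index below j.\<close>

primrec lin_state ::
  "real^'m^'m \<Rightarrow> real^'n^'m \<Rightarrow> real^'m \<Rightarrow> (nat \<Rightarrow> real^'n) \<Rightarrow> nat \<Rightarrow> real^'m" where
  "lin_state C E x w 0 = x"
| "lin_state C E x w (Suc j) = C *v lin_state C E x w j + E *v w j"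

lemma lin_state_cong:
  "(\<And>l. l < j \<Longrightarrow> w l = w' l) \<Longrightarrow> lin_state C E x w j = lin_state C E x w' j"
  by (induction j) auto

lemma lin_state_zero_start:
  fixes C :: "real^'m^'m"
  shows "lin_state C E x w j = lin_state C E 0 w j + ((*v) C ^^ j) x"
  by (induction j) (simp_all add: matrix_vector_right_distrib)

lemma measurable_lin_state:
  assumes "j \<le> k"
  shows "(\<lambda>w. lin_state C E x w j) \<in> borel_measurable (Pi\<^sub>M {..<k} (\<lambda>_. borel))"
  using assms
proof (induction j)
  case (Suc j)
  then have [measurable]: "(\<lambda>w. lin_state C E x w j) \<in> borel_measurable (Pi\<^sub>M {..<k} (\<lambda>_. borel))"
    by simp
  have [measurable]: "(\<lambda>w. w j) \<in> borel_measurable (Pi\<^sub>M {..<k} (\<lambda>_. borel))"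
    using Suc.prems by (intro measurable_component_singleton) simp
  show ?case by simp
qed simp

text \<open>The extra power i is what the induction needs: unfolding one step of the recursion
  replaces i by i + 1 and j + 1 by j.\<close>

lemma norm_lin_state_le:
  fixes C :: "real^'m^'m"
  assumes C: "\<And>k v. norm (((*v) C ^^ k) v) \<le> K * \<rho> ^ k * norm v"
  shows "norm (((*v) C ^^ i) (lin_state C E x w j)) \<le>
    K * \<rho> ^ (i + j) * norm x + (\<Sum>l<j. K * \<rho> ^ (i + (j - 1 - l)) * norm (E *v w l))"
proof (induction j arbitrary: i)
  case 0
  then show ?case using C by simp
next
  case (Suc j)
  have eq: "((*v) C ^^ i) (lin_state C E x w (Suc j)) =
      ((*v) C ^^ Suc i) (lin_state C E x w j) + ((*v) C ^^ i) (E *v w j)"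
    by (simp add: mat_funpow_linear funpow_swap1)
  have "norm (((*v) C ^^ i) (lin_state C E x w (Suc j))) \<le>
      norm (((*v) C ^^ Suc i) (lin_state C E x w j)) + norm (((*v) C ^^ i) (E *v w j))"
    unfolding eq by (rule norm_triangle_ineq)
  also have "\<dots> \<le> (K * \<rho> ^ (Suc i + j) * norm x +
      (\<Sum>l<j. K * \<rho> ^ (Suc i + (j - 1 - l)) * norm (E *v w l))) + K * \<rho> ^ i * norm (E *v w j)"
    by (intro add_mono Suc.IH C)
  also have "(\<Sum>l<j. K * \<rho> ^ (Suc i + (j - 1 - l)) * norm (E *v w l)) =
      (\<Sum>l<j. K * \<rho> ^ (i + (Suc j - 1 - l)) * norm (E *v w l))"
  proof (rule sum.cong)
    fix l assume "l \<in> {..<j}"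
    then have "Suc i + (j - 1 - l) = i + (Suc j - 1 - l)" by auto
    then show "K * \<rho> ^ (Suc i + (j - 1 - l)) * norm (E *v w l) =
      K * \<rho> ^ (i + (Suc j - 1 - l)) * norm (E *v w l)" by presburger
  qed simp
  finally show ?case by (simp add: add.assoc)
qed

lemma geometric_weights_sum_le:
  fixes \<rho> :: real
  assumes "0 \<le> \<rho>" "\<rho> < 1"
  shows "(\<Sum>l<j. \<rho> ^ l) \<le> 1 / (1 - \<rho>)"
proof -
  have "(\<Sum>l<j. \<rho> ^ l) = (1 - \<rho> ^ j) / (1 - \<rho>)"
    using assms by (simp add: sum_gp_strict)
  also have "\<dots> \<le> 1 / (1 - \<rho>)"
    using assms by (intro divide_right_mono) auto
  finally show ?thesis .
qed

text \<open>Cauchy-Schwarz with the weights \<open>a\<close>, whose total is at most K / (1 -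
  \<rho>) for every j. The result is linear in the squared inputs, so expectations can be taken term
  by term and remain bounded in j.\<close>

lemma norm_lin_state_square_le:
  fixes C :: "real^'m^'m"
  assumes C: "\<And>k v. norm (((*v) C ^^ k) v) \<le> K * \<rho> ^ k * norm v"
    and K: "0 \<le> K" "0 \<le> \<rho>" "\<rho> < 1"
  shows "(norm (lin_state C E x w j))\<^sup>2 \<le> 2 * K\<^sup>2 * (norm x)\<^sup>2 +
    2 * (K / (1 - \<rho>)) * (\<Sum>l<j. K * \<rho> ^ (j - Suc l) * (norm (E *v w l))\<^sup>2)"
proof -
  define a where "a l = K * \<rho> ^ (j - Suc l)" for l
  have a0: "0 \<le> a l" for l unfolding a_def using K by simp
  let ?b = "\<lambda>l. norm (E *v w l)"
  have "norm (lin_state C E x w j) \<le> K * \<rho> ^ j * norm x + (\<Sum>l<j. a l * ?b l)"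
    using norm_lin_state_le[OF C, of 0] by (simp add: a_def)
  also have "\<dots> \<le> K * norm x + (\<Sum>l<j. a l * ?b l)"
    using K by (intro add_right_mono mult_right_mono) (auto simp: mult_left_le power_le_one)
  finally have "(norm (lin_state C E x w j))\<^sup>2 \<le> (K * norm x + (\<Sum>l<j. a l * ?b l))\<^sup>2"
    by (intro power_mono) auto
  also have "\<dots> \<le> 2 * (K * norm x)\<^sup>2 + 2 * (\<Sum>l<j. a l * ?b l)\<^sup>2"
    using sum_squares_bound[of "K * norm x" "\<Sum>l<j. a l * ?b l"] by (simp add: power2_sum)
  also have "(\<Sum>l<j. a l * ?b l)\<^sup>2 \<le> (\<Sum>l<j. a l) * (\<Sum>l<j. a l * (?b l)\<^sup>2)"
  proof -
    have "(\<Sum>l<j. a l * ?b l)\<^sup>2 = (\<Sum>l<j. sqrt (a l) * (sqrt (a l) * ?b l))\<^sup>2"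
      using a0 by (simp add: mult.assoc[symmetric])
    also have "\<dots> \<le> (\<Sum>l<j. (sqrt (a l))\<^sup>2) * (\<Sum>l<j. (sqrt (a l) * ?b l)\<^sup>2)"
      by (rule Cauchy_Schwarz_ineq_sum)
    finally show ?thesis using a0 by (simp add: power_mult_distrib)
  qed
  also have "(\<Sum>l<j. a l) * (\<Sum>l<j. a l * (?b l)\<^sup>2) \<le> (K / (1 - \<rho>)) * (\<Sum>l<j. a l * (?b l)\<^sup>2)"
  proof (rule mult_right_mono)
    have "(\<Sum>l<j. a l) = K * (\<Sum>l<j. \<rho> ^ l)"
      unfolding a_def by (simp add: sum.nat_diff_reindex sum_distrib_left[symmetric])
    also have "\<dots> \<le> K * (1 / (1 - \<rho>))"
      using K by (intro mult_left_mono geometric_weights_sum_le)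
    finally show "(\<Sum>l<j. a l) \<le> K / (1 - \<rho>)" by simp
    show "0 \<le> (\<Sum>l<j. a l * (?b l)\<^sup>2)" using a0 by (intro sum_nonneg) simp
  qed
  finally show ?thesis by (simp add: a_def power_mult_distrib mult.assoc)
qed

lemma outer_matrix_vector: "outer (A *v u) (B *v v) = A ** outer u v ** transpose B"
  by (simp add: vec_eq_iff outer_def matrix_vector_mult_def matrix_matrix_mult_def transpose_def
      sum_product sum_distrib_left sum_distrib_right mult_ac)

lemma outer_add: "outer (u + u') v = outer u v + outer u' v" "outer u (v + v') = outer u v + outer u v'"
  by (simp_all add: vec_eq_iff outer_def algebra_simps)

lemma transpose_outer: "transpose (outer u v) = outer v u"
  by (simp add: vec_eq_iff outer_def transpose_def mult.commute)

lemma norm_outer: "norm (outer u v) = norm u * norm v"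
proof -
  have "outer u v $ i = u $ i *\<^sub>R v" for i
    by (simp add: vec_eq_iff outer_def)
  then show ?thesis
    by (simp add: norm_vec_def[of "outer u v"] norm_vec_def[of u] L2_set_left_distrib)
qed

lemma inner_outer: "(A :: real^'m^'n) \<bullet> outer u v = u \<bullet> (A *v v)"
  by (simp add: inner_vec_def outer_def matrix_vector_mult_def sum_distrib_left mult_ac)

lemma measurable_vec_nth_compose [measurable (raw)]:
  fixes f :: "'a \<Rightarrow> ('b::euclidean_space)^'n"
  assumes "f \<in> borel_measurable N"
  shows "(\<lambda>x. f x $ i) \<in> borel_measurable N"
  using assms by (rule measurable_compose)
    (intro borel_measurable_continuous_onI continuous_intros)

lemma measurable_outer [measurable (raw)]:
  fixes f :: "'a \<Rightarrow> real^'n" and g :: "'a \<Rightarrow> real^'m"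
  assumes [measurable]: "f \<in> borel_measurable N" "g \<in> borel_measurable N"
  shows "(\<lambda>x. outer (f x) (g x)) \<in> borel_measurable N"
proof (rule borel_measurable_euclidean_space[THEN iffD2], rule ballI)
  fix b :: "real^'m^'n" assume "b \<in> Basis"
  have "outer u v \<bullet> b = (\<Sum>i\<in>UNIV. \<Sum>j\<in>UNIV. u $ i * v $ j * b $ i $ j)" for u :: "real^'n" and v :: "real^'m"
    by (simp add: inner_vec_def outer_def)
  then show "(\<lambda>x. outer (f x) (g x) \<bullet> b) \<in> borel_measurable N" by simp
qed

text \<open>Iterating the equation gives X = C^k X (C^T)^k for every k, and the right-hand side
  tends to 0. This is uniqueness of the solution \<Gamma>.\<close>

lemma stein_operator_injective:
  fixes C :: "real^'m^'m"
  assumes C: "\<And>k v. norm (((*v) C ^^ k) v) \<le> K * \<rho> ^ k * norm v" and \<rho>: "0 \<le> \<rho>" "\<rho> < 1"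
    and X: "X = C ** X ** transpose C"
  shows "X = 0"
proof -
  define P where "P k = (((**) C) ^^ k) (mat 1)" for k
  have Pv: "P k *v v = ((*v) C ^^ k) v" for k v
    unfolding P_def by (induction k) (simp_all add: matrix_vector_mul_assoc[symmetric])
  have PX: "P k ** X ** transpose (P k) = X" for k
  proof (induction k)
    case (Suc k)
    have "P (Suc k) ** X ** transpose (P (Suc k)) = C ** (P k ** X ** transpose (P k)) ** transpose C"
      unfolding P_def by (simp add: matrix_transpose_mul matrix_mul_assoc)
    then show ?case using Suc X by simp
  qed (simp add: P_def)
  have "P \<longlonglongrightarrow> 0"
  proof (rule mat_tendstoI)
    fix i j
    have "(\<lambda>k. K * \<rho> ^ k * norm (axis j 1 :: real^'m)) \<longlonglongrightarrow> 0"
      using \<rho> by (intro tendsto_mult_left_zero tendsto_mult_right_zero LIMSEQ_power_zero) simp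
    then have "(\<lambda>k. P k *v axis j 1) \<longlonglongrightarrow> 0"
      by (rule Lim_null_comparison[rotated]) (rule always_eventually, simp only: Pv C, simp)
    then have "(\<lambda>k. (P k *v axis j 1) $ i) \<longlonglongrightarrow> 0 $ i" by (rule tendsto_vec_nth)
    then show "(\<lambda>k. P k $ i $ j) \<longlonglongrightarrow> 0 $ i $ j"
      by (simp add: matrix_vector_mult_basis column_def)
  qed
  then have "(\<lambda>k. P k ** X ** transpose (P k)) \<longlonglongrightarrow> 0 ** X ** transpose 0"
    by (intro tendsto_intros)
  then have "(\<lambda>k. X) \<longlonglongrightarrow> 0 ** X ** transpose 0" by (simp only: PX)
  then have "X = 0 ** X ** transpose 0" by (simp add: LIMSEQ_const_iff)
  then show ?thesis by (simp add: vec_eq_iff matrix_matrix_mult_def)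
qed

lemma (in prob_space) expectation_sum_orthogonal_le:
  fixes X :: "nat \<Rightarrow> 'a \<Rightarrow> real"
  assumes [measurable]: "\<And>j. X j \<in> borel_measurable M"
    and sq: "\<And>j. integrable M (\<lambda>\<omega>. (X j \<omega>)\<^sup>2)"
    and orth: "\<And>j k. j < k \<Longrightarrow> expectation (\<lambda>\<omega>. X j \<omega> * X k \<omega>) = 0"
    and bnd: "\<And>j. expectation (\<lambda>\<omega>. (X j \<omega>)\<^sup>2) \<le> c"
  shows "integrable M (\<lambda>\<omega>. (\<Sum>j<n. X j \<omega>)\<^sup>2)"
    "expectation (\<lambda>\<omega>. (\<Sum>j<n. X j \<omega>)\<^sup>2) \<le> real n * c"
proof -
  have prod: "integrable M (\<lambda>\<omega>. X j \<omega> * X k \<omega>)" for j k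
  proof (rule Bochner_Integration.integrable_bound)
    show "integrable M (\<lambda>\<omega>. (X j \<omega>)\<^sup>2 + (X k \<omega>)\<^sup>2)" using sq by simp
    show "AE \<omega> in M. norm (X j \<omega> * X k \<omega>) \<le> norm ((X j \<omega>)\<^sup>2 + (X k \<omega>)\<^sup>2)"
    proof (rule AE_I2)
      fix \<omega>
      have "2 * (\<bar>X j \<omega>\<bar> * \<bar>X k \<omega>\<bar>) \<le> (X j \<omega>)\<^sup>2 + (X k \<omega>)\<^sup>2"
        using sum_squares_bound[of "\<bar>X j \<omega>\<bar>" "\<bar>X k \<omega>\<bar>"] by simp
      moreover have "0 \<le> \<bar>X j \<omega>\<bar> * \<bar>X k \<omega>\<bar>" by simp
      ultimately show "norm (X j \<omega> * X k \<omega>) \<le> norm ((X j \<omega>)\<^sup>2 + (X k \<omega>)\<^sup>2)"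
        unfolding real_norm_def abs_mult by linarith
    qed
  qed measurable
  have "integrable M (\<lambda>\<omega>. (\<Sum>j<n. X j \<omega>)\<^sup>2) \<and> expectation (\<lambda>\<omega>. (\<Sum>j<n. X j \<omega>)\<^sup>2) \<le> real n * c"
  proof (induction n)
    case (Suc n)
    have eq: "(\<Sum>j<Suc n. X j \<omega>)\<^sup>2 = (\<Sum>j<n. X j \<omega>)\<^sup>2 + 2 * (\<Sum>j<n. X j \<omega> * X n \<omega>) + (X n \<omega>)\<^sup>2" for \<omega>
      by (simp add: power2_sum sum_distrib_right sum_distrib_left algebra_simps)
    have int: "integrable M (\<lambda>\<omega>. 2 * (\<Sum>j<n. X j \<omega> * X n \<omega>))"
      using prod by simp
    have "expectation (\<lambda>\<omega>. (\<Sum>j<n. X j \<omega> * X n \<omega>)) = 0"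
      using prod orth by (simp add: Bochner_Integration.integral_sum)
    then show ?case
      unfolding eq using Suc int sq bnd[of n]
      by (simp add: algebra_simps)
  qed simp
  then show "integrable M (\<lambda>\<omega>. (\<Sum>j<n. X j \<omega>)\<^sup>2)"
    "expectation (\<lambda>\<omega>. (\<Sum>j<n. X j \<omega>)\<^sup>2) \<le> real n * c" by auto
qed

lemma (in prob_space) weak_lln_orthogonal:
  fixes X :: "nat \<Rightarrow> 'a \<Rightarrow> real"
  assumes [measurable]: "\<And>j. X j \<in> borel_measurable M"
    and sq: "\<And>j. integrable M (\<lambda>\<omega>. (X j \<omega>)\<^sup>2)"
    and orth: "\<And>j k. j < k \<Longrightarrow> expectation (\<lambda>\<omega>. X j \<omega> * X k \<omega>) = 0"
    and bnd: "\<And>j. expectation (\<lambda>\<omega>. (X j \<omega>)\<^sup>2) \<le> c"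
  shows "((\<lambda>s. (\<Sum>j<fst s. X j (snd s)) / real (fst s)) \<longlongrightarrow> 0) (in_prob M)"
proof -
  note * = expectation_sum_orthogonal_le[OF assms]
  have "((\<lambda>s. ((\<Sum>j<fst s. X j (snd s)) / real (fst s))\<^sup>2) \<longlongrightarrow> 0) (in_prob M)"
  proof (rule tendsto_in_prob_markov[where X = "\<lambda>n \<omega>. ((\<Sum>j<n. X j \<omega>) / real n)\<^sup>2"])
    show "integrable M (\<lambda>\<omega>. ((\<Sum>j<n. X j \<omega>) / real n)\<^sup>2)" for n
      using *(1) by (simp add: power_divide)
    show "(\<lambda>n. expectation (\<lambda>\<omega>. ((\<Sum>j<n. X j \<omega>) / real n)\<^sup>2)) \<longlonglongrightarrow> 0"
    proof (rule Lim_null_comparison)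
      show "\<forall>\<^sub>F n in sequentially. norm (expectation (\<lambda>\<omega>. ((\<Sum>j<n. X j \<omega>) / real n)\<^sup>2)) \<le> c / real n"
        using eventually_gt_at_top[of 0]
      proof eventually_elim
        case (elim n)
        have "expectation (\<lambda>\<omega>. ((\<Sum>j<n. X j \<omega>) / real n)\<^sup>2) = expectation (\<lambda>\<omega>. (\<Sum>j<n. X j \<omega>)\<^sup>2) / (real n)\<^sup>2"
          by (simp add: power_divide)
        also have "\<dots> \<le> real n * c / (real n)\<^sup>2"
          by (intro divide_right_mono *(2) zero_le_power2)
        also have "\<dots> = c / real n" using elim by (simp add: power2_eq_square)
        finally show ?case by simp
      qed
      show "(\<lambda>n. c / real n) \<longlonglongrightarrow> 0" by (rule lim_const_over_n)
    qed
  qed simp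
  then have "((\<lambda>s. sqrt (((\<Sum>j<fst s. X j (snd s)) / real (fst s))\<^sup>2)) \<longlongrightarrow> sqrt 0) (in_prob M)"
    by (rule tendsto_real_sqrt)
  then show ?thesis by (simp only: real_sqrt_abs real_sqrt_zero tendsto_rabs_zero_iff)
qed

section \<open>Gaussian noise: moments, exponential martingale and central limit theorem\<close>

locale gaussian_noise = prob_space M for M :: "'a measure" +
  fixes \<eta> :: "nat \<Rightarrow> 'a \<Rightarrow> real^'n" and S :: "real^'n^'n"
  assumes indep: "indep_vars (\<lambda>_. borel) \<eta> UNIV"
    and law: "\<And>j. distr M borel (\<eta> j) = mvnormal S"
    and psd_S: "psd S"
begin

lemma measurable_noise [measurable]: "\<eta> j \<in> borel_measurable M"
  using indep unfolding indep_vars_def by simp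

text \<open>The noise strictly before time k as a point of the finite product space. Leaving out
  time k itself makes it independent of \<open>\<eta> k\<close>.\<close>

definition past :: "nat \<Rightarrow> 'a \<Rightarrow> nat \<Rightarrow> real^'n" where
  "past k \<omega> = restrict (\<lambda>l. \<eta> l \<omega>) {..<k}"

lemma measurable_past [measurable]: "past k \<in> measurable M (Pi\<^sub>M {..<k} (\<lambda>_. borel))"
  unfolding past_def by (rule measurable_restrict) simp

lemma restrict_past: "l \<le> k \<Longrightarrow> restrict (past k \<omega>) {..<l} = past l \<omega>"
  by (auto simp: past_def)

lemma indep_past:
  assumes f: "f \<in> borel_measurable (Pi\<^sub>M {..<k} (\<lambda>_. borel))" and g: "g \<in> borel_measurable borel"
  shows "indep_var borel (\<lambda>\<omega>. f (past k \<omega>)) borel (\<lambda>\<omega>. g (\<eta> k \<omega>))"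
proof -
  have "indep_var (Pi\<^sub>M {..<k} (\<lambda>_. borel)) (past k) (Pi\<^sub>M {k} (\<lambda>_. borel)) (\<lambda>\<omega>. restrict (\<lambda>i. \<eta> i \<omega>) {k})"
    unfolding past_def by (rule indep_var_restrict[OF indep]) auto
  moreover have "(\<lambda>h. g (h k)) \<in> borel_measurable (Pi\<^sub>M {k} (\<lambda>_. borel))"
    by (rule measurable_compose[OF measurable_component_singleton[of k "{k}"] g]) simp
  ultimately have "indep_var borel (f \<circ> past k) borel ((\<lambda>h. g (h k)) \<circ> (\<lambda>\<omega>. restrict (\<lambda>i. \<eta> i \<omega>) {k}))"
    using f by (intro indep_var_compose)
  then show ?thesis by (simp add: o_def)
qed

lemma integrable_inner_noise_power: "integrable M (\<lambda>\<omega>. (u \<bullet> \<eta> j \<omega>) ^ k)"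
proof -
  have "integrable (distr M borel (\<eta> j)) (\<lambda>z. (u \<bullet> z) ^ k)"
    unfolding law by (rule mvnormal_moment(1)[OF psd_S])
  then show ?thesis by (subst (asm) integrable_distr_eq) auto
qed

lemma integrable_noise_power: "integrable M (\<lambda>\<omega>. (\<eta> j \<omega> $ a) ^ k)"
  using integrable_inner_noise_power[of "axis a 1" j k] by (simp add: inner_axis')

lemma expectation_noise: "expectation (\<lambda>\<omega>. \<eta> j \<omega> $ a) = 0"
proof -
  have "expectation (\<lambda>\<omega>. axis a 1 \<bullet> \<eta> j \<omega>) = (LINT z|distr M borel (\<eta> j). axis a 1 \<bullet> z)"
    by (subst integral_distr) auto
  then show ?thesis
    unfolding law mvnormal_mean[OF psd_S] by (simp add: inner_axis')
qed

lemma expectation_inner_noise_square: "expectation (\<lambda>\<omega>. (u \<bullet> \<eta> j \<omega>)\<^sup>2) = u \<bullet> (S *v u)"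
proof -
  have "expectation (\<lambda>\<omega>. (u \<bullet> \<eta> j \<omega>)\<^sup>2) = (LINT z|distr M borel (\<eta> j). (u \<bullet> z)\<^sup>2)"
    by (subst integral_distr) auto
  then show ?thesis unfolding law mvnormal_second_moment[OF psd_S] .
qed

lemma noise_product:
  shows "integrable M (\<lambda>\<omega>. \<eta> j \<omega> $ a * \<eta> j \<omega> $ b)"
    and "expectation (\<lambda>\<omega>. \<eta> j \<omega> $ a * \<eta> j \<omega> $ b) = S $ a $ b"
proof -
  let ?a = "axis a 1 :: real^'n" and ?b = "axis b 1 :: real^'n"
  have eq: "\<eta> j \<omega> $ a * \<eta> j \<omega> $ b =
      (((?a + ?b) \<bullet> \<eta> j \<omega>)\<^sup>2 - (?a \<bullet> \<eta> j \<omega>)\<^sup>2 - (?b \<bullet> \<eta> j \<omega>)\<^sup>2) / 2" for \<omega>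
    by (simp add: inner_axis' inner_add_left power2_sum)
  show "integrable M (\<lambda>\<omega>. \<eta> j \<omega> $ a * \<eta> j \<omega> $ b)"
    unfolding eq by (intro integrable_divide Bochner_Integration.integrable_diff integrable_inner_noise_power)
  have "expectation (\<lambda>\<omega>. \<eta> j \<omega> $ a * \<eta> j \<omega> $ b) =
      ((?a + ?b) \<bullet> (S *v (?a + ?b)) - ?a \<bullet> (S *v ?a) - ?b \<bullet> (S *v ?b)) / 2"
    unfolding eq by (simp add: integrable_inner_noise_power expectation_inner_noise_square)
  also have "\<dots> = (?a \<bullet> (S *v ?b) + ?b \<bullet> (S *v ?a)) / 2"
    by (simp add: matrix_vector_right_distrib inner_add_left inner_add_right)
  also have "\<dots> = S $ a $ b"
    using psd_nth_commute[OF psd_S, of a b] by (simp add: inner_axis_quadratic)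
  finally show "expectation (\<lambda>\<omega>. \<eta> j \<omega> $ a * \<eta> j \<omega> $ b) = S $ a $ b" .
qed

lemma noise_norm_square:
  shows "integrable M (\<lambda>\<omega>. (norm (\<eta> j \<omega>))\<^sup>2)"
    and "expectation (\<lambda>\<omega>. (norm (\<eta> j \<omega>))\<^sup>2) = trace S"
proof -
  have eq: "(norm (\<eta> j \<omega>))\<^sup>2 = (\<Sum>a\<in>UNIV. \<eta> j \<omega> $ a * \<eta> j \<omega> $ a)" for \<omega>
    unfolding power2_norm_eq_inner by (simp add: inner_vec_def)
  show "integrable M (\<lambda>\<omega>. (norm (\<eta> j \<omega>))\<^sup>2)"
    unfolding eq by (intro Bochner_Integration.integrable_sum noise_product)
  show "expectation (\<lambda>\<omega>. (norm (\<eta> j \<omega>))\<^sup>2) = trace S"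
    unfolding eq by (simp add: Bochner_Integration.integral_sum noise_product trace_def)
qed

text \<open>The centred products of noise components at different times are uncorrelated, and finite
  Gaussian fourth moments give them a common variance, so Chebyshev's inequality suffices entry by
  entry.\<close>

lemma noise_covariance_lln:
  "((\<lambda>s. (1 / real (fst s)) *\<^sub>R (\<Sum>j<fst s. outer (\<eta> j (snd s)) (\<eta> j (snd s)))) \<longlongrightarrow> S) (in_prob M)"
proof (rule mat_tendstoI)
  fix a b
  define X where "X j \<omega> = \<eta> j \<omega> $ a * \<eta> j \<omega> $ b - S $ a $ b" for j \<omega>
  have [measurable]: "X j \<in> borel_measurable M" for j unfolding X_def by measurable
  have sq4: "integrable M (\<lambda>\<omega>. (\<eta> j \<omega> $ a * \<eta> j \<omega> $ b)\<^sup>2)" for j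
  proof (rule Bochner_Integration.integrable_bound)
    show "integrable M (\<lambda>\<omega>. (\<eta> j \<omega> $ a) ^ 4 + (\<eta> j \<omega> $ b) ^ 4)"
      by (intro Bochner_Integration.integrable_add integrable_noise_power)
    show "AE \<omega> in M. norm ((\<eta> j \<omega> $ a * \<eta> j \<omega> $ b)\<^sup>2) \<le> norm ((\<eta> j \<omega> $ a) ^ 4 + (\<eta> j \<omega> $ b) ^ 4)"
    proof (rule AE_I2)
      fix \<omega>
      have "2 * (\<eta> j \<omega> $ a * \<eta> j \<omega> $ b)\<^sup>2 \<le> (\<eta> j \<omega> $ a) ^ 4 + (\<eta> j \<omega> $ b) ^ 4"
        using sum_squares_bound[of "(\<eta> j \<omega> $ a)\<^sup>2" "(\<eta> j \<omega> $ b)\<^sup>2"]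
        by (simp add: power_mult_distrib mult.assoc)
      then show "norm ((\<eta> j \<omega> $ a * \<eta> j \<omega> $ b)\<^sup>2) \<le> norm ((\<eta> j \<omega> $ a) ^ 4 + (\<eta> j \<omega> $ b) ^ 4)"
        using zero_le_power2[of "\<eta> j \<omega> $ a * \<eta> j \<omega> $ b"] unfolding real_norm_def by linarith
    qed
  qed measurable
  have sq: "integrable M (\<lambda>\<omega>. (X j \<omega>)\<^sup>2)" for j
    unfolding X_def power2_diff using sq4 noise_product(1)
    by (intro Bochner_Integration.integrable_add Bochner_Integration.integrable_diff) auto
  have X_law: "expectation (\<lambda>\<omega>. h (X j \<omega>)) = (LINT z|mvnormal S. h (z $ a * z $ b - S $ a $ b))"
    if [measurable]: "h \<in> borel_measurable borel" for h :: "real \<Rightarrow> real" and j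
    unfolding law[of j, symmetric] X_def by (subst integral_distr) auto
  have mean: "expectation (X j) = 0" for j
    unfolding X_def using noise_product prob_space by (simp add: noise_product)
  have int: "integrable M (X j)" for j
    unfolding X_def using noise_product by simp
  have orth: "expectation (\<lambda>\<omega>. X j \<omega> * X k \<omega>) = 0" if "j < k" for j k
  proof -
    have [measurable]: "(\<lambda>w. w j) \<in> borel_measurable (Pi\<^sub>M {..<k} (\<lambda>_. borel :: (real^'n) measure))"
      using that by (intro measurable_component_singleton) simp
    have "indep_var borel (\<lambda>\<omega>. (\<lambda>w. w j $ a * w j $ b - S $ a $ b) (past k \<omega>)) borel
        (\<lambda>\<omega>. (\<lambda>z. z $ a * z $ b - S $ a $ b) (\<eta> k \<omega>))"
      by (rule indep_past) measurable
    then have "indep_var borel (X j) borel (X k)"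
      using that by (simp add: past_def X_def[abs_def])
    then show ?thesis using int mean by (simp add: indep_var_lebesgue_integral)
  qed
  have "((\<lambda>s. (\<Sum>j<fst s. X j (snd s)) / real (fst s)) \<longlongrightarrow> 0) (in_prob M)"
  proof (rule weak_lln_orthogonal[OF _ sq orth])
    show "expectation (\<lambda>\<omega>. (X j \<omega>)\<^sup>2) \<le> (LINT z|mvnormal S. (z $ a * z $ b - S $ a $ b)\<^sup>2)" for j
      using X_law[of "\<lambda>x. x\<^sup>2" j] by simp
  qed auto
  then have "((\<lambda>s. (\<Sum>j<fst s. X j (snd s)) / real (fst s) + S $ a $ b) \<longlongrightarrow> S $ a $ b) (in_prob M)"
    using tendsto_add[OF _ tendsto_const, of _ 0] by fastforce
  moreover have "\<forall>\<^sub>F s in in_prob M. (\<Sum>j<fst s. X j (snd s)) / real (fst s) + S $ a $ b =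
      ((1 / real (fst s)) *\<^sub>R (\<Sum>j<fst s. outer (\<eta> j (snd s)) (\<eta> j (snd s)))) $ a $ b"
    using eventually_seq_in_prob[OF eventually_gt_at_top[of 0]]
    by eventually_elim (simp add: X_def outer_def sum_subtractf field_simps)
  ultimately show "((\<lambda>s. ((1 / real (fst s)) *\<^sub>R (\<Sum>j<fst s. outer (\<eta> j (snd s)) (\<eta> j (snd s)))) $ a $ b)
      \<longlongrightarrow> S $ a $ b) (in_prob M)"
    by (rule Lim_transform_eventually)
qed

text \<open>The last noise variable is integrated first: its coefficient depends on earlier noise
  only, so the Gaussian characteristic function exactly cancels the last compensating factor. On the
  product of the noise laws this conditioning is Fubini, and the bound \<open>w\<close> makes every
  partial product integrable.\<close>

lemma exponential_martingale:
  fixes d :: "nat \<Rightarrow> (nat \<Rightarrow> real^'n) \<Rightarrow> real^'n"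
  assumes d: "\<And>l. d l \<in> borel_measurable (Pi\<^sub>M {..<l} (\<lambda>_. borel))"
    and bnd: "\<And>m f. m \<le> n \<Longrightarrow>
      (\<Sum>l<m. d l (restrict f {..<l}) \<bullet> (S *v d l (restrict f {..<l}))) \<le> w"
  shows "(LINT \<omega>|M. of_real (exp ((\<Sum>l<n. d l (past l \<omega>) \<bullet> (S *v d l (past l \<omega>))) / 2)) *
      iexp (\<Sum>l<n. d l (past l \<omega>) \<bullet> \<eta> l \<omega>)) = 1"
proof -
  interpret N: prob_space "mvnormal S" by (rule prob_space_mvnormal)
  interpret PP: product_prob_space "\<lambda>_::nat. mvnormal S" by (intro product_prob_spaceI prob_space_mvnormal)
  define r where "r l f = d l (restrict f {..<l})" for l f
  define P where "P m f = complex_of_real (exp ((\<Sum>l<m. r l f \<bullet> (S *v r l f)) / 2)) *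
      iexp (\<Sum>l<m. r l f \<bullet> f l)" for m f
  have meas_eq: "borel_measurable (Pi\<^sub>M I (\<lambda>_. mvnormal S)) = borel_measurable (Pi\<^sub>M I (\<lambda>_. borel))" for I
    by (intro measurable_cong_sets sets_PiM_cong) auto
  have r: "r l \<in> borel_measurable (Pi\<^sub>M {..<m} (\<lambda>_. borel))" if "l \<le> m" for l m
    unfolding r_def using that
    by (intro measurable_compose[OF measurable_restrict_subset d]) auto
  have P: "P m \<in> borel_measurable (Pi\<^sub>M {..<m} (\<lambda>_. borel))" for m
  proof -
    have "r l \<in> borel_measurable (Pi\<^sub>M {..<m} (\<lambda>_. borel))"
      "(\<lambda>f. f l) \<in> borel_measurable (Pi\<^sub>M {..<m} (\<lambda>_. borel :: (real^'n) measure))" if "l \<in> {..<m}" for l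
      using that r by (auto intro: measurable_component_singleton)
    note [measurable] = this
    show ?thesis unfolding P_def by measurable
  qed
  have normP: "norm (P m f) \<le> exp (w / 2)" if "m \<le> n" for m f
    using bnd[OF that, of f] by (simp add: P_def norm_mult r_def)
  have main: "(LINT f|Pi\<^sub>M {..<m} (\<lambda>_. mvnormal S). P m f) = 1" if "m \<le> n" for m
    using that
  proof (induction m)
    case 0
    then show ?case by (simp add: P_def PiM_empty lebesgue_integral_count_space_finite)
  next
    case (Suc m)
    interpret Pm: prob_space "Pi\<^sub>M {..<Suc m} (\<lambda>_. mvnormal S)" by (rule prob_space_PiM) (rule prob_space_mvnormal)
    have int: "integrable (Pi\<^sub>M (insert m {..<m}) (\<lambda>_. mvnormal S)) (P (Suc m))"
      using normP[OF Suc.prems] P[of "Suc m"] unfolding lessThan_Suc[symmetric]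
      by (intro Pm.integrable_const_bound[where B = "exp (w / 2)"]) (auto simp: meas_eq)
    have upd: "P (Suc m) (x(m := y)) = (P m x * of_real (exp ((r m x \<bullet> (S *v r m x)) / 2))) * iexp (r m x \<bullet> y)" for x y
    proof -
      have "restrict (x(m := y)) {..<l} = restrict x {..<l}" if "l \<le> m" for l
        using that by (auto simp: restrict_def)
      then have rl: "r l (x(m := y)) = r l x" if "l \<le> m" for l
        using that unfolding r_def by simp
      have "(\<Sum>l<m. r l (x(m := y)) \<bullet> (S *v r l (x(m := y)))) = (\<Sum>l<m. r l x \<bullet> (S *v r l x))"
        "(\<Sum>l<m. r l (x(m := y)) \<bullet> (x(m := y)) l) = (\<Sum>l<m. r l x \<bullet> x l)"
        by (auto intro!: sum.cong simp: rl)
      then show ?thesis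
        unfolding P_def by (simp add: rl add_divide_distrib exp_add distrib_left mult_ac)
    qed
    have "(LINT f|Pi\<^sub>M {..<Suc m} (\<lambda>_. mvnormal S). P (Suc m) f) =
        (LINT x|Pi\<^sub>M {..<m} (\<lambda>_. mvnormal S). LINT y|mvnormal S. P (Suc m) (x(m := y)))"
      unfolding lessThan_Suc by (rule PP.product_integral_insert[OF _ _ int]) auto
    also have "\<dots> = (LINT x|Pi\<^sub>M {..<m} (\<lambda>_. mvnormal S). P m x)"
    proof (rule Bochner_Integration.integral_cong[OF refl])
      fix x
      have "(LINT y|mvnormal S. P (Suc m) (x(m := y))) =
          (P m x * of_real (exp ((r m x \<bullet> (S *v r m x)) / 2))) * of_real (exp (- (r m x \<bullet> (S *v r m x)) / 2))"
        unfolding upd by (simp only: integral_mult_right_zero char_mvnormal[OF psd_S])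
      also have "\<dots> = P m x * of_real (exp ((r m x \<bullet> (S *v r m x)) / 2) * exp (- (r m x \<bullet> (S *v r m x)) / 2))"
        by simp
      also have "\<dots> = P m x" by (simp add: exp_add[symmetric])
      finally show "(LINT y|mvnormal S. P (Suc m) (x(m := y))) = P m x" .
    qed
    also have "\<dots> = 1" using Suc by simp
    finally show ?case .
  qed
  show ?thesis
  proof (cases "n = 0")
    case True then show ?thesis using prob_space by simp
  next
    case False
    have "indep_vars (\<lambda>_. borel) \<eta> {..<n}" using indep by (rule indep_vars_subset) simp
    then have dist: "distr M (Pi\<^sub>M {..<n} (\<lambda>_. borel)) (past n) = Pi\<^sub>M {..<n} (\<lambda>_. mvnormal S)"
      using indep_vars_iff_distr_eq_PiM'[where I = "{..<n}" and M' = "\<lambda>_. borel" and X = \<eta>] False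
      unfolding past_def law by (simp add: lessThan_empty_iff)
    have "1 = (LINT f|distr M (Pi\<^sub>M {..<n} (\<lambda>_. borel)) (past n). P n f)"
      unfolding dist using main by simp
    also have "\<dots> = (LINT \<omega>|M. P n (past n \<omega>))"
      using P by (subst integral_distr) auto
    also have "\<dots> = (LINT \<omega>|M. of_real (exp ((\<Sum>l<n. d l (past l \<omega>) \<bullet> (S *v d l (past l \<omega>))) / 2)) *
      iexp (\<Sum>l<n. d l (past l \<omega>) \<bullet> \<eta> l \<omega>))"
    proof -
      have "r l (past n \<omega>) = d l (past l \<omega>)" if "l < n" for l \<omega>
        unfolding r_def using that by (simp add: restrict_past)
      moreover have "past n \<omega> l = \<eta> l \<omega>" if "l < n" for l \<omega>
        using that by (simp add: past_def)
      ultimately show ?thesis unfolding P_def by simp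
    qed
    finally show ?thesis by simp
  qed
qed

text \<open>The running total is tested with the current term included, so the sum stops before it
  would pass \<open>w\<close>; the terms being nonnegative, it never resumes.\<close>

lemma truncated_sum_le:
  fixes a :: "nat \<Rightarrow> real"
  assumes a: "\<And>l. 0 \<le> a l" and w: "0 \<le> w"
  shows "(\<Sum>l<m. if (\<Sum>s\<le>l. a s) \<le> w then a l else 0) \<le> min w (\<Sum>l<m. a l)"
proof (induction m)
  case (Suc m)
  then show ?case using a[of m] by (auto simp: lessThan_Suc_atMost[symmetric])
qed (use w in simp)

text \<open>Let S_n be the normalised sum and V_n its conditional variance. The exponential
  \<open>Y\<close> of the truncated coefficients is bounded with expectation 1. With probability
  tending to 1 nothing is truncated, so \<open>Y\<close> equals exp(V_n / 2) iexp(S_n) with V_n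
  close to v. Comparing expectations, exp(v / 2) times the characteristic function tends to
  1.\<close>

theorem gaussian_martingale_clt:
  fixes c :: "nat \<Rightarrow> (nat \<Rightarrow> real^'n) \<Rightarrow> real^'n"
  assumes c: "\<And>l. c l \<in> borel_measurable (Pi\<^sub>M {..<l} (\<lambda>_. borel))"
    and V: "((\<lambda>s. (\<Sum>l<fst s. c l (past l (snd s)) \<bullet> (S *v c l (past l (snd s)))) / real (fst s)) \<longlongrightarrow> v) (in_prob M)"
  shows "(\<lambda>n. LINT \<omega>|M. iexp ((\<Sum>l<n. c l (past l \<omega>) \<bullet> \<eta> l \<omega>) / sqrt (real n))) \<longlonglongrightarrow> of_real (exp (- v / 2))"
proof -
  define q where "q l f = c l (restrict f {..<l}) \<bullet> (S *v c l (restrict f {..<l}))" for l f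
  have q0: "0 \<le> q l f" for l f using psd_S unfolding q_def psd_def by blast
  \<comment> \<open>A level strictly above the limit v, so that truncation becomes improbable, and
    nonnegative, as \<open>truncated_sum_le\<close> requires.\<close>
  define w where "w = \<bar>v\<bar> + 1"
  have w: "0 \<le> w" "v < w" by (auto simp: w_def)
  \<comment> \<open>The test includes the term for l itself, yet \<open>q l\<close> reads only noise
    before time l; the decision is therefore made before the noise at l enters.\<close>
  define d where "d n l f = (if (\<Sum>s\<le>l. q s f / real n) \<le> w then (1 / sqrt (real n)) *\<^sub>R c l f else 0)" for n l f
  have d_meas: "d n l \<in> borel_measurable (Pi\<^sub>M {..<l} (\<lambda>_. borel))" for n l
  proof -
    have "(\<lambda>f. c s (restrict f {..<s})) \<in> borel_measurable (Pi\<^sub>M {..<l} (\<lambda>_. borel))" if "s \<in> {..l}" for s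
      using that by (intro measurable_compose[OF measurable_restrict_subset c]) auto
    note [measurable] = this c
    show ?thesis unfolding d_def q_def by measurable
  qed
  have qr: "q s (restrict f {..<l}) = q s f" if "s \<le> l" for s l f
  proof -
    have "{..<l} \<inter> {..<s} = {..<s}" using that by auto
    then show ?thesis unfolding q_def by (simp add: restrict_restrict)
  qed
  have dq: "d n l (restrict f {..<l}) \<bullet> (S *v d n l (restrict f {..<l})) =
      (if (\<Sum>s\<le>l. q s f / real n) \<le> w then q l f / real n else 0)" for n l f
    by (simp add: d_def qr) (simp add: q_def matrix_vector_mult_scaleR)
  have d_bnd: "(\<Sum>l<m. d n l (restrict f {..<l}) \<bullet> (S *v d n l (restrict f {..<l}))) \<le> w" for n m f
    unfolding dq using truncated_sum_le[of "\<lambda>l. q l f / real n" w m] q0 w by simp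
  let ?S = "\<lambda>n \<omega>. (\<Sum>l<n. c l (past l \<omega>) \<bullet> \<eta> l \<omega>) / sqrt (real n)"
  let ?V = "\<lambda>n \<omega>. (\<Sum>l<n. c l (past l \<omega>) \<bullet> (S *v c l (past l \<omega>))) / real n"
  define Y where "Y n \<omega> = complex_of_real (exp ((\<Sum>l<n. d n l (past l \<omega>) \<bullet> (S *v d n l (past l \<omega>))) / 2)) *
      iexp (\<Sum>l<n. d n l (past l \<omega>) \<bullet> \<eta> l \<omega>)" for n \<omega>
  have EY: "(LINT \<omega>|M. Y n \<omega>) = 1" for n
    unfolding Y_def by (rule exponential_martingale[OF d_meas d_bnd])
  have [measurable]: "(\<lambda>\<omega>. c l (past l \<omega>)) \<in> borel_measurable M"
    "(\<lambda>\<omega>. d n l (past l \<omega>)) \<in> borel_measurable M" for l n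
    by (rule measurable_compose[OF measurable_past], rule c)
      (rule measurable_compose[OF measurable_past], rule d_meas)
  have Y_meas [measurable]: "Y n \<in> borel_measurable M" for n
    unfolding Y_def by measurable
  have Y_norm: "norm (Y n \<omega>) \<le> exp (w / 2)" for n \<omega>
  proof -
    have "(\<Sum>l<n. d n l (past l \<omega>) \<bullet> (S *v d n l (past l \<omega>))) =
        (\<Sum>l<n. d n l (restrict (past n \<omega>) {..<l}) \<bullet> (S *v d n l (restrict (past n \<omega>) {..<l})))"
      by (intro sum.cong) (simp_all add: restrict_past)
    then show ?thesis using d_bnd[of n "past n \<omega>" n] unfolding Y_def by (simp add: norm_mult)
  qed
  have int_Y: "integrable M (Y n)" for n
    using Y_norm by (intro integrable_const_bound[where B = "exp (w / 2)"]) auto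
  have int_S: "integrable M (\<lambda>\<omega>. iexp (?S n \<omega>))" for n
    by (intro integrable_const_bound[where B = 1]) auto
  define Z where "Z n \<omega> = of_real (exp (v / 2)) * iexp (?S n \<omega>) - Y n \<omega>" for n \<omega>
  have good: "Y n \<omega> = of_real (exp (?V n \<omega> / 2)) * iexp (?S n \<omega>)" if "?V n \<omega> \<le> w" for n \<omega>
  proof -
    have dl: "d n l (past l \<omega>) = (1 / sqrt (real n)) *\<^sub>R c l (past l \<omega>)" if "l < n" for l
    proof -
      have "(\<Sum>s\<le>l. q s (past l \<omega>) / real n) = (\<Sum>s\<le>l. q s (past n \<omega>) / real n)"
        using qr[of _ l "past n \<omega>"] that by (intro sum.cong) (auto simp: restrict_past)
      also have "\<dots> \<le> (\<Sum>s<n. q s (past n \<omega>) / real n)"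
        using that q0 by (intro sum_mono2) auto
      also have "\<dots> = ?V n \<omega>"
        unfolding q_def sum_divide_distrib by (intro sum.cong) (simp_all add: restrict_past)
      finally have "(\<Sum>s\<le>l. q s (past l \<omega>) / real n) \<le> w" using \<open>?V n \<omega> \<le> w\<close> by linarith
      then show ?thesis unfolding d_def by simp
    qed
    have "(\<Sum>l<n. d n l (past l \<omega>) \<bullet> (S *v d n l (past l \<omega>))) = ?V n \<omega>"
      unfolding sum_divide_distrib by (intro sum.cong) (simp_all add: dl matrix_vector_mult_scaleR)
    moreover have "(\<Sum>l<n. d n l (past l \<omega>) \<bullet> \<eta> l \<omega>) = ?S n \<omega>"
      unfolding sum_divide_distrib by (intro sum.cong) (simp_all add: dl)
    ultimately show ?thesis unfolding Y_def by simp
  qed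
  have "((\<lambda>s. exp (v / 2) - exp (?V (fst s) (snd s) / 2)) \<longlongrightarrow> exp (v / 2) - exp (v / 2)) (in_prob M)"
    by (intro tendsto_intros V) simp
  then have "((\<lambda>s. \<bar>exp (v / 2) - exp (?V (fst s) (snd s) / 2)\<bar>) \<longlongrightarrow> 0) (in_prob M)"
    using tendsto_rabs_zero by fastforce
  moreover have "\<forall>\<^sub>F s in in_prob M. \<bar>exp (v / 2) - exp (?V (fst s) (snd s) / 2)\<bar> = norm (Z (fst s) (snd s))"
    using order_tendstoD(2)[OF V w(2)]
  proof eventually_elim
    case (elim s)
    then have "Z (fst s) (snd s) = of_real (exp (v / 2) - exp (?V (fst s) (snd s) / 2)) * iexp (?S (fst s) (snd s))"
      unfolding Z_def by (subst good) (auto simp: algebra_simps)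
    then show ?case by (simp add: norm_mult del: of_real_diff)
  qed
  ultimately have "((\<lambda>s. norm (Z (fst s) (snd s))) \<longlongrightarrow> 0) (in_prob M)"
    by (rule Lim_transform_eventually)
  then have "((\<lambda>s. Z (fst s) (snd s)) \<longlongrightarrow> 0) (in_prob M)"
    by (rule tendsto_norm_zero_cancel)
  then have "(\<lambda>n. LINT \<omega>|M. Z n \<omega>) \<longlonglongrightarrow> 0"
  proof (rule bounded_convergence_in_prob[rotated 2])
    show "norm (Z n \<omega>) \<le> exp (v / 2) + exp (w / 2)" for n \<omega>
      unfolding Z_def by (rule order_trans[OF norm_triangle_ineq4])
        (use Y_norm[of n \<omega>] in \<open>simp add: norm_mult\<close>)
    show "Z n \<in> borel_measurable M" for n unfolding Z_def by measurable
  qed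
  moreover have "(LINT \<omega>|M. Z n \<omega>) = of_real (exp (v / 2)) * (LINT \<omega>|M. iexp (?S n \<omega>)) - 1" for n
    unfolding Z_def using int_Y int_S by (simp add: EY)
  ultimately have "(\<lambda>n. of_real (exp (v / 2)) * (LINT \<omega>|M. iexp (?S n \<omega>)) - 1) \<longlonglongrightarrow> 0" by simp
  then have "(\<lambda>n. of_real (exp (- v / 2)) * ((of_real (exp (v / 2)) * (LINT \<omega>|M. iexp (?S n \<omega>)) - 1) + 1))
      \<longlonglongrightarrow> of_real (exp (- v / 2)) * (0 + 1)"
    by (intro tendsto_intros)
  moreover have "of_real (exp (- v / 2)) * (of_real (exp (v / 2)) * z) = z" for z :: complex
  proof -
    have "complex_of_real (exp (- v / 2)) * of_real (exp (v / 2)) = of_real (exp (- v / 2) * exp (v / 2))" by simp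
    also have "\<dots> = 1" by (simp add: exp_add[symmetric])
    finally show ?thesis by (simp add: mult.assoc[symmetric])
  qed
  ultimately show ?thesis by (simp only: diff_add_cancel add_0 mult_1_right)
qed

end

section \<open>Limit theorems for the sample moments\<close>

lemma norm_matrix_square: "(norm (A :: real^'m^'n))\<^sup>2 = (\<Sum>a\<in>UNIV. \<Sum>b\<in>UNIV. (A $ a $ b)\<^sup>2)"
  unfolding power2_norm_eq_inner by (simp add: inner_vec_def power2_eq_square)

lemma matrix_scaleR_mult: "(c *\<^sub>R A) ** B = c *\<^sub>R (A ** B)" "A ** (c *\<^sub>R B) = c *\<^sub>R (A ** B)"
  for A :: "real^'n^'m"
  by (simp_all add: vec_eq_iff matrix_matrix_mult_def sum_distrib_left mult_ac)

lemma matrix_add_rdistrib: "(A + B) ** C = A ** C + B ** C" for A :: "'a::semiring_1^'n^'m"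
  by (simp add: vec_eq_iff matrix_matrix_mult_def distrib_right sum.distrib)

lemma matrix_sum_mult: "(\<Sum>j\<in>I. A j) ** B = (\<Sum>j\<in>I. A j ** B)" for A :: "'i \<Rightarrow> real^'n^'m"
  by (simp add: vec_eq_iff matrix_matrix_mult_def sum_distrib_right) (intro allI sum.swap)

lemma matrix_mult_sum_right: "B ** (\<Sum>j\<in>I. A j) = (\<Sum>j\<in>I. B ** A j)" for A :: "'i \<Rightarrow> real^'n^'m"
  by (simp add: vec_eq_iff matrix_matrix_mult_def sum_distrib_left) (intro allI sum.swap)

lemma transpose_sum: "transpose (\<Sum>j\<in>I. A j) = (\<Sum>j\<in>I. transpose (A j))" for A :: "'i \<Rightarrow> real^'n^'m"
  by (simp add: vec_eq_iff transpose_def)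

locale linear_process = gaussian_noise M \<eta> S for M :: "'a measure" and \<eta> :: "nat \<Rightarrow> 'a \<Rightarrow> real^'n" and S +
  fixes C :: "real^'m^'m" and E :: "real^'n^'m" and K \<rho> :: real
  assumes C_pow: "\<And>k v. norm (((*v) C ^^ k) v) \<le> K * \<rho> ^ k * norm v"
    and K: "0 \<le> K" and \<rho>: "0 \<le> \<rho>" "\<rho> < 1"
begin

definition state :: "('a \<Rightarrow> real^'m) \<Rightarrow> nat \<Rightarrow> 'a \<Rightarrow> real^'m" where
  "state x0 j \<omega> = lin_state C E (x0 \<omega>) (\<lambda>l. \<eta> l \<omega>) j"

abbreviation "zstate \<equiv> state (\<lambda>_. 0)"

lemma state_Suc: "state x0 (Suc j) \<omega> = C *v state x0 j \<omega> + E *v \<eta> j \<omega>"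
  by (simp add: state_def)

lemma state_0: "state x0 0 \<omega> = x0 \<omega>"
  by (simp add: state_def)

lemma measurable_state [measurable]:
  assumes [measurable]: "x0 \<in> borel_measurable M"
  shows "state x0 j \<in> borel_measurable M"
proof (induction j)
  case 0 then show ?case using assms by (simp add: state_def[abs_def])
next
  case (Suc j)
  note [measurable] = Suc
  show ?case unfolding state_Suc[abs_def] by measurable
qed

text \<open>The reason for starting at zero: this state is a function of past noise, whereas a
  general initial state may be correlated with noise of any time.\<close>

lemma zstate_past: "j \<le> k \<Longrightarrow> zstate j \<omega> = lin_state C E 0 (past k \<omega>) j"
  unfolding state_def past_def by (intro lin_state_cong) simp

text \<open>Expectation of the pathwise bound \<open>norm_lin_state_square_le\<close>; its geometric
  weights have a total bounded independently of j.\<close>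

lemma state_second_moment:
  assumes [measurable]: "x0 \<in> borel_measurable M" and x0: "integrable M (\<lambda>\<omega>. (norm (x0 \<omega>))\<^sup>2)"
  obtains B where "\<And>j. integrable M (\<lambda>\<omega>. (norm (state x0 j \<omega>))\<^sup>2)"
    "\<And>j. expectation (\<lambda>\<omega>. (norm (state x0 j \<omega>))\<^sup>2) \<le> B"
proof -
  let ?\<kappa> = "K / (1 - \<rho>)"
  define R where "R j \<omega> = 2 * K\<^sup>2 * (norm (x0 \<omega>))\<^sup>2 +
    2 * ?\<kappa> * (\<Sum>l<j. K * \<rho> ^ (j - Suc l) * ((norm E)\<^sup>2 * (norm (\<eta> l \<omega>))\<^sup>2))" for j \<omega>
  have \<kappa>: "0 \<le> ?\<kappa>" using K \<rho> by simp
  have le: "(norm (state x0 j \<omega>))\<^sup>2 \<le> R j \<omega>" for j \<omega>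
  proof -
    have "(norm (E *v \<eta> l \<omega>))\<^sup>2 \<le> (norm E)\<^sup>2 * (norm (\<eta> l \<omega>))\<^sup>2" for l
      using power_mono[OF norm_matrix_vector_le[of E "\<eta> l \<omega>"], of 2] by (simp add: power_mult_distrib)
    then have "(\<Sum>l<j. K * \<rho> ^ (j - Suc l) * (norm (E *v \<eta> l \<omega>))\<^sup>2) \<le>
        (\<Sum>l<j. K * \<rho> ^ (j - Suc l) * ((norm E)\<^sup>2 * (norm (\<eta> l \<omega>))\<^sup>2))"
      using K \<rho> by (intro sum_mono mult_left_mono) auto
    then have "2 * ?\<kappa> * (\<Sum>l<j. K * \<rho> ^ (j - Suc l) * (norm (E *v \<eta> l \<omega>))\<^sup>2) \<le>
        2 * ?\<kappa> * (\<Sum>l<j. K * \<rho> ^ (j - Suc l) * ((norm E)\<^sup>2 * (norm (\<eta> l \<omega>))\<^sup>2))"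
      using \<kappa> by (intro mult_left_mono) auto
    then show ?thesis
      using norm_lin_state_square_le[OF C_pow K \<rho>, of E "x0 \<omega>" "\<lambda>l. \<eta> l \<omega>" j]
      unfolding state_def R_def by linarith
  qed
  have R_int: "integrable M (R j)" for j
    unfolding R_def using x0 noise_norm_square(1)
    by (intro Bochner_Integration.integrable_add integrable_mult_right Bochner_Integration.integrable_sum) auto
  have int: "integrable M (\<lambda>\<omega>. (norm (state x0 j \<omega>))\<^sup>2)" for j
  proof (rule Bochner_Integration.integrable_bound[OF R_int[of j]])
    show "AE \<omega> in M. norm ((norm (state x0 j \<omega>))\<^sup>2) \<le> norm (R j \<omega>)"
      using le by (intro AE_I2) (simp add: order_trans[OF _ abs_ge_self])
  qed measurable
  have "expectation (\<lambda>\<omega>. (norm (state x0 j \<omega>))\<^sup>2) \<le>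
      2 * K\<^sup>2 * expectation (\<lambda>\<omega>. (norm (x0 \<omega>))\<^sup>2) + 2 * ?\<kappa> * (?\<kappa> * ((norm E)\<^sup>2 * trace S))" for j
  proof -
    have tr: "0 \<le> trace S"
      unfolding noise_norm_square(2)[of 0, symmetric] by simp
    have "expectation (\<lambda>\<omega>. (norm (state x0 j \<omega>))\<^sup>2) \<le> expectation (R j)"
      using int R_int le by (intro integral_mono)
    also have "expectation (R j) = 2 * K\<^sup>2 * expectation (\<lambda>\<omega>. (norm (x0 \<omega>))\<^sup>2) +
        2 * ?\<kappa> * (\<Sum>l<j. K * \<rho> ^ (j - Suc l) * ((norm E)\<^sup>2 * trace S))"
      unfolding R_def using x0 noise_norm_square by (simp add: Bochner_Integration.integral_sum)
    also have "(\<Sum>l<j. K * \<rho> ^ (j - Suc l) * ((norm E)\<^sup>2 * trace S)) =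
        (K * (\<Sum>l<j. \<rho> ^ l)) * ((norm E)\<^sup>2 * trace S)"
      by (simp only: sum_distrib_right[symmetric] sum_distrib_left[symmetric] sum.nat_diff_reindex)
    also have "2 * ?\<kappa> * \<dots> \<le> 2 * ?\<kappa> * (?\<kappa> * ((norm E)\<^sup>2 * trace S))"
    proof (intro mult_left_mono mult_right_mono)
      have "K * (\<Sum>l<j. \<rho> ^ l) \<le> K * (1 / (1 - \<rho>))"
        using K \<rho> by (intro mult_left_mono geometric_weights_sum_le)
      then show "K * (\<Sum>l<j. \<rho> ^ l) \<le> ?\<kappa>" by simp
    qed (use \<kappa> tr in auto)
    finally show ?thesis by simp
  qed
  then show ?thesis using that int by blast
qed

definition score :: "('a \<Rightarrow> real^'m) \<Rightarrow> nat \<Rightarrow> 'a \<Rightarrow> real^'m^'n" where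
  "score x0 n \<omega> = (1 / sqrt (real n)) *\<^sub>R (\<Sum>j<n. outer (\<eta> j \<omega>) (state x0 j \<omega>))"

definition gram :: "('a \<Rightarrow> real^'m) \<Rightarrow> nat \<Rightarrow> 'a \<Rightarrow> real^'m^'m" where
  "gram x0 n \<omega> = (1 / real n) *\<^sub>R (\<Sum>j<n. outer (state x0 j \<omega>) (state x0 j \<omega>))"

lemma measurable_score [measurable]:
  assumes [measurable]: "x0 \<in> borel_measurable M"
  shows "score x0 n \<in> borel_measurable M"
  unfolding score_def by measurable

text \<open>For j < k the noise at k is independent of all other factors in the product of the j-th
  and k-th terms, and it has mean zero. The terms are thus orthogonal with bounded variance, and the
  variance of the sum grows at most linearly.\<close>

lemma cross_products:
  obtains B where "\<And>n. integrable M (\<lambda>\<omega>. (\<Sum>j<n. \<eta> j \<omega> $ a * zstate j \<omega> $ b)\<^sup>2)"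
    "\<And>n. expectation (\<lambda>\<omega>. (\<Sum>j<n. \<eta> j \<omega> $ a * zstate j \<omega> $ b)\<^sup>2) \<le> real n * B"
proof -
  obtain B where B: "\<And>j. integrable M (\<lambda>\<omega>. (norm (zstate j \<omega>))\<^sup>2)"
    "\<And>j. expectation (\<lambda>\<omega>. (norm (zstate j \<omega>))\<^sup>2) \<le> B"
    using state_second_moment[of "\<lambda>_. 0"] by auto
  have z_le: "(zstate j \<omega> $ b)\<^sup>2 \<le> (norm (zstate j \<omega>))\<^sup>2" for j \<omega>
  proof -
    have "norm (zstate j \<omega> $ b) \<le> norm (zstate j \<omega>)" by (rule Finite_Cartesian_Product.norm_nth_le)
    from power_mono[OF this, of 2] show ?thesis by simp
  qed
  have z_int: "integrable M (\<lambda>\<omega>. (zstate j \<omega> $ b)\<^sup>2)" for j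
    by (rule Bochner_Integration.integrable_bound[OF B(1)[of j]])
      (auto intro!: AE_I2 z_le)
  have z_bnd: "expectation (\<lambda>\<omega>. (zstate j \<omega> $ b)\<^sup>2) \<le> B" for j
    using integral_mono[OF z_int B(1) z_le] B(2) order_trans by blast
  have z_meas: "(\<lambda>w. lin_state C E 0 w j $ b) \<in> borel_measurable (Pi\<^sub>M {..<k} (\<lambda>_. borel))" if "j \<le> k" for j k
    using measurable_lin_state[OF that] by measurable
  define Z where "Z j \<omega> = \<eta> j \<omega> $ a * zstate j \<omega> $ b" for j \<omega>
  have [measurable]: "Z j \<in> borel_measurable M" for j unfolding Z_def by measurable
  have sq: "integrable M (\<lambda>\<omega>. (Z j \<omega>)\<^sup>2)" and sqE: "expectation (\<lambda>\<omega>. (Z j \<omega>)\<^sup>2) \<le> B * S $ a $ a" for j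
  proof -
    have "indep_var borel (\<lambda>\<omega>. (\<lambda>w. (lin_state C E 0 w j $ b)\<^sup>2) (past j \<omega>)) borel (\<lambda>\<omega>. (\<lambda>z. (z $ a)\<^sup>2) (\<eta> j \<omega>))"
      by (rule indep_past) (use z_meas[of j j] in measurable)
    then have ind: "indep_var borel (\<lambda>\<omega>. (zstate j \<omega> $ b)\<^sup>2) borel (\<lambda>\<omega>. (\<eta> j \<omega> $ a)\<^sup>2)"
      by (simp add: zstate_past[of j j])
    have eq: "(Z j \<omega>)\<^sup>2 = (zstate j \<omega> $ b)\<^sup>2 * (\<eta> j \<omega> $ a)\<^sup>2" for \<omega>
      by (simp add: Z_def power_mult_distrib mult.commute)
    show "integrable M (\<lambda>\<omega>. (Z j \<omega>)\<^sup>2)"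
      unfolding eq by (rule indep_var_integrable[OF ind z_int integrable_noise_power])
    have "expectation (\<lambda>\<omega>. (\<eta> j \<omega> $ a)\<^sup>2) = S $ a $ a"
      using noise_product(2)[of j a a] by (simp add: power2_eq_square)
    then have "expectation (\<lambda>\<omega>. (Z j \<omega>)\<^sup>2) = expectation (\<lambda>\<omega>. (zstate j \<omega> $ b)\<^sup>2) * S $ a $ a"
      unfolding eq by (simp add: indep_var_lebesgue_integral[OF ind z_int integrable_noise_power])
    also have "\<dots> \<le> B * S $ a $ a"
      by (intro mult_right_mono z_bnd psd_diag_nonneg psd_S)
    finally show "expectation (\<lambda>\<omega>. (Z j \<omega>)\<^sup>2) \<le> B * S $ a $ a" .
  qed
  have orth: "expectation (\<lambda>\<omega>. Z j \<omega> * Z k \<omega>) = 0" if "j < k" for j k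
  proof -
    have comp: "(\<lambda>w. w j) \<in> borel_measurable (Pi\<^sub>M {..<k} (\<lambda>_. borel :: (real^'n) measure))"
      using that by (intro measurable_component_singleton) simp
    have f_meas: "(\<lambda>w. w j $ a * lin_state C E 0 w j $ b * lin_state C E 0 w k $ b)
        \<in> borel_measurable (Pi\<^sub>M {..<k} (\<lambda>_. borel))"
      using that by (intro borel_measurable_times z_meas measurable_vec_nth_compose[OF comp]) auto
    let ?W = "\<lambda>\<omega>. Z j \<omega> * zstate k \<omega> $ b"
    have "indep_var borel (\<lambda>\<omega>. (\<lambda>w. w j $ a * lin_state C E 0 w j $ b * lin_state C E 0 w k $ b) (past k \<omega>)) borel
        (\<lambda>\<omega>. (\<lambda>z. z $ a) (\<eta> k \<omega>))"
      by (rule indep_past[OF f_meas]) measurable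
    then have ind: "indep_var borel ?W borel (\<lambda>\<omega>. \<eta> k \<omega> $ a)"
      using that by (simp add: Z_def zstate_past[of j k] zstate_past[of k k] past_def[of k, unfolded restrict_def])
    have W_int: "integrable M ?W"
    proof (rule Bochner_Integration.integrable_bound)
      show "integrable M (\<lambda>\<omega>. (Z j \<omega>)\<^sup>2 + (zstate k \<omega> $ b)\<^sup>2)"
        by (intro Bochner_Integration.integrable_add sq z_int)
      show "AE \<omega> in M. norm (?W \<omega>) \<le> norm ((Z j \<omega>)\<^sup>2 + (zstate k \<omega> $ b)\<^sup>2)"
      proof (rule AE_I2)
        fix \<omega>
        have "2 * (\<bar>Z j \<omega>\<bar> * \<bar>zstate k \<omega> $ b\<bar>) \<le> (Z j \<omega>)\<^sup>2 + (zstate k \<omega> $ b)\<^sup>2"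
          using sum_squares_bound[of "\<bar>Z j \<omega>\<bar>" "\<bar>zstate k \<omega> $ b\<bar>"] by simp
        moreover have "0 \<le> \<bar>Z j \<omega>\<bar> * \<bar>zstate k \<omega> $ b\<bar>" by simp
        ultimately show "norm (?W \<omega>) \<le> norm ((Z j \<omega>)\<^sup>2 + (zstate k \<omega> $ b)\<^sup>2)"
          unfolding real_norm_def abs_mult by linarith
      qed
    qed measurable
    have "expectation (\<lambda>\<omega>. Z j \<omega> * Z k \<omega>) = expectation (\<lambda>\<omega>. ?W \<omega> * \<eta> k \<omega> $ a)"
      by (simp add: Z_def mult_ac)
    also have "\<dots> = expectation ?W * expectation (\<lambda>\<omega>. \<eta> k \<omega> $ a)"
      using integrable_noise_power[of k a 1] by (intro indep_var_lebesgue_integral[OF ind W_int]) simp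
    finally show ?thesis by (simp add: expectation_noise)
  qed
  show ?thesis
    using expectation_sum_orthogonal_le[of Z, OF _ sq orth sqE] by (intro that) (auto simp: Z_def)
qed

lemma score_zero_second_moment:
  obtains B where "\<And>n. integrable M (\<lambda>\<omega>. (norm (score (\<lambda>_. 0) n \<omega>))\<^sup>2)"
    "\<And>n. expectation (\<lambda>\<omega>. (norm (score (\<lambda>_. 0) n \<omega>))\<^sup>2) \<le> B"
proof -
  define P where "P a b B \<longleftrightarrow> (\<forall>n. integrable M (\<lambda>\<omega>. (\<Sum>j<n. \<eta> j \<omega> $ a * zstate j \<omega> $ b)\<^sup>2)) \<and>
      (\<forall>n. expectation (\<lambda>\<omega>. (\<Sum>j<n. \<eta> j \<omega> $ a * zstate j \<omega> $ b)\<^sup>2) \<le> real n * B)" for a b B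
  have "\<exists>B. P a b B" for a b
    unfolding P_def by (rule cross_products[of a b]) blast
  then obtain B where "\<And>a b. P a b (B a b)" by metis
  then have B: "integrable M (\<lambda>\<omega>. (\<Sum>j<n. \<eta> j \<omega> $ a * zstate j \<omega> $ b)\<^sup>2)"
    "expectation (\<lambda>\<omega>. (\<Sum>j<n. \<eta> j \<omega> $ a * zstate j \<omega> $ b)\<^sup>2) \<le> real n * B a b" for a b n
    unfolding P_def by blast+
  have eq: "(norm (score (\<lambda>_. 0) n \<omega>))\<^sup>2 =
      (1 / real n) * (\<Sum>a\<in>UNIV. \<Sum>b\<in>UNIV. (\<Sum>j<n. \<eta> j \<omega> $ a * zstate j \<omega> $ b)\<^sup>2)" for n \<omega>
  proof -
    have "score (\<lambda>_. 0) n \<omega> $ a $ b = (\<Sum>j<n. \<eta> j \<omega> $ a * zstate j \<omega> $ b) / sqrt (real n)" for a b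
      by (simp add: score_def outer_def sum_divide_distrib)
    then show ?thesis
      unfolding norm_matrix_square by (simp add: power_divide sum_distrib_left)
  qed
  show ?thesis
  proof (rule that)
    show "integrable M (\<lambda>\<omega>. (norm (score (\<lambda>_. 0) n \<omega>))\<^sup>2)" for n
      unfolding eq by (intro integrable_mult_right Bochner_Integration.integrable_sum B)
    show "expectation (\<lambda>\<omega>. (norm (score (\<lambda>_. 0) n \<omega>))\<^sup>2) \<le> \<bar>\<Sum>a\<in>UNIV. \<Sum>b\<in>UNIV. B a b\<bar>" for n
    proof (cases "n = 0")
      case True then show ?thesis by (simp add: score_def)
    next
      case False
      have "expectation (\<lambda>\<omega>. (norm (score (\<lambda>_. 0) n \<omega>))\<^sup>2) =
          (1 / real n) * (\<Sum>a\<in>UNIV. \<Sum>b\<in>UNIV. expectation (\<lambda>\<omega>. (\<Sum>j<n. \<eta> j \<omega> $ a * zstate j \<omega> $ b)\<^sup>2))"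
        unfolding eq by (simp add: Bochner_Integration.integral_sum B)
      also have "\<dots> \<le> (1 / real n) * (\<Sum>a\<in>UNIV. \<Sum>b\<in>UNIV. real n * B a b)"
        by (intro mult_left_mono sum_mono B) simp
      also have "\<dots> = (\<Sum>a\<in>UNIV. \<Sum>b\<in>UNIV. B a b)"
        using False by (simp add: sum_distrib_left[symmetric])
      finally show ?thesis by linarith
    qed
  qed
qed

text \<open>The scores differ by the sum of outer (\<eta> j) (C^j x0) divided by sqrt n. Products of
  norms are bounded by sums of squares, whose expectations are constant in j; with geometric weights
  the expected difference is of order 1 / sqrt n.\<close>

lemma score_start_negligible:
  assumes [measurable]: "x0 \<in> borel_measurable M" and x0: "integrable M (\<lambda>\<omega>. (norm (x0 \<omega>))\<^sup>2)"
  shows "((\<lambda>s. score x0 (fst s) (snd s) - score (\<lambda>_. 0) (fst s) (snd s)) \<longlongrightarrow> 0) (in_prob M)"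
proof -
  define R where "R n \<omega> = (1 / sqrt (real n)) *
      (\<Sum>j<n. K * \<rho> ^ j * ((norm (\<eta> j \<omega>))\<^sup>2 + (norm (x0 \<omega>))\<^sup>2))" for n \<omega>
  have le: "norm (score x0 n \<omega> - score (\<lambda>_. 0) n \<omega>) \<le> R n \<omega>" for n \<omega>
  proof -
    have "outer (\<eta> j \<omega>) (state x0 j \<omega>) - outer (\<eta> j \<omega>) (zstate j \<omega>) = outer (\<eta> j \<omega>) (((*v) C ^^ j) (x0 \<omega>))" for j
    proof -
      have "state x0 j \<omega> = zstate j \<omega> + ((*v) C ^^ j) (x0 \<omega>)"
        unfolding state_def by (rule lin_state_zero_start)
      then show ?thesis by (simp add: outer_add)
    qed
    then have "score x0 n \<omega> - score (\<lambda>_. 0) n \<omega> =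
        (1 / sqrt (real n)) *\<^sub>R (\<Sum>j<n. outer (\<eta> j \<omega>) (((*v) C ^^ j) (x0 \<omega>)))"
      unfolding score_def by (simp add: scaleR_diff_right[symmetric] sum_subtractf[symmetric])
    also have "norm \<dots> \<le> (1 / sqrt (real n)) * (\<Sum>j<n. norm (outer (\<eta> j \<omega>) (((*v) C ^^ j) (x0 \<omega>))))"
      unfolding norm_scaleR by (intro mult_mono norm_sum) auto
    also have "\<dots> \<le> R n \<omega>"
      unfolding R_def
    proof (intro mult_left_mono sum_mono)
      fix j
      have "norm (outer (\<eta> j \<omega>) (((*v) C ^^ j) (x0 \<omega>))) \<le> norm (\<eta> j \<omega>) * (K * \<rho> ^ j * norm (x0 \<omega>))"
        unfolding norm_outer by (intro mult_left_mono C_pow) simp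
      also have "\<dots> = (K * \<rho> ^ j) * (norm (\<eta> j \<omega>) * norm (x0 \<omega>))" by simp
      also have "\<dots> \<le> (K * \<rho> ^ j) * ((norm (\<eta> j \<omega>))\<^sup>2 + (norm (x0 \<omega>))\<^sup>2)"
      proof (intro mult_left_mono)
        have "0 \<le> norm (\<eta> j \<omega>) * norm (x0 \<omega>)" by simp
        then show "norm (\<eta> j \<omega>) * norm (x0 \<omega>) \<le> (norm (\<eta> j \<omega>))\<^sup>2 + (norm (x0 \<omega>))\<^sup>2"
          using sum_squares_bound[of "norm (\<eta> j \<omega>)" "norm (x0 \<omega>)"] by linarith
      qed (use K \<rho> in simp)
      finally show "norm (outer (\<eta> j \<omega>) (((*v) C ^^ j) (x0 \<omega>))) \<le>
          K * \<rho> ^ j * ((norm (\<eta> j \<omega>))\<^sup>2 + (norm (x0 \<omega>))\<^sup>2)" .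
    qed simp
    finally show ?thesis .
  qed
  have "((\<lambda>s. R (fst s) (snd s)) \<longlongrightarrow> 0) (in_prob M)"
  proof (rule tendsto_in_prob_markov)
    show "integrable M (R n)" for n
      unfolding R_def using x0 noise_norm_square(1)
      by (intro integrable_mult_right Bochner_Integration.integrable_sum Bochner_Integration.integrable_add)
    show "0 \<le> R n \<omega>" for n \<omega> using le[of n \<omega>] by (rule order_trans[OF norm_ge_zero])
    let ?m = "trace S + expectation (\<lambda>\<omega>. (norm (x0 \<omega>))\<^sup>2)"
    have m: "0 \<le> ?m"
      unfolding noise_norm_square(2)[of 0, symmetric] by (intro add_nonneg_nonneg) simp_all
    have ER: "expectation (R n) = (1 / sqrt (real n)) * ((K * (\<Sum>j<n. \<rho> ^ j)) * ?m)" for n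
      unfolding R_def using x0 noise_norm_square
      by (simp add: Bochner_Integration.integral_sum sum_distrib_left sum_distrib_right mult_ac)
    show "(\<lambda>n. expectation (R n)) \<longlonglongrightarrow> 0"
    proof (rule tendsto_sandwich[OF _ _ tendsto_const])
      have "(\<lambda>n. 1 / sqrt (real n)) \<longlonglongrightarrow> 0" by real_asymp
      then show "(\<lambda>n. (1 / sqrt (real n)) * ((K * (1 / (1 - \<rho>))) * ?m)) \<longlonglongrightarrow> 0"
        by (rule tendsto_mult_left_zero)
      show "\<forall>\<^sub>F n in sequentially. expectation (R n) \<le> (1 / sqrt (real n)) * ((K * (1 / (1 - \<rho>))) * ?m)"
        unfolding ER using K \<rho> m
        by (intro always_eventually allI mult_left_mono mult_right_mono geometric_weights_sum_le) auto
      show "\<forall>\<^sub>F n in sequentially. 0 \<le> expectation (R n)"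
        unfolding ER using K \<rho> m
        by (intro always_eventually allI mult_nonneg_nonneg sum_nonneg) auto
    qed
  qed
  then show ?thesis
    by (rule Lim_null_comparison[rotated]) (auto intro!: always_eventually le)
qed

lemma score_tight:
  assumes [measurable]: "x0 \<in> borel_measurable M" and x0: "integrable M (\<lambda>\<omega>. (norm (x0 \<omega>))\<^sup>2)"
  shows "tight_in_prob (\<lambda>s. score x0 (fst s) (snd s))"
proof -
  obtain B where B: "\<And>n. integrable M (\<lambda>\<omega>. (norm (score (\<lambda>_. 0) n \<omega>))\<^sup>2)"
    "\<And>n. expectation (\<lambda>\<omega>. (norm (score (\<lambda>_. 0) n \<omega>))\<^sup>2) \<le> B"
    using score_zero_second_moment by blast
  have "tight_in_prob (\<lambda>s. score (\<lambda>_. 0) (fst s) (snd s))"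
    using B by (intro tight_in_prob_second_moment) auto
  from tight_in_prob_add[OF this tendsto_imp_tight_in_prob[OF score_start_negligible[OF assms]]]
  show ?thesis by simp
qed

lemma score_over_sqrt:
  assumes "x0 \<in> borel_measurable M" "integrable M (\<lambda>\<omega>. (norm (x0 \<omega>))\<^sup>2)"
  shows "((\<lambda>s. (1 / sqrt (real (fst s))) *\<^sub>R score x0 (fst s) (snd s)) \<longlongrightarrow> 0) (in_prob M)"
proof (rule tendsto_zero_mult_tight[OF score_tight[OF assms]])
  have "(\<lambda>n. 1 / sqrt (real n)) \<longlonglongrightarrow> 0" by real_asymp
  then show "((\<lambda>s. 1 / sqrt (real (fst s))) \<longlongrightarrow> 0) (in_prob M)"
    by (rule tendsto_seq_in_prob)
qed (simp add: mult.commute)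

text \<open>Sum the outer square of the state recursion over time. The two sums of squared states
  differ by boundary terms only, so the sample covariance satisfies the equation of \<Gamma> up to
  cross terms, the edge and the fluctuation of the sample noise covariance.\<close>

lemma gram_recursion:
  fixes x0 :: "'a \<Rightarrow> real^'m"
  defines "H \<equiv> \<lambda>n \<omega>. (1 / real n) *\<^sub>R (\<Sum>j<n. outer (\<eta> j \<omega>) (state x0 j \<omega>))"
  shows "gram x0 n \<omega> - C ** gram x0 n \<omega> ** transpose C =
    C ** transpose (H n \<omega>) ** transpose E + E ** H n \<omega> ** transpose C +
    E ** ((1 / real n) *\<^sub>R (\<Sum>j<n. outer (\<eta> j \<omega>) (\<eta> j \<omega>))) ** transpose E
    + (1 / real n) *\<^sub>R outer (x0 \<omega>) (x0 \<omega>) - (1 / real n) *\<^sub>R outer (state x0 n \<omega>) (state x0 n \<omega>)"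
proof -
  let ?x = "\<lambda>j. state x0 j \<omega>" and ?e = "\<lambda>j. \<eta> j \<omega>"
  have shift: "(\<Sum>j<n. outer (?x j) (?x j)) + outer (?x n) (?x n) =
      outer (x0 \<omega>) (x0 \<omega>) + (\<Sum>j<n. outer (?x (Suc j)) (?x (Suc j)))"
    using sum.lessThan_Suc_shift[of "\<lambda>j. outer (?x j) (?x j)" n] by (simp add: state_0)
  have step: "outer (?x (Suc j)) (?x (Suc j)) = C ** outer (?x j) (?x j) ** transpose C +
      C ** outer (?x j) (?e j) ** transpose E + E ** outer (?e j) (?x j) ** transpose C +
      E ** outer (?e j) (?e j) ** transpose E" for j
    unfolding state_Suc outer_add outer_matrix_vector by simp
  have "(\<Sum>j<n. outer (?x (Suc j)) (?x (Suc j))) =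
      C ** (\<Sum>j<n. outer (?x j) (?x j)) ** transpose C +
      C ** (\<Sum>j<n. outer (?x j) (?e j)) ** transpose E + E ** (\<Sum>j<n. outer (?e j) (?x j)) ** transpose C +
      E ** (\<Sum>j<n. outer (?e j) (?e j)) ** transpose E"
    unfolding step by (simp add: sum.distrib matrix_sum_mult matrix_mult_sum_right)
  then have "(\<Sum>j<n. outer (?x j) (?x j)) - C ** (\<Sum>j<n. outer (?x j) (?x j)) ** transpose C =
      C ** (\<Sum>j<n. outer (?x j) (?e j)) ** transpose E + E ** (\<Sum>j<n. outer (?e j) (?x j)) ** transpose C +
      E ** (\<Sum>j<n. outer (?e j) (?e j)) ** transpose E + outer (x0 \<omega>) (x0 \<omega>) - outer (?x n) (?x n)"
    using shift by (simp add: algebra_simps)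
  then have "(1 / real n) *\<^sub>R ((\<Sum>j<n. outer (?x j) (?x j)) - C ** (\<Sum>j<n. outer (?x j) (?x j)) ** transpose C) =
      (1 / real n) *\<^sub>R (C ** (\<Sum>j<n. outer (?x j) (?e j)) ** transpose E + E ** (\<Sum>j<n. outer (?e j) (?x j)) ** transpose C +
      E ** (\<Sum>j<n. outer (?e j) (?e j)) ** transpose E + outer (x0 \<omega>) (x0 \<omega>) - outer (?x n) (?x n))" by simp
  then show ?thesis
    unfolding gram_def H_def
    by (simp add: matrix_scaleR_mult transpose_scalar transpose_sum transpose_outer
        scaleR_add_right scaleR_diff_right)
qed

text \<open>In \<open>gram_recursion\<close> the cross terms are the score divided by sqrt n and the
  edge terms have bounded second moment divided by n, so all of them vanish and only E S E^T
  survives. The injective linear map \<open>T\<close> has a continuous left inverse, which transfers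
  the limit to the sample covariance itself.\<close>

theorem gram_lln:
  assumes [measurable]: "x0 \<in> borel_measurable M" and x0: "integrable M (\<lambda>\<omega>. (norm (x0 \<omega>))\<^sup>2)"
    and \<Gamma>: "\<Gamma> - C ** \<Gamma> ** transpose C = E ** S ** transpose E"
  shows "((\<lambda>s. gram x0 (fst s) (snd s)) \<longlongrightarrow> \<Gamma>) (in_prob M)"
proof -
  define T where "T X = X - C ** X ** transpose C" for X :: "real^'m^'m"
  have lin: "linear T"
    unfolding T_def
    by (rule linearI) (simp_all add: matrix_add_ldistrib matrix_add_rdistrib matrix_scaleR_mult
        scaleR_diff_right)
  have inj: "inj T"
    unfolding linear_injective_0[OF lin]
    using stein_operator_injective[OF C_pow \<rho>] by (auto simp: T_def)
  obtain g where g: "linear g" "g \<circ> T = id"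
    using linear_injective_left_inverse[OF lin inj] by blast
  define H where "H n \<omega> = (1 / real n) *\<^sub>R (\<Sum>j<n. outer (\<eta> j \<omega>) (state x0 j \<omega>))" for n \<omega>
  obtain B where B: "\<And>j. integrable M (\<lambda>\<omega>. (norm (state x0 j \<omega>))\<^sup>2)"
    "\<And>j. expectation (\<lambda>\<omega>. (norm (state x0 j \<omega>))\<^sup>2) \<le> B"
    using state_second_moment[OF assms(1) x0] by blast
  have H: "((\<lambda>s. H (fst s) (snd s)) \<longlongrightarrow> 0) (in_prob M)"
    using score_over_sqrt[OF assms(1) x0] by (simp add: score_def H_def)
  have edge: "((\<lambda>s. (1 / real (fst s)) *\<^sub>R outer (Y (fst s) (snd s)) (Y (fst s) (snd s))) \<longlongrightarrow> 0) (in_prob M)"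
    if Y: "\<And>n. integrable M (\<lambda>\<omega>. (norm (Y n \<omega>))\<^sup>2)" "\<And>n. expectation (\<lambda>\<omega>. (norm (Y n \<omega>))\<^sup>2) \<le> B'"
    for Y :: "nat \<Rightarrow> 'a \<Rightarrow> real^'m" and B'
  proof -
    have "((\<lambda>s. (norm (Y (fst s) (snd s)))\<^sup>2 / real (fst s)) \<longlongrightarrow> 0) (in_prob M)"
    proof (rule tendsto_in_prob_markov[where X = "\<lambda>n \<omega>. (norm (Y n \<omega>))\<^sup>2 / real n"])
      show "(\<lambda>n. expectation (\<lambda>\<omega>. (norm (Y n \<omega>))\<^sup>2 / real n)) \<longlonglongrightarrow> 0"
      proof (rule tendsto_sandwich[OF _ _ tendsto_const lim_const_over_n[of B']])
        show "\<forall>\<^sub>F n in sequentially. expectation (\<lambda>\<omega>. (norm (Y n \<omega>))\<^sup>2 / real n) \<le> B' / real n"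
          using Y by (intro always_eventually allI) (simp add: divide_right_mono)
      qed (intro always_eventually allI, simp)
    qed (use Y in auto)
    then show ?thesis
      by (rule Lim_null_comparison[rotated])
        (auto intro!: always_eventually simp: norm_outer power2_eq_square)
  qed
  have "((\<lambda>s. C ** transpose (H (fst s) (snd s)) ** transpose E + E ** H (fst s) (snd s) ** transpose C +
      E ** ((1 / real (fst s)) *\<^sub>R (\<Sum>j<fst s. outer (\<eta> j (snd s)) (\<eta> j (snd s)))) ** transpose E
      + (1 / real (fst s)) *\<^sub>R outer (x0 (snd s)) (x0 (snd s))
      - (1 / real (fst s)) *\<^sub>R outer (state x0 (fst s) (snd s)) (state x0 (fst s) (snd s)))
    \<longlongrightarrow> C ** transpose 0 ** transpose E + E ** 0 ** transpose C + E ** S ** transpose E + 0 - 0) (in_prob M)"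
    by (intro tendsto_add tendsto_diff tendsto_matrix_mult tendsto_transpose tendsto_const H
        noise_covariance_lln edge[of "\<lambda>_. x0", OF x0 order_refl] edge[of "state x0", OF B])
  moreover have "C ** transpose 0 ** transpose E + E ** 0 ** transpose C + E ** S ** transpose E + 0 - 0 = T \<Gamma>"
    unfolding T_def \<Gamma> by (simp add: vec_eq_iff matrix_matrix_mult_def transpose_def)
  ultimately have "((\<lambda>s. T (gram x0 (fst s) (snd s))) \<longlongrightarrow> T \<Gamma>) (in_prob M)"
    unfolding T_def gram_recursion H_def by simp
  then have "((\<lambda>s. g (T (gram x0 (fst s) (snd s)))) \<longlongrightarrow> g (T \<Gamma>)) (in_prob M)"
    by (rule isCont_tendsto_compose[OF linear_continuous_at[OF linear_conv_bounded_linear[THEN iffD1, OF g(1)]]])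
  then show ?thesis using g(2) by (simp add: fun_eq_iff)
qed

text \<open>For the zero start, the pairing of \<Lambda> with the score is a martingale sum with
  coefficient \<Lambda> times the current state. Its conditional variance is linear in the sample
  state covariance, so \<open>gram_lln\<close> supplies the limit.\<close>

theorem score_clt:
  assumes [measurable]: "x0 \<in> borel_measurable M" and x0: "integrable M (\<lambda>\<omega>. (norm (x0 \<omega>))\<^sup>2)"
    and \<Gamma>: "\<Gamma> - C ** \<Gamma> ** transpose C = E ** S ** transpose E"
  shows "(\<lambda>n. LINT \<omega>|M. iexp (\<Lambda> \<bullet> score x0 n \<omega>)) \<longlonglongrightarrow>
    of_real (exp (- ((S ** \<Lambda>) \<bullet> (\<Lambda> ** \<Gamma>)) / 2))"
proof -
  define c where "c l w = \<Lambda> *v lin_state C E 0 w l" for l w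
  have c_meas: "c l \<in> borel_measurable (Pi\<^sub>M {..<l} (\<lambda>_. borel))" for l
    unfolding c_def using measurable_lin_state[of l l C E 0] by measurable
  have c: "c l (past l \<omega>) = \<Lambda> *v zstate l \<omega>" for l \<omega>
    by (simp add: c_def zstate_past[of l l])
  have "((\<lambda>s. (S ** \<Lambda>) \<bullet> (\<Lambda> ** gram (\<lambda>_. 0) (fst s) (snd s))) \<longlongrightarrow> (S ** \<Lambda>) \<bullet> (\<Lambda> ** \<Gamma>)) (in_prob M)"
    by (intro tendsto_inner tendsto_matrix_mult tendsto_const gram_lln[OF _ _ \<Gamma>]) auto
  moreover have "(S ** \<Lambda>) \<bullet> (\<Lambda> ** gram (\<lambda>_. 0) n \<omega>) =
      (\<Sum>l<n. c l (past l \<omega>) \<bullet> (S *v c l (past l \<omega>))) / real n" for n \<omega>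
  proof -
    have "(S ** \<Lambda>) \<bullet> (\<Lambda> ** outer v v) = (\<Lambda> *v v) \<bullet> (S *v (\<Lambda> *v v))" for v
    proof -
      have "\<Lambda> ** outer v v = outer (\<Lambda> *v v) v"
        using outer_matrix_vector[of \<Lambda> v "mat 1" v] by simp
      then show ?thesis by (simp add: inner_outer matrix_vector_mul_assoc)
    qed
    then show ?thesis
      unfolding gram_def c by (simp add: matrix_scaleR_mult matrix_mult_sum_right inner_sum_right)
  qed
  ultimately have "(\<lambda>n. LINT \<omega>|M. iexp ((\<Sum>l<n. c l (past l \<omega>) \<bullet> \<eta> l \<omega>) / sqrt (real n))) \<longlonglongrightarrow>
      of_real (exp (- ((S ** \<Lambda>) \<bullet> (\<Lambda> ** \<Gamma>)) / 2))"
    by (intro gaussian_martingale_clt c_meas) simp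
  moreover have "(\<Sum>l<n. c l (past l \<omega>) \<bullet> \<eta> l \<omega>) / sqrt (real n) = \<Lambda> \<bullet> score (\<lambda>_. 0) n \<omega>" for n \<omega>
    unfolding c score_def by (simp add: inner_sum_right inner_outer inner_commute)
  ultimately have z: "(\<lambda>n. LINT \<omega>|M. iexp (\<Lambda> \<bullet> score (\<lambda>_. 0) n \<omega>)) \<longlonglongrightarrow>
      of_real (exp (- ((S ** \<Lambda>) \<bullet> (\<Lambda> ** \<Gamma>)) / 2))" by simp
  have int: "integrable M (\<lambda>\<omega>. iexp (\<Lambda> \<bullet> score y n \<omega>))" if [measurable]: "y \<in> borel_measurable M" for y n
    by (intro integrable_const_bound[where B = 1]) auto
  have "(\<lambda>n. LINT \<omega>|M. iexp (\<Lambda> \<bullet> score x0 n \<omega>) - iexp (\<Lambda> \<bullet> score (\<lambda>_. 0) n \<omega>)) \<longlonglongrightarrow> 0"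
  proof (rule bounded_convergence_in_prob[where K = 2])
    show "norm (iexp (\<Lambda> \<bullet> score x0 n \<omega>) - iexp (\<Lambda> \<bullet> score (\<lambda>_. 0) n \<omega>)) \<le> 2" for n \<omega>
      by (rule order_trans[OF norm_triangle_ineq4]) simp
    have lim: "((\<lambda>s. iexp (\<Lambda> \<bullet> (score x0 (fst s) (snd s) - score (\<lambda>_. 0) (fst s) (snd s))) - 1) \<longlongrightarrow> iexp (\<Lambda> \<bullet> 0) - 1) (in_prob M)"
      by (intro tendsto_intros score_start_negligible assms x0)
    then have "((\<lambda>s. norm (iexp (\<Lambda> \<bullet> (score x0 (fst s) (snd s) - score (\<lambda>_. 0) (fst s) (snd s))) - 1)) \<longlongrightarrow> 0) (in_prob M)"
      using tendsto_norm by fastforce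
    moreover have "norm (iexp (a - b) - 1) = norm (iexp a - iexp b)" for a b :: real
    proof -
      have "\<i> * complex_of_real a = \<i> * complex_of_real b + \<i> * complex_of_real (a - b)"
        by (simp add: algebra_simps)
      then have "iexp a = iexp b * iexp (a - b)" by (simp only: exp_add)
      then have "iexp a - iexp b = iexp b * (iexp (a - b) - 1)" by (simp add: algebra_simps)
      then show ?thesis by (simp add: norm_mult)
    qed
    ultimately have "((\<lambda>s. norm (iexp (\<Lambda> \<bullet> score x0 (fst s) (snd s)) - iexp (\<Lambda> \<bullet> score (\<lambda>_. 0) (fst s) (snd s)))) \<longlongrightarrow> 0) (in_prob M)"
      by (simp only: inner_diff_right)
    then show "((\<lambda>s. iexp (\<Lambda> \<bullet> score x0 (fst s) (snd s)) - iexp (\<Lambda> \<bullet> score (\<lambda>_. 0) (fst s) (snd s))) \<longlongrightarrow> 0) (in_prob M)"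
      by (rule tendsto_norm_zero_cancel)
  qed measurable
  then have "(\<lambda>n. (LINT \<omega>|M. iexp (\<Lambda> \<bullet> score x0 n \<omega>)) - (LINT \<omega>|M. iexp (\<Lambda> \<bullet> score (\<lambda>_. 0) n \<omega>))) \<longlonglongrightarrow> 0"
    using int by simp
  from tendsto_add[OF this z] show ?thesis by simp
qed

end

section \<open>Vectorised matrices\<close>

text \<open>Rows are stacked, so that a Kronecker product with the identity on the left acts on
  every row separately.\<close>

definition vec_of_mat :: "real^'b^'a \<Rightarrow> real^('a \<times> 'b)" where
  "vec_of_mat V = (\<chi> a. V $ fst a $ snd a)"

definition mat_of_vec :: "real^('a \<times> 'b) \<Rightarrow> real^'b^'a" where
  "mat_of_vec u = (\<chi> i b. u $ (i, b))"

lemma vec_of_mat_of_vec [simp]: "vec_of_mat (mat_of_vec u) = u"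
  by (simp add: vec_eq_iff vec_of_mat_def mat_of_vec_def)

lemma inner_vec_of_mat: "vec_of_mat U \<bullet> vec_of_mat V = U \<bullet> (V :: real^'b^'a)"
  by (simp add: inner_vec_def vec_of_mat_def sum_UNIV_Times)

lemma norm_vec_of_mat [simp]: "norm (vec_of_mat (V :: real^'b^'a)) = norm V"
  by (simp add: norm_eq_sqrt_inner inner_vec_of_mat)

lemma vec_of_mat_diff: "vec_of_mat (U - V) = vec_of_mat U - vec_of_mat V"
  by (simp add: vec_eq_iff vec_of_mat_def)

lemma kron_mat_1_vec: "kron (mat 1) K *v vec_of_mat V = vec_of_mat (\<chi> i. K *v (V $ i))"
  for K :: "real^'b::finite^'b" and V :: "real^'b^'a::finite"
proof -
  have "(kron (mat 1) K *v vec_of_mat V) $ (i, b) = (K *v (V $ i)) $ b" for i b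
  proof -
    have "(kron (mat 1) K *v vec_of_mat V) $ (i, b) =
        (\<Sum>j\<in>UNIV. \<Sum>c\<in>UNIV. (if i = j then 1 else 0) * K $ b $ c * V $ j $ c)"
      by (simp add: matrix_vector_mult_def kron_def vec_of_mat_def sum_UNIV_Times mat_def)
    also have "\<dots> = (\<Sum>j\<in>UNIV. if i = j then (\<Sum>c\<in>UNIV. K $ b $ c * V $ j $ c) else 0)"
      by (intro sum.cong refl) auto
    finally show ?thesis by (simp add: matrix_vector_mult_def)
  qed
  then show ?thesis by (simp add: vec_eq_iff vec_of_mat_def)
qed

lemma kron_mat_1_form:
  "vec_of_mat U \<bullet> (kron (mat 1) K *v vec_of_mat V) = (\<Sum>i\<in>UNIV. U $ i \<bullet> (K *v V $ i))"
  for K :: "real^'b::finite^'b" and V :: "real^'b^'a::finite"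
  unfolding kron_mat_1_vec inner_vec_of_mat by (simp add: inner_vec_def[of U])

lemma psd_kron_mat_1:
  assumes "psd K"
  shows "psd (kron (mat 1 :: real^'a::finite^'a) (K :: real^'b::finite^'b))"
  unfolding psd_def
proof (intro conjI allI)
  show "transpose (kron (mat 1) K) = kron (mat 1 :: real^'a^'a) K"
    using psd_nth_commute[OF assms] by (auto simp: vec_eq_iff transpose_def kron_def mat_def)
  fix v :: "real^('a \<times> 'b)"
  have "v \<bullet> (kron (mat 1) K *v v) = (\<Sum>i\<in>UNIV. mat_of_vec v $ i \<bullet> (K *v mat_of_vec v $ i))"
    using kron_mat_1_form[of "mat_of_vec v" K "mat_of_vec v"] by simp
  also have "0 \<le> \<dots>" using assms unfolding psd_def by (intro sum_nonneg) auto
  finally show "0 \<le> v \<bullet> (kron (mat 1) K *v v)" .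
qed

lemma trace_form_eq: "U \<bullet> V = trace (transpose U ** V)" for U V :: "real^'n^'m"
  unfolding inner_vec_def trace_def transpose_def matrix_matrix_mult_def
  by simp (rule sum.swap)

lemma inner_matrix_mult_left: "U \<bullet> (P ** D) = (transpose P ** U) \<bullet> D"
  for U :: "real^'n^'m" and P :: "real^'k^'m"
  by (simp add: trace_form_eq matrix_transpose_mul matrix_mul_assoc)

lemma inner_matrix_mult_right: "U \<bullet> (D ** R) = (U ** transpose R) \<bullet> D"
  for U :: "real^'n^'m" and D :: "real^'k^'m"
  unfolding trace_form_eq matrix_transpose_mul transpose_transpose
  by (simp only: matrix_mul_assoc trace_mul_sym[of _ R])

lemma quadratic_form_diff_le:
  fixes Q :: "real^'n^'n"
  shows "\<bar>u \<bullet> (Q *v u) - v \<bullet> (Q *v v)\<bar> \<le> norm (u - v) * (norm Q * (norm u + norm v))"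
proof -
  have "u \<bullet> (Q *v u) - v \<bullet> (Q *v v) = (u - v) \<bullet> (Q *v u) + v \<bullet> (Q *v (u - v))"
    by (simp add: inner_diff_left matrix_vector_mult_diff_distrib inner_diff_right)
  also have "\<bar>\<dots>\<bar> \<le> \<bar>(u - v) \<bullet> (Q *v u)\<bar> + \<bar>v \<bullet> (Q *v (u - v))\<bar>" by (rule abs_triangle_ineq)
  also have "\<dots> \<le> norm (u - v) * (norm Q * norm u) + norm v * (norm Q * norm (u - v))"
    by (intro add_mono order_trans[OF Cauchy_Schwarz_ineq2] mult_left_mono norm_matrix_vector_le) auto
  finally show ?thesis by (simp add: algebra_simps)
qed

text \<open>On the unit sphere the form of \<open>S\<close> has a positive minimum c; a symmetric
  matrix within distance c of \<open>S\<close> is still positive definite.\<close>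

lemma eventually_pos_definite:
  fixes S :: "real^'n^'n"
  assumes S: "pos_definite S" and f: "(f \<longlongrightarrow> S) F" and sym: "\<forall>\<^sub>F x in F. transpose (f x) = f x"
  shows "\<forall>\<^sub>F x in F. pos_definite (f x)"
proof -
  have cont: "continuous_on (sphere 0 1) (\<lambda>v. v \<bullet> (S *v v))"
    by (intro continuous_intros linear_continuous_on matrix_vector_mul_bounded_linear)
  have "sphere 0 1 \<noteq> ({} :: (real^'n) set)"
    using norm_axis_1[of "undefined :: 'n"] by (metis empty_iff mem_sphere_0)
  then obtain v0 where v0: "v0 \<in> sphere 0 1" "\<And>v. v \<in> sphere 0 1 \<Longrightarrow> v0 \<bullet> (S *v v0) \<le> v \<bullet> (S *v v)"
    using continuous_attains_inf[OF compact_sphere _ cont] by blast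
  define c where "c = v0 \<bullet> (S *v v0)"
  have "v0 \<noteq> 0" using v0(1) by auto
  then have c: "0 < c" using S unfolding c_def pos_definite_def by blast
  have low: "c * (norm v)\<^sup>2 \<le> v \<bullet> (S *v v)" for v
  proof (cases "v = 0")
    case False
    have "c \<le> ((1 / norm v) *\<^sub>R v) \<bullet> (S *v ((1 / norm v) *\<^sub>R v))"
      unfolding c_def using False by (intro v0(2)) simp
    also have "\<dots> = (v \<bullet> (S *v v)) / (norm v)\<^sup>2"
      by (simp add: matrix_vector_mult_scaleR power2_eq_square)
    finally show ?thesis using False by (simp add: pos_le_divide_eq)
  qed simp
  show ?thesis using sym tendstoD[OF f c]
  proof eventually_elim
    case (elim x)
    show ?case unfolding pos_definite_def
    proof (intro conjI allI impI)
      fix v :: "real^'n" assume v: "v \<noteq> 0"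
      have "\<bar>v \<bullet> ((f x - S) *v v)\<bar> \<le> norm v * (norm (f x - S) * norm v)"
        by (intro order_trans[OF Cauchy_Schwarz_ineq2] mult_left_mono norm_matrix_vector_le) simp
      also have "\<dots> < c * (norm v)\<^sup>2"
        using elim v by (simp add: power2_eq_square dist_norm)
      finally have "v \<bullet> (S *v v) - v \<bullet> (f x *v v) < c * (norm v)\<^sup>2"
        by (simp add: matrix_vector_mult_diff_rdistrib inner_diff_right)
      then show "0 < v \<bullet> (f x *v v)" using low[of v] by linarith
    qed (use elim in simp)
  qed
qed

section \<open>The regression in state-space form\<close>

definition coeff_mat :: "('p::{finite,linorder}, 'n::finite) var_coeffs \<Rightarrow> real^('p \<times> 'n)^'n" where
  "coeff_mat A = (\<chi> i b. A $ fst b $ i $ snd b)"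

text \<open>The regressors for time t. Lags start at 1, so \<open>u t\<close> is absent and the
  noise at t first enters the vector for t + 1.\<close>

definition lagged :: "(int \<Rightarrow> real^'n) \<Rightarrow> int \<Rightarrow> real^('p::{finite,linorder} \<times> 'n::finite)" where
  "lagged u t = (\<chi> b. u (t - int (lag (fst b))) $ snd b)"

definition noise_input :: "real^'n::finite^('p::{finite,linorder} \<times> 'n)" where
  "noise_input = (\<chi> a j. if lag (fst a) = 1 \<and> snd a = j then 1 else 0)"

lemma var_predict_eq: "var_predict A u t = coeff_mat A *v lagged u t"
proof -
  have "var_predict A u t $ i = (coeff_mat A *v lagged u t) $ i" for i
    by (simp add: var_predict_def coeff_mat_def lagged_def matrix_vector_mult_def sum_UNIV_Times)
  then show ?thesis by (simp add: vec_eq_iff)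
qed

lemma lagged_step:
  fixes A :: "('p::{finite,linorder}, 'n::finite) var_coeffs"
  assumes "u t = var_predict A u t + w"
  shows "lagged u (t + 1) = companion A *v lagged u t + noise_input *v w"
proof -
  have "(lagged u (t + 1) :: real^('p \<times> 'n)) $ (k, i) = (companion A *v lagged u t + noise_input *v w) $ (k, i)" for k i
  proof (cases "lag k = 1")
    case True
    have "(companion A *v lagged u t) $ (k, i) = (coeff_mat A *v lagged u t) $ i"
      by (simp add: matrix_vector_mult_def companion_first_row[OF True] coeff_mat_def)
    moreover have "((noise_input :: real^'n^('p \<times> 'n)) *v w) $ (k, i) = w $ i"
      by (simp add: matrix_vector_mult_def noise_input_def True if_distrib if_distribR cong: if_cong)
    moreover have "(lagged u (t + 1) :: real^('p \<times> 'n)) $ (k, i) = u t $ i"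
      by (simp add: lagged_def True)
    moreover have "u t $ i = (coeff_mat A *v lagged u t) $ i + w $ i"
      using assms by (simp add: var_predict_eq)
    ultimately show ?thesis by simp
  next
    case False
    then obtain k' :: 'p where k': "lag k = lag k' + 1" by (rule lag_pred)
    have "(companion A *v lagged u t) $ (k, i) = (lagged u t :: real^('p \<times> 'n)) $ (k', i)"
      by (simp add: matrix_vector_mult_def companion_shift_row[OF k'] if_distrib if_distribR cong: if_cong)
    moreover have "((noise_input :: real^'n^('p \<times> 'n)) *v w) $ (k, i) = 0"
      using False by (simp add: matrix_vector_mult_def noise_input_def)
    ultimately show ?thesis by (simp add: lagged_def k')
  qed
  then show ?thesis by (simp add: vec_eq_iff)
qed

lemma lagged_eq_lin_state:
  fixes A :: "('p::{finite,linorder}, 'n::finite) var_coeffs"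
  assumes "\<And>t. u t = var_predict A u t + w t"
  shows "lagged u (t0 + int j) = lin_state (companion A) noise_input (lagged u t0) (\<lambda>l. w (t0 + int l)) j"
proof (induction j)
  case (Suc j)
  have "lagged u (t0 + int (Suc j)) = companion A *v lagged u (t0 + int j) + noise_input *v w (t0 + int j)"
  proof -
    have "t0 + int (Suc j) = t0 + int j + 1" by simp
    then show ?thesis using lagged_step[OF assms[of "t0 + int j"]] by (simp only:)
  qed
  then show ?case using Suc by simp
qed simp

lemma matrix_mult_transpose_nth':
  "(X ** transpose Y) $ a $ b = (\<Sum>j\<in>UNIV. X $ a $ j * Y $ b $ j)"
  by (simp add: matrix_matrix_mult_def transpose_def)

lemma noise_input_corner:
  "(noise_input :: real^'n::finite^('p::{finite,linorder} \<times> 'n)) ** S ** transpose noise_input = corner_block S"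
proof -
  let ?N = "noise_input :: real^'n^('p \<times> 'n)"
  have N: "?N $ a $ j = (if lag (fst a) = 1 \<and> snd a = j then 1 else 0)" for a j
    by (simp add: noise_input_def)
  have ind: "(if Q then 1 else 0) * x = (if Q then x else 0)"
    and ind': "x * (if Q then 1 else 0) = (if Q then x else 0)" for Q and x :: real by auto
  have NS: "(?N ** S) $ a $ j = (if lag (fst a) = 1 then S $ snd a $ j else 0)" for a j
    by (cases "lag (fst a) = 1") (simp_all add: matrix_matrix_mult_def N ind)
  have "(?N ** S ** transpose ?N) $ a $ b = corner_block S $ a $ b" for a b
    unfolding matrix_mult_transpose_nth' NS N
    by (cases "lag (fst a) = 1"; cases "lag (fst b) = 1") (simp_all add: corner_block_def ind')
  then show ?thesis by (simp add: vec_eq_iff)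
qed

lemma sum_regression_times:
  "(\<Sum>t\<in>{int p + 1..int (n + p)}. f t) = (\<Sum>j<n. f (int p + 1 + int j))"
  by (rule sum.reindex_bij_witness[where i = "\<lambda>j. int p + 1 + int j" and j = "\<lambda>t. nat (t - int p - 1)"]) auto

lemma quadratic_min_imp_linear_zero:
  fixes b c :: real
  assumes "\<And>s. 0 \<le> s\<^sup>2 * c - 2 * s * b"
  shows "b = 0"
proof (rule ccontr)
  assume b: "b \<noteq> 0"
  define d where "d = \<bar>c\<bar> + 1"
  have d: "0 < d" "c \<le> d" by (auto simp: d_def)
  \<comment> \<open>The choice s = b/d minimises s^2 d - 2 s b, with value -b^2/d; using d >= c, d >
    0 in place of c covers every sign of c.\<close>
  have "0 \<le> (b / d)\<^sup>2 * c - 2 * (b / d) * b" by (rule assms)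
  also have "\<dots> \<le> (b / d)\<^sup>2 * d - 2 * (b / d) * b"
    using d by (intro diff_right_mono mult_left_mono) auto
  also have "\<dots> = - (b\<^sup>2 / d)"
    using d by (simp add: field_simps power2_eq_square)
  finally show False using b d by (simp add: divide_le_0_iff)
qed

text \<open>Perturbing a single coefficient by s changes the residual sum of squares by a quadratic
  polynomial in s that is nonnegative for all s, so its linear part vanishes. This holds for
  whichever minimiser was selected.\<close>

lemma ols_normal_equations:
  fixes A :: "('p::{finite,linorder}, 'n::finite) var_coeffs"
  assumes "is_ols (n + CARD('p)) u A"
  shows "(\<Sum>j<n. outer (u (int CARD('p) + 1 + int j) - var_predict A u (int CARD('p) + 1 + int j))
    (lagged u (int CARD('p) + 1 + int j) :: real^('p \<times> 'n))) = 0"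
proof -
  let ?t = "\<lambda>j. int CARD('p) + 1 + int j"
  define r where "r j = u (?t j) - var_predict A u (?t j)" for j
  define z :: "nat \<Rightarrow> real^('p \<times> 'n)" where "z j = lagged u (?t j)" for j
  have "(\<Sum>j<n. r j $ i * z j $ (k, l)) = 0" for i k l
  proof (rule quadratic_min_imp_linear_zero)
    fix s :: real
    define H :: "('p, 'n) var_coeffs" where "H = (\<chi> k' i' l'. if k' = k \<and> i' = i \<and> l' = l then s else 0)"
    have pred: "var_predict (A + H) u t = var_predict A u t + (s * (lagged u t :: real^('p \<times> 'n)) $ (k, l)) *\<^sub>R axis i 1" for t
    proof -
      have "(coeff_mat (A + H) *v (lagged u t :: real^('p \<times> 'n))) $ i' =
        (coeff_mat A *v (lagged u t :: real^('p \<times> 'n))) $ i' + (\<Sum>b\<in>UNIV. if b = (k, l) then (if i' = i then s * (lagged u t :: real^('p \<times> 'n)) $ (k, l) else 0) else 0)" for i'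
        unfolding matrix_vector_mult_def coeff_mat_def vec_lambda_beta sum.distrib[symmetric]
        by (intro sum.cong refl) (auto simp: H_def algebra_simps)
      then show ?thesis
        unfolding var_predict_eq by (simp add: vec_eq_iff axis_def)
    qed
    have "rss (n + CARD('p)) u A \<le> rss (n + CARD('p)) u (A + H)"
      using assms unfolding is_ols_def by blast
    then have "(\<Sum>j<n. (norm (r j))\<^sup>2) \<le> (\<Sum>j<n. (norm (r j - (s * z j $ (k, l)) *\<^sub>R axis i 1))\<^sup>2)"
      unfolding rss_def sum_regression_times r_def z_def pred by (simp add: diff_diff_eq)
    also have "\<dots> = (\<Sum>j<n. (norm (r j))\<^sup>2 - 2 * s * (r j $ i * z j $ (k, l)) + s\<^sup>2 * (z j $ (k, l))\<^sup>2)"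
      unfolding power2_norm_eq_inner by (intro sum.cong refl)
        (simp add: inner_diff_left inner_diff_right inner_axis inner_axis' power2_eq_square algebra_simps)
    also have "\<dots> = (\<Sum>j<n. (norm (r j))\<^sup>2) - 2 * s * (\<Sum>j<n. r j $ i * z j $ (k, l)) + s\<^sup>2 * (\<Sum>j<n. (z j $ (k, l))\<^sup>2)"
      by (simp add: sum.distrib sum_subtractf sum_distrib_left)
    finally show "0 \<le> s\<^sup>2 * (\<Sum>j<n. (z j $ (k, l))\<^sup>2) - 2 * s * (\<Sum>j<n. r j $ i * z j $ (k, l))" by simp
  qed
  then show ?thesis
    unfolding r_def z_def by (simp add: vec_eq_iff outer_def)
qed

section \<open>The state covariance\<close>

context prob_space
begin

text \<open>Allows uniqueness of limits and passage to the limit in inequalities: an exceptional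
  event of probability at most 1/2 cannot be the whole space.\<close>

lemma in_prob_not_bot: "in_prob M \<noteq> bot"
proof
  assume "in_prob M = bot"
  then have "eventually (\<lambda>_. False) (in_prob M)" by simp
  from this[unfolded eventually_in_prob, rule_format, of "1 / 2"]
  obtain B where B: "B \<in> events" "prob B \<le> 1 / 2" "\<forall>\<omega>\<in>space M - B. False"
    by (auto simp: eventually_sequentially)
  then have "B = space M" using sets.sets_into_space by blast
  then show False using B(2) prob_space by simp
qed

lemma indep_vars_reindex_inj:
  assumes ind: "indep_vars (\<lambda>_. N) X UNIV" and f: "inj f"
  shows "indep_vars (\<lambda>_. N) (\<lambda>j. X (f j)) UNIV"
proof -
  have "indep_vars (\<lambda>j. Pi\<^sub>M {f j} (\<lambda>_. N)) (\<lambda>j \<omega>. restrict (\<lambda>i. X i \<omega>) {f j}) UNIV"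
    using f by (intro indep_vars_restrict[OF ind]) (auto simp: disjoint_family_on_def inj_def)
  then have "indep_vars (\<lambda>_. N) (\<lambda>j \<omega>. (\<lambda>h. h (f j)) (restrict (\<lambda>i. X i \<omega>) {f j})) UNIV"
    by (rule indep_vars_compose2) (auto intro: measurable_component_singleton)
  then show ?thesis by simp
qed

end

text \<open>\<Gamma> is the limit in probability of sample covariances, which are symmetric and
  positive semidefinite for every outcome; both properties are closed.\<close>

lemma (in linear_process) psd_state_covariance:
  assumes \<Gamma>: "\<Gamma> - C ** \<Gamma> ** transpose C = E ** S ** transpose E"
  shows "psd \<Gamma>"
  unfolding psd_def
proof (intro conjI allI)
  have lim: "((\<lambda>s. gram (\<lambda>_. 0) (fst s) (snd s)) \<longlongrightarrow> \<Gamma>) (in_prob M)"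
    by (rule gram_lln[OF _ _ \<Gamma>]) auto
  have "transpose (gram (\<lambda>_. 0) n \<omega>) = gram (\<lambda>_. 0) n \<omega>" for n \<omega>
    unfolding gram_def by (simp add: transpose_scalar transpose_sum transpose_outer)
  then show "transpose \<Gamma> = \<Gamma>"
    using tendsto_unique[OF in_prob_not_bot tendsto_transpose[OF lim]] lim by simp
  fix v
  have "0 \<le> v \<bullet> (gram (\<lambda>_. 0) n \<omega> *v v)" for n \<omega>
  proof -
    have "outer z z *v v = (z \<bullet> v) *\<^sub>R z" for z :: "real^'m"
      by (simp add: vec_eq_iff outer_def matrix_vector_mult_def inner_vec_def sum_distrib_left mult_ac)
    then have "v \<bullet> (outer z z *v v) = (z \<bullet> v)\<^sup>2" for z :: "real^'m"
      by (simp add: power2_eq_square inner_commute)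
    moreover have "v \<bullet> (gram (\<lambda>_. 0) n \<omega> *v v) = (1 / real n) * (\<Sum>j<n. v \<bullet> (outer (zstate j \<omega>) (zstate j \<omega>) *v v))"
    proof -
      have "(\<Sum>j<n. outer (zstate j \<omega>) (zstate j \<omega>)) *v v = (\<Sum>j<n. outer (zstate j \<omega>) (zstate j \<omega>) *v v)"
        by (induction n) (simp_all add: matrix_vector_mult_add_rdistrib)
      moreover have "(c *\<^sub>R X) *v v = c *\<^sub>R (X *v v)" for c and X :: "real^'m^'m"
        by (simp add: vec_eq_iff matrix_vector_mult_def sum_distrib_left mult_ac)
      ultimately show ?thesis unfolding gram_def by (simp add: inner_sum_right)
    qed
    ultimately show ?thesis by (simp add: sum_nonneg)
  qed
  then have "\<forall>\<^sub>F s in in_prob M. 0 \<le> v \<bullet> (gram (\<lambda>_. 0) (fst s) (snd s) *v v)" by simp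
  moreover have "((\<lambda>s. v \<bullet> (gram (\<lambda>_. 0) (fst s) (snd s) *v v)) \<longlongrightarrow> v \<bullet> (\<Gamma> *v v)) (in_prob M)"
    by (intro tendsto_intros lim)
  ultimately show "0 \<le> v \<bullet> (\<Gamma> *v v)"
    using tendsto_lowerbound in_prob_not_bot by blast
qed

text \<open>
  If \<open>v \<bullet> \<Gamma> v = 0\<close> then the first block of \<open>v\<close> vanishes and \<open>C\<^sup>T v\<close>, whose blocks are those of \<open>v\<close>
  shifted up by one lag, again annihilates the form.
\<close>

lemma pos_definite_state_covariance:
  fixes A :: "('p::{finite,linorder}, 'n::finite) var_coeffs"
  assumes \<Gamma>: "\<Gamma> - companion A ** \<Gamma> ** transpose (companion A) = corner_block S"
    and psd: "psd \<Gamma>" and S: "pos_definite S"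
  shows "pos_definite \<Gamma>"
proof -
  let ?C = "companion A" and ?N = "noise_input :: real^'n^('p \<times> 'n)"
  have step: "(\<forall>k i. lag k = 1 \<longrightarrow> v $ (k, i) = 0) \<and> (transpose ?C *v v) \<bullet> (\<Gamma> *v (transpose ?C *v v)) = 0"
    if v: "v \<bullet> (\<Gamma> *v v) = 0" for v
  proof -
    let ?w = "transpose ?C *v v" and ?y = "transpose ?N *v v"
    have tr: "v \<bullet> (L *v x) = (transpose L *v v) \<bullet> x" for L :: "real^'k^('p \<times> 'n)" and x
      by (simp add: dot_lmul_matrix)
    have eq: "\<Gamma> = ?C ** \<Gamma> ** transpose ?C + ?N ** S ** transpose ?N"
      using \<Gamma> unfolding noise_input_corner by (simp add: algebra_simps)
    have "v \<bullet> (\<Gamma> *v v) = v \<bullet> (?C *v (\<Gamma> *v ?w)) + v \<bullet> (?N *v (S *v ?y))"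
      by (subst eq) (simp only: matrix_vector_mult_add_rdistrib inner_add_right matrix_vector_mul_assoc matrix_mul_assoc)
    also have "\<dots> = ?w \<bullet> (\<Gamma> *v ?w) + ?y \<bullet> (S *v ?y)"
      by (simp only: tr)
    finally have "?w \<bullet> (\<Gamma> *v ?w) + ?y \<bullet> (S *v ?y) = 0" using v by simp
    moreover have "0 \<le> ?w \<bullet> (\<Gamma> *v ?w)" "0 \<le> ?y \<bullet> (S *v ?y)"
      using psd pos_definite_imp_psd[OF S] unfolding psd_def by blast+
    ultimately have z: "?w \<bullet> (\<Gamma> *v ?w) = 0" "?y \<bullet> (S *v ?y) = 0" by linarith+
    then have y0: "?y = 0" using S unfolding pos_definite_def by (metis less_irrefl)
    have "v $ (k, i) = 0" if k: "lag k = 1" for k i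
    proof -
      have "?y $ i = (\<Sum>k'\<in>UNIV. if k' = k then v $ (k', i) else 0)"
        unfolding matrix_vector_mult_def transpose_def noise_input_def vec_lambda_beta sum_UNIV_Times
        using k lag_inj[of _ k] by (intro sum.cong refl) (auto simp: if_distrib if_distribR cong: if_cong)
      then show ?thesis using y0 by simp
    qed
    then show ?thesis using z by blast
  qed
  \<comment> \<open>The vector stays quantified because the induction hypothesis is applied to the
    transposed companion matrix times v. The coefficient row of that matrix contributes nothing, as
    the first block of v vanishes.\<close>
  have zero: "\<forall>v. v \<bullet> (\<Gamma> *v v) = 0 \<longrightarrow> (\<forall>k i. lag k = Suc j \<longrightarrow> v $ (k, i) = 0)" for j
  proof (induction j)
    case 0 then show ?case using step by simp
  next
    case (Suc j)
    show ?case
    proof (intro allI impI)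
      fix v :: "real^('p \<times> 'n)" and k :: 'p and i
      assume v: "v \<bullet> (\<Gamma> *v v) = 0" and k: "lag k = Suc (Suc j)"
      then obtain k' :: 'p where k': "lag k = lag k' + 1" using lag_pred[of k] by auto
      note st = step[OF v]
      have "(transpose ?C *v v) $ (k', i) = (\<Sum>a\<in>UNIV. if a = (k, i) then v $ a else 0)"
        unfolding matrix_vector_mult_def transpose_def vec_lambda_beta
      proof (intro sum.cong refl)
        fix a :: "'p \<times> 'n"
        obtain l m where a: "a = (l, m)" by (cases a)
        show "?C $ a $ (k', i) * v $ a = (if a = (k, i) then v $ a else 0)"
        proof (cases "lag l = 1")
          case True
          then show ?thesis using st k by (auto simp: a)
        next
          case False
          then obtain l' :: 'p where l': "lag l = lag l' + 1" by (rule lag_pred)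
          show ?thesis
          proof (cases "l = k")
            case True
            then have "l' = k'" using l' k' lag_inj[of l' k'] by simp
            then show ?thesis using True companion_shift_row[OF l', where b = "(k', i)"] by (simp add: a)
          next
            case False
            then have "l' \<noteq> k'" using l' k' lag_inj[of l k] by auto
            then show ?thesis using False by (auto simp: a companion_shift_row[OF l'])
          qed
        qed
      qed
      then have "(transpose ?C *v v) $ (k', i) = v $ (k, i)" by simp
      moreover have "(transpose ?C *v v) $ (k', i) = 0"
        using Suc st k k' by simp
      ultimately show "v $ (k, i) = 0" by simp
    qed
  qed
  show ?thesis unfolding pos_definite_def
  proof (intro conjI allI impI)
    show "transpose \<Gamma> = \<Gamma>" using psd unfolding psd_def by blast
    fix v :: "real^('p \<times> 'n)" assume v: "v \<noteq> 0"
    have "v \<bullet> (\<Gamma> *v v) \<noteq> 0"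
    proof
      assume v0: "v \<bullet> (\<Gamma> *v v) = 0"
      have "v $ (k, i) = 0" for k i
        using zero[of "lag k - 1"] v0 lag_ge_1[of k] by auto
      then show False using v by (simp add: vec_eq_iff)
    qed
    moreover have "0 \<le> v \<bullet> (\<Gamma> *v v)" using psd unfolding psd_def by blast
    ultimately show "0 < v \<bullet> (\<Gamma> *v v)" by linarith
  qed
qed

lemma pos_definite_inverse_psd:
  fixes G :: "real^'n^'n"
  assumes "pos_definite G"
  shows "psd (matrix_inv G)"
proof -
  have d: "det G \<noteq> 0" using assms by (rule pos_definite_det_nonzero)
  have sym: "transpose G = G" using assms unfolding pos_definite_def by blast
  have "G ** transpose (matrix_inv G) = transpose (matrix_inv G ** G)"
    by (simp add: matrix_transpose_mul sym)
  then have "G ** transpose (matrix_inv G) = mat 1" by (simp add: matrix_inv_mult[OF d])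
  then have "transpose (matrix_inv G) = matrix_inv G" by (rule matrix_inv_eqI[symmetric])
  moreover have "0 \<le> v \<bullet> (matrix_inv G *v v)" for v
  proof -
    let ?u = "matrix_inv G *v v"
    have "G *v ?u = v" by (simp add: matrix_vector_mul_assoc matrix_inv_mult[OF d])
    then have "v \<bullet> ?u = ?u \<bullet> (G *v ?u)" by (simp add: inner_commute)
    then show ?thesis using pos_definite_imp_psd[OF assms] unfolding psd_def by simp
  qed
  ultimately show ?thesis unfolding psd_def by blast
qed

section \<open>The limit distribution\<close>

lemma real_distribution_gen_chi2: "real_distribution (gen_chi2 Q B)"
proof -
  interpret Z: prob_space "mvnormal B" by (rule prob_space_mvnormal)
  show ?thesis unfolding gen_chi2_def by (intro Z.real_distribution_distr) measurable
qed

lemma weak_conv_m_offset: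
  assumes "weak_conv_m (\<lambda>n. \<mu> (n + k)) \<nu>"
  shows "weak_conv_m \<mu> \<nu>"
  unfolding weak_conv_m_def weak_conv_def
proof (intro allI impI)
  fix x assume "isCont (cdf \<nu>) x"
  then have "(\<lambda>n. cdf (\<mu> (n + k)) x) \<longlonglongrightarrow> cdf \<nu> x"
    using assms unfolding weak_conv_m_def weak_conv_def by blast
  then show "(\<lambda>n. cdf (\<mu> n) x) \<longlonglongrightarrow> cdf \<nu> x" by (rule LIMSEQ_offset)
qed

lemma measurable_vec_lambda_real [measurable (raw)]:
  assumes "\<And>i. (\<lambda>x. f x i) \<in> borel_measurable N"
  shows "(\<lambda>x. (\<chi> i. f x i) :: real^'n) \<in> borel_measurable N"
proof (rule borel_measurable_euclidean_space[THEN iffD2], rule ballI)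
  fix b :: "real^'n" assume "b \<in> Basis"
  then obtain i where "b = axis i 1" unfolding Basis_cart_real by blast
  then show "(\<lambda>x. (\<chi> i. f x i) \<bullet> b) \<in> borel_measurable N"
    using assms[of i] by (simp add: inner_axis)
qed

lemma measurable_matrix_mult_const [measurable (raw)]:
  fixes P :: "real^'b^'a" and R :: "real^'d^'c"
  assumes [measurable]: "f \<in> borel_measurable N"
  shows "(\<lambda>x. P ** f x ** R) \<in> borel_measurable N"
proof -
  have "continuous_on UNIV (\<lambda>X. P ** X ** R)"
    unfolding continuous_on_def by (intro ballI tendsto_intros)
  then have "(\<lambda>X. P ** X ** R) \<in> borel_measurable borel" by (rule borel_measurable_continuous_onI)
  then show ?thesis using assms by (rule measurable_compose[rotated])
qed

text \<open>With \<open>sel_y\<close> this turns the extraction of blocks into matrix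
  multiplication, so that it fits transposes, inner products and limits of matrix products.\<close>

definition sel_x :: "real^('x::finite + 'y::finite)^'x" where
  "sel_x = (\<chi> i k. if k = Inl i then 1 else 0)"

definition sel_y :: "real^('p::finite \<times> ('x::finite + 'y::finite))^('p \<times> 'y)" where
  "sel_y = (\<chi> b c. if c = (fst b, Inr (snd b)) then 1 else 0)"

lemma sel_x_mult: "(sel_x ** M) $ i $ j = M $ Inl i $ j"
  by (simp add: matrix_matrix_mult_def sel_x_def if_distrib if_distribR cong: if_cong)

lemma sel_y_mult: "(sel_y ** M) $ b $ j = M $ (fst b, Inr (snd b)) $ j"
  by (simp add: matrix_matrix_mult_def sel_y_def if_distrib if_distribR cong: if_cong)

lemma mult_sel_y: "(M ** transpose sel_y) $ i $ b = M $ i $ (fst b, Inr (snd b))"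
  by (simp add: matrix_mult_transpose_nth' sel_y_def if_distrib if_distribR cong: if_cong)

lemma xy_coeffs_eq: "xy_coeffs A = sel_x ** coeff_mat A ** transpose sel_y"
  by (simp add: vec_eq_iff mult_sel_y sel_x_mult xy_coeffs_def coeff_mat_def)

lemma sub_xx_eq:
  fixes S :: "real^('x::finite + 'y::finite)^('x + 'y)"
  shows "sub_xx S = sel_x ** S ** transpose sel_x"
proof -
  have "(M ** transpose sel_x) $ i $ j = M $ i $ Inl j" for M :: "real^('x + 'y)^'x" and i j
    by (simp add: matrix_mult_transpose_nth' sel_x_def if_distrib if_distribR cong: if_cong)
  then show ?thesis by (simp add: vec_eq_iff sub_xx_def sel_x_mult)
qed

lemma blocks_yy_eq: "blocks_yy G = sel_y ** G ** transpose sel_y"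
  by (simp add: vec_eq_iff blocks_yy_def mult_sel_y sel_y_mult)

lemma psd_congruence:
  fixes P :: "real^'n^'m"
  assumes "psd G"
  shows "psd (P ** G ** transpose P)"
  unfolding psd_def
proof (intro conjI allI)
  have "transpose G = G" using assms unfolding psd_def by blast
  then show "transpose (P ** G ** transpose P) = P ** G ** transpose P"
    by (simp add: matrix_transpose_mul matrix_mul_assoc)
  fix v
  have "v \<bullet> ((P ** G ** transpose P) *v v) = v \<bullet> (P *v (G *v (transpose P *v v)))"
    by (simp only: matrix_vector_mul_assoc matrix_mul_assoc)
  also have "\<dots> = (transpose P *v v) \<bullet> (G *v (transpose P *v v))"
    by (simp add: dot_lmul_matrix)
  finally show "0 \<le> v \<bullet> ((P ** G ** transpose P) *v v)"
    using assms unfolding psd_def by simp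
qed

text \<open>Any factor G = L L^T of a positive definite matrix is invertible, and the inverse of L
  has both properties.\<close>

lemma whitening_exists:
  assumes "pos_definite (G :: real^'n^'n)"
  obtains H :: "real^'n^'n" where "H ** G ** transpose H = mat 1" "transpose H ** H = matrix_inv G"
proof -
  obtain L :: "real^'n^'n" where L: "L ** transpose L = G"
    using psd_factor[OF pos_definite_imp_psd[OF assms]] .
  have "det L \<noteq> 0"
    using pos_definite_det_nonzero[OF assms] unfolding L[symmetric] by (simp add: det_mul)
  note inv = matrix_inv_mult[OF this]
  let ?H = "matrix_inv L"
  have "?H ** G ** transpose ?H = (?H ** L) ** transpose (?H ** L)"
    unfolding L[symmetric] matrix_transpose_mul by (simp only: matrix_mul_assoc)
  then have 1: "?H ** G ** transpose ?H = mat 1" by (simp add: inv)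
  have "G ** (transpose ?H ** ?H) = L ** transpose (?H ** L) ** ?H"
    unfolding L[symmetric] matrix_transpose_mul by (simp only: matrix_mul_assoc)
  then have "G ** (transpose ?H ** ?H) = mat 1" by (simp add: inv)
  then have "transpose ?H ** ?H = matrix_inv G" by (rule matrix_inv_eqI[symmetric])
  then show ?thesis using 1 that by blast
qed

context null_model
begin

lemma gc_quad_scaleR: "gc_quad (c *\<^sub>R T) = c\<^sup>2 * gc_quad T"
  unfolding gc_quad_def
  by (simp add: matrix_vector_mult_scaleR power2_eq_square sum_distrib_left mult_ac)

text \<open>Inserting Sxx_inv = H^T H into the trace form leaves the sum of the forms of
  \<open>gc_form\<close> at the rows of H T, which is the Kronecker product with the
  identity.\<close>

lemma gc_quad_whitened:
  assumes H: "transpose H ** H = Sxx_inv"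
  shows "gc_quad T = vec_of_mat (H ** T) \<bullet> (kron (mat 1) gc_form *v vec_of_mat (H ** T))"
proof -
  have row: "(H ** T) $ m = (\<Sum>j\<in>UNIV. H $ m $ j *\<^sub>R T $ j)" for m
    by (simp add: vec_eq_iff matrix_matrix_mult_def)
  have mv: "gc_form *v (\<Sum>j\<in>UNIV. c j *\<^sub>R T $ j) = (\<Sum>j\<in>UNIV. c j *\<^sub>R (gc_form *v T $ j))" for c
    by (simp add: linear_sum[OF matrix_vector_mul_linear] matrix_vector_mult_scaleR)
  have Si: "Sxx_inv $ i $ j = (\<Sum>m\<in>UNIV. H $ m $ i * H $ m $ j)" for i j
    unfolding H[symmetric] by (simp add: matrix_matrix_mult_def transpose_def)
  have "vec_of_mat (H ** T) \<bullet> (kron (mat 1) gc_form *v vec_of_mat (H ** T)) =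
      (\<Sum>m\<in>UNIV. \<Sum>i\<in>UNIV. \<Sum>j\<in>UNIV. H $ m $ i * H $ m $ j * (T $ j \<bullet> (gc_form *v T $ i)))"
    unfolding kron_mat_1_form row mv
    by (simp add: inner_sum_left inner_sum_right sum_distrib_left mult_ac)
  also have "\<dots> = (\<Sum>i\<in>UNIV. \<Sum>m\<in>UNIV. \<Sum>j\<in>UNIV. H $ m $ i * H $ m $ j * (T $ j \<bullet> (gc_form *v T $ i)))"
    by (rule sum.swap)
  also have "\<dots> = (\<Sum>i\<in>UNIV. \<Sum>j\<in>UNIV. \<Sum>m\<in>UNIV. H $ m $ i * H $ m $ j * (T $ j \<bullet> (gc_form *v T $ i)))"
    by (intro sum.cong refl sum.swap)
  also have "\<dots> = gc_quad T"
    unfolding gc_quad_def Si by (simp add: sum_distrib_right)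
  finally show ?thesis ..
qed

end

text \<open>\<Lambda> is \<open>U\<close> pulled back through the linear map Z -> H sel_x Z G^-1
  sel_y^T. Under the covariance of the score, H whitens the left side to the identity, and on the
  right G^-1 G G^-1 = G^-1 is restricted to the y columns.\<close>

lemma score_character_exponent:
  fixes H :: "real^'x::finite^'x" and S :: "real^('x + 'y::finite)^('x + 'y)"
    and G :: "real^('p::finite \<times> ('x + 'y))^('p \<times> ('x + 'y))" and U :: "real^('p \<times> 'y)^'x"
  assumes H: "H ** sub_xx S ** transpose H = mat 1" and G: "pos_definite G"
  defines "\<Lambda> \<equiv> transpose (H ** sel_x) ** U ** transpose (matrix_inv G ** transpose sel_y)"
  shows "(S ** \<Lambda>) \<bullet> (\<Lambda> ** G) =
    vec_of_mat U \<bullet> (kron (mat 1) (blocks_yy (matrix_inv G)) *v vec_of_mat U)"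
proof -
  let ?P = "H ** sel_x :: real^('x + 'y)^'x" and ?Gi = "matrix_inv G" and ?B = "blocks_yy (matrix_inv G)"
  let ?J = "sel_y :: real^('p \<times> ('x + 'y))^('p \<times> 'y)"
  have d: "det G \<noteq> 0" using G by (rule pos_definite_det_nonzero)
  have psd_i: "psd ?Gi" using G by (rule pos_definite_inverse_psd)
  then have sym: "transpose ?Gi = ?Gi" unfolding psd_def by blast
  have "psd ?B" unfolding blocks_yy_eq by (rule psd_congruence[OF psd_i])
  then have symB: "transpose ?B = ?B" unfolding psd_def by blast
  have \<Lambda>: "\<Lambda> = transpose ?P ** U ** ?J ** ?Gi"
    unfolding \<Lambda>_def by (simp add: matrix_transpose_mul sym matrix_mul_assoc)
  have LG: "\<Lambda> ** G = transpose ?P ** (U ** ?J)"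
  proof -
    have "\<Lambda> ** G = transpose ?P ** (U ** ?J) ** (?Gi ** G)"
      unfolding \<Lambda> by (simp only: matrix_mul_assoc)
    then show ?thesis by (simp add: matrix_inv_mult[OF d])
  qed
  have PS: "?P ** S ** transpose ?P = mat 1"
    using H unfolding sub_xx_eq by (simp add: matrix_transpose_mul matrix_mul_assoc)
  have "(S ** \<Lambda>) \<bullet> (\<Lambda> ** G) = (transpose (transpose ?P) ** (S ** \<Lambda>)) \<bullet> (U ** ?J)"
    unfolding LG by (rule inner_matrix_mult_left)
  also have "transpose (transpose ?P) ** (S ** \<Lambda>) = (?P ** S ** transpose ?P) ** (U ** ?J ** ?Gi)"
    unfolding \<Lambda> transpose_transpose by (simp only: matrix_mul_assoc)
  also have "\<dots> = U ** ?J ** ?Gi" unfolding PS by simp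
  also have "(U ** ?J ** ?Gi) \<bullet> (U ** ?J) = (U ** ?J ** ?Gi ** transpose ?J) \<bullet> U"
    by (rule inner_matrix_mult_right)
  also have "U ** ?J ** ?Gi ** transpose ?J = U ** ?B"
    unfolding blocks_yy_eq by (simp only: matrix_mul_assoc)
  also have "(U ** ?B) \<bullet> U = vec_of_mat U \<bullet> (kron (mat 1) ?B *v vec_of_mat U)"
  proof -
    have "(U ** ?B) $ i = ?B *v U $ i" for i
    proof -
      have "(U ** ?B) $ i = transpose ?B *v U $ i"
        by (simp add: vec_eq_iff matrix_matrix_mult_def matrix_vector_mult_def transpose_def mult.commute
            del: transpose_matrix_vector)
      then show ?thesis unfolding symB .
    qed
    then have "(U ** ?B) \<bullet> U = (\<Sum>i\<in>UNIV. (?B *v U $ i) \<bullet> U $ i)"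
      by (simp only: inner_vec_def[of "U ** ?B"])
    also have "\<dots> = (\<Sum>i\<in>UNIV. U $ i \<bullet> (?B *v U $ i))"
      by (intro sum.cong refl inner_commute)
    finally show ?thesis unfolding kron_mat_1_form .
  qed
  finally show ?thesis .
qed

theorem theorem2:
  fixes A :: "('p::{finite,linorder}, 'x::finite + 'y::finite) var_coeffs"
    and S :: "real^('x + 'y)^('x + 'y)"
    and \<Gamma> :: "real^('p \<times> ('x + 'y))^('p \<times> ('x + 'y))"
    and M :: "'a measure"
    and U e :: "int \<Rightarrow> 'a \<Rightarrow> real^('x + 'y)"
    and F :: "real set"
    and Ahat :: "nat \<Rightarrow> 'a \<Rightarrow> ('p, 'x + 'y) var_coeffs"
    and Shat :: "nat \<Rightarrow> 'a \<Rightarrow> real^('x + 'y)^('x + 'y)"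
    and fhat :: "nat \<Rightarrow> 'a \<Rightarrow> real"
  assumes null: "(A, S) \<in> null_params"
    and model: "var_process M A S U e"
    and F: "F \<in> sets lebesgue" "F \<subseteq> {0..2 * pi}" "measure lebesgue F > 0"
    and ols: "\<And>N \<omega>. \<omega> \<in> space M \<Longrightarrow> is_ols N (\<lambda>t. U t \<omega>) (Ahat N \<omega>)"
    and resid: "\<And>N \<omega>. \<omega> \<in> space M \<Longrightarrow> Shat N \<omega> = resid_cov N (\<lambda>t. U t \<omega>) (Ahat N \<omega>)"
    and fhat_meas: "\<And>N. fhat N \<in> borel_measurable M"
    and fhat: "\<And>N \<omega>. \<omega> \<in> space M \<Longrightarrow> (Ahat N \<omega>, Shat N \<omega>) \<in> var_params \<Longrightarrow>
                 fhat N \<omega> = band_gc F (Ahat N \<omega>) (Shat N \<omega>)"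
    and Gamma: "\<Gamma> - companion A ** \<Gamma> ** transpose (companion A) = corner_block S"
  shows "weak_conv_m (\<lambda>N. distr M borel (\<lambda>\<omega>. real N * fhat N \<omega>))
           (gen_chi2 (kron (mat 1 :: real^'x^'x) (Re_mat (band_block_Syy_x F A S)))
                     (kron (mat 1 :: real^'x^'x) (blocks_yy (matrix_inv \<Gamma>))))"
proof -

  \<comment> \<open>State-space form of the model\<close>
  let ?p = "CARD('p)"
  let ?N = "noise_input :: real^('x + 'y)^('p \<times> ('x + 'y))"
  \<comment> \<open>The first regression time: all p lagged values are observed from here on. Noise
    and state are renumbered from this time.\<close>
  define t0 where "t0 = int ?p + 1"
  define \<eta> where "\<eta> j = e (t0 + int j)" for j :: nat
  define x0 where "x0 \<omega> = (lagged (\<lambda>t. U t \<omega>) t0 :: real^('p \<times> ('x + 'y)))" for \<omega>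
  interpret nm: null_model A S F by unfold_locales (fact null F)+
  interpret prob_space M using model unfolding var_process_def by blast
  have noise: "indep_vars (\<lambda>_. borel) e UNIV" "\<And>t. distr M borel (e t) = mvnormal S"
    using model unfolding var_process_def gaussian_white_noise_def by blast+
  obtain K \<rho> where K\<rho>: "0 \<le> K" "0 \<le> \<rho>" "\<rho> < 1"
    "\<And>k v. norm (((*v) (companion A) ^^ k) v) \<le> K * \<rho> ^ k * norm v"
    using funpow_geometric_bound[of "companion A"] nm.stable unfolding var_stable_def by metis
  interpret linear_process M \<eta> S "companion A" ?N K \<rho>
  proof unfold_locales
    show "indep_vars (\<lambda>_. borel) \<eta> UNIV"
      unfolding \<eta>_def by (rule indep_vars_reindex_inj[OF noise(1)]) (simp add: inj_def)
    show "distr M borel (\<eta> j) = mvnormal S" for j unfolding \<eta>_def by (rule noise(2))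
    show "psd S" using nm.pos_def by (rule pos_definite_imp_psd)
  qed (fact K\<rho>)+
  have U_meas [measurable]: "U t \<in> borel_measurable M" and U_int: "integrable M (\<lambda>\<omega>. (norm (U t \<omega>))\<^sup>2)" for t
    using model unfolding var_process_def wide_sense_stationary_def by blast+
  have x0_meas [measurable]: "x0 \<in> borel_measurable M"
    unfolding x0_def[abs_def] lagged_def by measurable
  have x0_int: "integrable M (\<lambda>\<omega>. (norm (x0 \<omega>))\<^sup>2)"
  proof -
    have eq: "(norm (x0 \<omega>))\<^sup>2 = (\<Sum>b\<in>(UNIV :: ('p \<times> ('x + 'y)) set). (U (t0 - int (lag (fst b))) \<omega> $ snd b)\<^sup>2)" for \<omega>
      unfolding power2_norm_eq_inner x0_def lagged_def by (simp add: inner_vec_def power2_eq_square)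
    have "integrable M (\<lambda>\<omega>. (U t \<omega> $ i)\<^sup>2)" for t i
    proof (rule Bochner_Integration.integrable_bound[OF U_int[of t]])
      show "AE \<omega> in M. norm ((U t \<omega> $ i)\<^sup>2) \<le> norm ((norm (U t \<omega>))\<^sup>2)"
      proof (rule AE_I2)
        fix \<omega>
        have "norm (U t \<omega> $ i) \<le> norm (U t \<omega>)" by (rule Finite_Cartesian_Product.norm_nth_le)
        from power_mono[OF this, of 2] show "norm ((U t \<omega> $ i)\<^sup>2) \<le> norm ((norm (U t \<omega>))\<^sup>2)" by simp
      qed
    qed measurable
    then show ?thesis unfolding eq by simp
  qed
  have \<Gamma>_eq: "\<Gamma> - companion A ** \<Gamma> ** transpose (companion A) = ?N ** S ** transpose ?N"
    unfolding noise_input_corner by (rule Gamma)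
  have pd\<Gamma>: "pos_definite \<Gamma>"
    by (rule pos_definite_state_covariance[OF Gamma psd_state_covariance[OF \<Gamma>_eq] nm.pos_def])
  then have d\<Gamma>: "det \<Gamma> \<noteq> 0" by (rule pos_definite_det_nonzero)

  \<comment> \<open>The estimation error in terms of score and sample covariance\<close>
  let ?score = "\<lambda>s. score x0 (fst s) (snd s)" and ?gram = "\<lambda>s. gram x0 (fst s) (snd s)"
  \<comment> \<open>The first component of s counts regression times; the sample size exceeds it by
    p.\<close>
  define Ah where "Ah s = Ahat (fst s + ?p) (snd s)" for s
  define Sh where "Sh s = Shat (fst s + ?p) (snd s)" for s
  define \<Delta> where "\<Delta> s = coeff_mat (Ah s) - coeff_mat A" for s
  define T where "T s = ?score s ** matrix_inv (?gram s)" for s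
  have score_tight': "tight_in_prob ?score" by (rule score_tight[OF x0_meas x0_int])
  have gram_lim: "(?gram \<longlongrightarrow> \<Gamma>) (in_prob M)" by (rule gram_lln[OF x0_meas x0_int \<Gamma>_eq])
  have inv_lim: "((\<lambda>s. matrix_inv (?gram s)) \<longlongrightarrow> matrix_inv \<Gamma>) (in_prob M)"
    by (rule tendsto_matrix_inv[OF gram_lim d\<Gamma>])
  have n_pos: "\<forall>\<^sub>F s in in_prob M. 0 < fst s"
    by (rule eventually_seq_in_prob[OF eventually_gt_at_top])
  have det_pos: "\<forall>\<^sub>F s in in_prob M. det (?gram s) \<noteq> 0"
    by (rule tendsto_imp_eventually_ne[OF tendsto_det[OF gram_lim] d\<Gamma>])
  \<comment> \<open>The model equation holds almost surely at each time; as the integers are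
    countable, one null set serves all times.\<close>
  have eqn: "\<forall>\<^sub>F s in in_prob M. \<forall>t. U t (snd s) = var_predict A (\<lambda>t. U t (snd s)) t + e t (snd s)"
  proof (rule eventually_in_prob_AE)
    have "AE \<omega> in M. \<forall>t. U t \<omega> = var_predict A (\<lambda>t. U t \<omega>) t + e t \<omega>"
      using model unfolding var_process_def AE_all_countable by blast
    then show "AE \<omega> in M. \<forall>n::nat. \<forall>t. U t \<omega> = var_predict A (\<lambda>t. U t \<omega>) t + e t \<omega>" by simp
  qed

  \<comment> \<open>The normal equations say score = sqrt n \<Delta> gram, which determines the
    minimiser wherever the sample covariance is invertible.\<close>
  have regression: "\<forall>\<^sub>F s in in_prob M. sqrt (real (fst s)) *\<^sub>R \<Delta> s = T s \<and>
    Sh s = (1 / real (fst s)) *\<^sub>R (\<Sum>j<fst s. outer (\<eta> j (snd s)) (\<eta> j (snd s)))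
      - \<Delta> s ** ((1 / sqrt (real (fst s))) *\<^sub>R transpose (?score s))"
    using eqn n_pos det_pos eventually_in_prob_space
  proof eventually_elim
    case (elim s)
    obtain n \<omega> where s: "s = (n, \<omega>)" by (cases s)
    have n: "0 < n" and \<omega>: "\<omega> \<in> space M" and dg: "det (gram x0 n \<omega>) \<noteq> 0" using elim(2-4) s by auto
    let ?u = "\<lambda>t. U t \<omega>" and ?z = "\<lambda>j. state x0 j \<omega>"
    have eq\<omega>: "?u t = var_predict A ?u t + e t \<omega>" for t
      using elim(1) unfolding s snd_conv by (rule spec)
    have z: "lagged ?u (t0 + int j) = ?z j" for j
      unfolding state_def x0_def \<eta>_def
      by (rule lagged_eq_lin_state[of ?u A "\<lambda>t. e t \<omega>" t0 j, OF eq\<omega>])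
    define r where "r j = \<eta> j \<omega> - \<Delta> s *v ?z j" for j
    have r: "?u (t0 + int j) - var_predict (Ah s) ?u (t0 + int j) = r j" for j
    proof -
      have "?u (t0 + int j) = coeff_mat A *v ?z j + \<eta> j \<omega>"
        using eq\<omega>[of "t0 + int j"] unfolding \<eta>_def var_predict_eq z .
      then show ?thesis
        by (simp add: r_def \<Delta>_def var_predict_eq z matrix_vector_mult_diff_rdistrib)
    qed
    have ols_s: "is_ols (n + ?p) ?u (Ah s)" using ols[OF \<omega>] by (simp add: Ah_def s)
    have normal: "(\<Sum>j<n. outer (r j) (?z j)) = 0"
      using ols_normal_equations[OF ols_s] unfolding t0_def[symmetric] r z .
    have outer_diff: "outer (a - b) c = outer a c - outer b c" "outer c (a - b) = outer c a - outer c b"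
      for a b :: "real^'k" and c :: "real^'l"
      by (simp_all add: vec_eq_iff outer_def algebra_simps)
    have outer_mult: "outer (D *v a) b = D ** outer a b" for D :: "real^'k^'l" and a and b :: "real^'m"
      using outer_matrix_vector[of D a "mat 1" b] by simp
    have score_eq: "(\<Sum>j<n. outer (\<eta> j \<omega>) (?z j)) = \<Delta> s ** (\<Sum>j<n. outer (?z j) (?z j))"
      using normal unfolding r_def outer_diff outer_mult by (simp add: sum_subtractf matrix_mult_sum_right)
    have "score x0 n \<omega> = sqrt (real n) *\<^sub>R (\<Delta> s ** gram x0 n \<omega>)"
    proof -
      have "1 / sqrt (real n) = sqrt (real n) * (1 / real n)"
        using n by (simp add: field_simps)
      then show ?thesis
        unfolding score_def gram_def score_eq by (simp only: matrix_scaleR_mult scaleR_scaleR)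
    qed
    then have "T s = (sqrt (real n) *\<^sub>R \<Delta> s) ** (gram x0 n \<omega> ** matrix_inv (gram x0 n \<omega>))"
      unfolding T_def s by (simp add: matrix_scaleR_mult matrix_mul_assoc)
    then have TD: "sqrt (real n) *\<^sub>R \<Delta> s = T s" by (simp add: matrix_inv_mult[OF dg])
    \<comment> \<open>Only the second residual is expanded first: its part along the regressors
      drops out by the normal equations, so a single correction term, linear in \<Delta>,
      remains.\<close>
    have rr: "(\<Sum>j<n. outer (r j) (r j)) = (\<Sum>j<n. outer (\<eta> j \<omega>) (\<eta> j \<omega>)) - \<Delta> s ** transpose (\<Sum>j<n. outer (\<eta> j \<omega>) (?z j))"
    proof -
      have rD: "outer a (D *v b) = outer a b ** transpose D" for D :: "real^'k^'l" and a :: "real^'m" and b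
        using outer_matrix_vector[of "mat 1" a D b] by simp
      have "(\<Sum>j<n. outer (r j) (r j)) = (\<Sum>j<n. outer (r j) (\<eta> j \<omega>) - outer (r j) (?z j) ** transpose (\<Delta> s))"
        by (intro sum.cong refl) (subst (2) r_def, simp only: outer_diff rD)
      also have "\<dots> = (\<Sum>j<n. outer (r j) (\<eta> j \<omega>)) - (\<Sum>j<n. outer (r j) (?z j)) ** transpose (\<Delta> s)"
        by (simp add: sum_subtractf matrix_sum_mult)
      also have "\<dots> = (\<Sum>j<n. outer (r j) (\<eta> j \<omega>))" unfolding normal by simp
      also have "\<dots> = (\<Sum>j<n. outer (\<eta> j \<omega>) (\<eta> j \<omega>)) - \<Delta> s ** (\<Sum>j<n. outer (?z j) (\<eta> j \<omega>))"
        unfolding r_def outer_diff outer_mult by (simp add: sum_subtractf matrix_mult_sum_right)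
      finally show ?thesis by (simp add: transpose_sum transpose_outer)
    qed
    have "Sh s = (1 / real n) *\<^sub>R (\<Sum>j<n. outer (r j) (r j))"
      unfolding Sh_def s fst_conv snd_conv resid[OF \<omega>] resid_cov_def sum_regression_times
      unfolding t0_def[symmetric] r[unfolded Ah_def s fst_conv snd_conv] by simp
    also have "\<dots> = (1 / real n) *\<^sub>R (\<Sum>j<n. outer (\<eta> j \<omega>) (\<eta> j \<omega>))
      - \<Delta> s ** ((1 / sqrt (real n)) *\<^sub>R transpose (score x0 n \<omega>))"
      unfolding rr score_def using n
      by (simp add: scaleR_diff_right transpose_scalar matrix_scaleR_mult)
    finally show ?case using TD by (simp add: s)
  qed

  \<comment> \<open>Consistency of the estimates\<close>
  have T_tight: "tight_in_prob T"
    by (rule tight_in_prob_mult[OF score_tight' tendsto_imp_tight_in_prob[OF inv_lim]])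
      (simp add: T_def norm_matrix_mult_le)
  have sq_lim: "((\<lambda>s. 1 / sqrt (real (fst s))) \<longlongrightarrow> 0) (in_prob M)"
  proof (rule tendsto_seq_in_prob)
    show "(\<lambda>n. 1 / sqrt (real n)) \<longlonglongrightarrow> 0" by real_asymp
  qed
  have \<Delta>_lim: "(\<Delta> \<longlongrightarrow> 0) (in_prob M)"
  proof (rule tendsto_zero_mult_tight[OF T_tight sq_lim])
    show "\<forall>\<^sub>F s in in_prob M. norm (\<Delta> s) \<le> norm (T s) * norm (1 / sqrt (real (fst s)))"
      using regression n_pos
    proof eventually_elim
      case (elim s)
      then have "norm (T s) = sqrt (real (fst s)) * norm (\<Delta> s)" by (metis abs_of_nonneg norm_scaleR of_nat_0_le_iff real_sqrt_ge_zero)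
      then show ?case using elim by simp
    qed
  qed
  have Ah_lim: "(Ah \<longlongrightarrow> A) (in_prob M)"
  proof (rule vec_tendstoI, rule mat_tendstoI)
    fix k i j
    have "((\<lambda>s. A $ k $ i $ j + \<Delta> s $ i $ (k, j)) \<longlongrightarrow> A $ k $ i $ j + 0 $ i $ (k, j)) (in_prob M)"
      by (intro tendsto_add tendsto_const tendsto_vec_nth2 \<Delta>_lim)
    then show "((\<lambda>s. Ah s $ k $ i $ j) \<longlongrightarrow> A $ k $ i $ j) (in_prob M)"
      by (simp add: \<Delta>_def coeff_mat_def)
  qed
  have Sh_lim: "(Sh \<longlongrightarrow> S) (in_prob M)"
  proof -
    have "((\<lambda>s. (1 / real (fst s)) *\<^sub>R (\<Sum>j<fst s. outer (\<eta> j (snd s)) (\<eta> j (snd s)))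
      - \<Delta> s ** transpose ((1 / sqrt (real (fst s))) *\<^sub>R ?score s)) \<longlongrightarrow> S - (0 :: real^('p \<times> ('x + 'y))^('x + 'y)) ** transpose 0) (in_prob M)"
      by (intro tendsto_diff noise_covariance_lln tendsto_matrix_mult \<Delta>_lim tendsto_transpose
          score_over_sqrt[OF x0_meas x0_int])
    then have "((\<lambda>s. (1 / real (fst s)) *\<^sub>R (\<Sum>j<fst s. outer (\<eta> j (snd s)) (\<eta> j (snd s)))
      - \<Delta> s ** ((1 / sqrt (real (fst s))) *\<^sub>R transpose (?score s))) \<longlongrightarrow> S) (in_prob M)"
      by (simp add: transpose_scalar)
    then show ?thesis
      by (rule Lim_transform_eventually) (use regression in eventually_elim, simp)
  qed
  have Sh_sym: "\<forall>\<^sub>F s in in_prob M. transpose (Sh s) = Sh s"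
    using eventually_in_prob_space
    by eventually_elim (simp add: Sh_def resid resid_cov_def transpose_scalar transpose_sum transpose_outer)
  have comp_lim: "((\<lambda>s. companion (Ah s)) \<longlongrightarrow> companion A) (in_prob M)"
  proof (rule mat_tendstoI)
    fix a b :: "'p \<times> ('x + 'y)"
    have "((\<lambda>s. Ah s $ fst b $ snd a $ snd b) \<longlongrightarrow> A $ fst b $ snd a $ snd b) (in_prob M)"
      by (intro tendsto_vec_nth Ah_lim)
    then show "((\<lambda>s. companion (Ah s) $ a $ b) \<longlongrightarrow> companion A $ a $ b) (in_prob M)"
      by (cases "lag (fst a) = 1") (simp_all add: companion_def)
  qed
  \<comment> \<open>Membership is an open condition on symmetric estimates. It is what identifies
    \<open>fhat\<close> with the plug-in value of the causality.\<close>
  have params: "\<forall>\<^sub>F s in in_prob M. (Ah s, Sh s) \<in> var_params"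
  proof -
    have "\<forall>\<^sub>F s in in_prob M. \<forall>c. is_eigenvalue (cmat (companion (Ah s))) c \<longrightarrow> cmod c < 1"
      using nm.stable comp_lim unfolding var_stable_def by (intro eventually_spectral_radius_less) auto
    with eventually_pos_definite[OF nm.pos_def Sh_lim Sh_sym] show ?thesis
      by eventually_elim (simp add: var_params_def var_stable_def)
  qed

  \<comment> \<open>Reduction to a quadratic form in the scaled coefficients\<close>
  define Jx where "Jx = (sel_x :: real^('x + 'y)^'x)"
  define Jy where "Jy = (sel_y :: real^('p \<times> ('x + 'y))^('p \<times> 'y))"
  define V where "V s = Jx ** T s ** transpose Jy" for s
  have xyA: "Jx ** coeff_mat A ** transpose Jy = 0"
  proof -
    have "A $ k $ Inl i $ Inr j = 0" for k i j
      using arg_cong[OF nm.xy_zero[of k], of "\<lambda>X. X $ i $ j"] by (simp add: sub_xy_def)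
    then show ?thesis unfolding Jx_def Jy_def xy_coeffs_eq[symmetric] by (simp add: vec_eq_iff xy_coeffs_def)
  qed
  have xyh: "xy_coeffs (Ah s) = Jx ** \<Delta> s ** transpose Jy" for s
    unfolding \<Delta>_def matrix_mult_diff matrix_diff_mult xyA unfolding Jx_def Jy_def xy_coeffs_eq by simp
  have V_eq: "\<forall>\<^sub>F s in in_prob M. sqrt (real (fst s)) *\<^sub>R xy_coeffs (Ah s) = V s"
    using regression
  proof eventually_elim
    case (elim s)
    have "sqrt (real (fst s)) *\<^sub>R xy_coeffs (Ah s) = Jx ** (sqrt (real (fst s)) *\<^sub>R \<Delta> s) ** transpose Jy"
      unfolding xyh by (simp only: matrix_scaleR_mult)
    then show ?case unfolding V_def using elim by simp
  qed
  have sandwich: "norm (Jx ** X ** transpose Jy) \<le> (norm Jx * norm Jy) * norm X" for X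
  proof -
    have "norm (Jx ** X ** transpose Jy) \<le> (norm Jx * norm X) * norm Jy"
      using norm_matrix_mult_le[of "Jx ** X" "transpose Jy"] mult_right_mono[OF norm_matrix_mult_le[of Jx X], of "norm Jy"] by simp
    then show ?thesis by (simp add: mult_ac)
  qed
  have V_tight: "tight_in_prob V"
    by (rule tight_in_prob_bound[OF T_tight, where c = "norm Jx * norm Jy"]) (simp add: V_def sandwich)
  let ?band = "\<lambda>s. band_gc F (Ah s) (Sh s)"
  \<comment> \<open>\<open>gc_quad\<close> is homogeneous of degree two, so the factor n is absorbed
    by scaling the coefficients with sqrt n, and the remainder is small compared with the square of
    the tight \<open>V\<close>.\<close>
  have D1: "((\<lambda>s. real (fst s) * ?band s - nm.gc_quad (V s)) \<longlongrightarrow> 0) (in_prob M)"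
  proof (rule tendsto_zero_small_multiple[OF V_tight])
    fix c :: real assume "0 < c"
    from V_eq nm.band_gc_expansion[OF Ah_lim Sh_lim Sh_sym this]
    show "\<forall>\<^sub>F s in in_prob M. norm (real (fst s) * ?band s - nm.gc_quad (V s)) \<le> c * (norm (V s))\<^sup>2"
    proof eventually_elim
      case (elim s)
      have q: "nm.gc_quad (V s) = real (fst s) * nm.gc_quad (xy_coeffs (Ah s))"
        unfolding elim(1)[symmetric] nm.gc_quad_scaleR by simp
      have v: "(norm (V s))\<^sup>2 = real (fst s) * (norm (xy_coeffs (Ah s)))\<^sup>2"
        unfolding elim(1)[symmetric] by (simp add: power_mult_distrib)
      have "\<bar>real (fst s) * ?band s - nm.gc_quad (V s)\<bar> = real (fst s) * \<bar>?band s - nm.gc_quad (xy_coeffs (Ah s))\<bar>"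
        unfolding q right_diff_distrib[symmetric] abs_mult by simp
      also have "\<dots> \<le> real (fst s) * (c * (norm (xy_coeffs (Ah s)))\<^sup>2)"
        using elim(2) by (intro mult_left_mono) auto
      finally show ?case unfolding v by (simp add: mult_ac)
    qed
  qed
  have xyh_lim: "((\<lambda>s. xy_coeffs (Ah s)) \<longlongrightarrow> 0) (in_prob M)"
  proof -
    have "((\<lambda>s. Jx ** \<Delta> s ** transpose Jy) \<longlongrightarrow> Jx ** 0 ** transpose Jy) (in_prob M)"
      by (intro tendsto_intros \<Delta>_lim)
    then show ?thesis by (simp add: xyh)
  qed
  \<comment> \<open>The estimator is multiplied by n + p, not by n; the surplus p times the
    causality has to vanish.\<close>
  have band_lim: "(?band \<longlongrightarrow> 0) (in_prob M)"
  proof -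
    have "((\<lambda>s. nm.gc_quad (xy_coeffs (Ah s))) \<longlongrightarrow> nm.gc_quad 0) (in_prob M)"
      unfolding nm.gc_quad_def
      by (intro tendsto_sum tendsto_mult tendsto_const tendsto_inner tendsto_matrix_vector_mult tendsto_vec_nth xyh_lim)
    then have q: "((\<lambda>s. nm.gc_quad (xy_coeffs (Ah s))) \<longlongrightarrow> 0) (in_prob M)" by (simp add: nm.gc_quad_def)
    have "((\<lambda>s. (norm (xy_coeffs (Ah s)))\<^sup>2) \<longlongrightarrow> (norm (0 :: real^('p \<times> 'y)^'x))\<^sup>2) (in_prob M)"
      by (intro tendsto_intros xyh_lim)
    then have "((\<lambda>s. (norm (xy_coeffs (Ah s)))\<^sup>2) \<longlongrightarrow> 0) (in_prob M)" by simp
    then have "((\<lambda>s. ?band s - nm.gc_quad (xy_coeffs (Ah s))) \<longlongrightarrow> 0) (in_prob M)"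
      by (rule Lim_null_comparison[rotated]) (use nm.band_gc_expansion[OF Ah_lim Sh_lim Sh_sym, of 1] in simp)
    from tendsto_add[OF this q] show ?thesis by simp
  qed

  \<comment> \<open>Limit law of the whitened quadratic form\<close>
  obtain H :: "real^'x^'x" where H: "H ** sub_xx S ** transpose H = mat 1" "transpose H ** H = nm.Sxx_inv"
    by (rule whitening_exists[OF pos_definite_sub_xx[OF nm.pos_def], folded nm.Sxx_inv_def])
  define Q where "Q = kron (mat 1 :: real^'x^'x) nm.gc_form"
  define B where "B = kron (mat 1 :: real^'x^'x) (blocks_yy (matrix_inv \<Gamma>))"
  \<comment> \<open>The whitened \<open>V\<close> with the inverse sample covariance replaced by its
    limit. This is a fixed linear image of the score, so its characteristic function is covered by
    \<open>score_clt\<close>.\<close>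
  define \<xi> where "\<xi> n \<omega> = vec_of_mat ((H ** Jx) ** score x0 n \<omega> ** (matrix_inv \<Gamma> ** transpose Jy))" for n \<omega>
  have \<xi>_meas [measurable]: "\<xi> n \<in> borel_measurable M" for n
    unfolding \<xi>_def[abs_def] vec_of_mat_def by measurable
  have psdQ: "psd Q" unfolding Q_def by (rule psd_kron_mat_1[OF nm.psd_gc_form])
  have psdB: "psd B"
    unfolding B_def blocks_yy_eq
    by (intro psd_kron_mat_1 psd_congruence pos_definite_inverse_psd pd\<Gamma>)
  have limit: "weak_conv_m (\<lambda>n. distr M borel (\<lambda>\<omega>. \<xi> n \<omega> \<bullet> (Q *v \<xi> n \<omega>))) (gen_chi2 Q B)"
  proof (rule weak_conv_gen_chi2[OF \<xi>_meas _ psdQ psdB])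
    fix u :: "real^('x \<times> ('p \<times> 'y))"
    let ?\<Lambda> = "transpose (H ** Jx) ** mat_of_vec u ** transpose (matrix_inv \<Gamma> ** transpose Jy)"
    have "u \<bullet> \<xi> n \<omega> = ?\<Lambda> \<bullet> score x0 n \<omega>" for n \<omega>
    proof -
      have "u \<bullet> \<xi> n \<omega> = mat_of_vec u \<bullet> ((H ** Jx) ** score x0 n \<omega> ** (matrix_inv \<Gamma> ** transpose Jy))"
        unfolding \<xi>_def by (metis inner_vec_of_mat vec_of_mat_of_vec)
      also have "\<dots> = (mat_of_vec u ** transpose (matrix_inv \<Gamma> ** transpose Jy)) \<bullet> ((H ** Jx) ** score x0 n \<omega>)"
        by (rule inner_matrix_mult_right)
      also have "\<dots> = (transpose (H ** Jx) ** (mat_of_vec u ** transpose (matrix_inv \<Gamma> ** transpose Jy))) \<bullet> score x0 n \<omega>"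
        by (rule inner_matrix_mult_left)
      finally show ?thesis by (simp only: matrix_mul_assoc)
    qed
    moreover have "(S ** ?\<Lambda>) \<bullet> (?\<Lambda> ** \<Gamma>) = u \<bullet> (B *v u)"
      using score_character_exponent[OF H(1) pd\<Gamma>, of "mat_of_vec u"]
      unfolding Jx_def Jy_def B_def by simp
    ultimately show "(\<lambda>n. LINT \<omega>|M. iexp (u \<bullet> \<xi> n \<omega>)) \<longlonglongrightarrow> of_real (exp (- (u \<bullet> (B *v u)) / 2))"
      using score_clt[OF x0_meas x0_int \<Gamma>_eq, of ?\<Lambda>] by simp
  qed
  \<comment> \<open>The two whitened vectors differ by the tight score times a vanishing matrix, and
    a quadratic form is Lipschitz with a constant governed by their tight norms.\<close>
  have D3: "((\<lambda>s. nm.gc_quad (V s) - \<xi> (fst s) (snd s) \<bullet> (Q *v \<xi> (fst s) (snd s))) \<longlongrightarrow> 0) (in_prob M)"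
  proof -
    define v where "v s = vec_of_mat (H ** V s)" for s
    define w where "w s = \<xi> (fst s) (snd s)" for s :: "nat \<times> 'a"
    have w_eq: "w s = vec_of_mat (H ** (Jx ** (?score s ** matrix_inv \<Gamma>) ** transpose Jy))" for s
      unfolding w_def \<xi>_def by (simp only: matrix_mul_assoc)
    have diff: "v s - w s = vec_of_mat (H ** (Jx ** (?score s ** (matrix_inv (?gram s) - matrix_inv \<Gamma>)) ** transpose Jy))" for s
      unfolding v_def w_eq V_def T_def vec_of_mat_diff[symmetric] by (simp only: matrix_mult_diff matrix_diff_mult)
    have "((\<lambda>s. matrix_inv (?gram s) - matrix_inv \<Gamma>) \<longlongrightarrow> matrix_inv \<Gamma> - matrix_inv \<Gamma>) (in_prob M)"
      by (intro tendsto_diff inv_lim tendsto_const)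
    then have "((\<lambda>s. matrix_inv (?gram s) - matrix_inv \<Gamma>) \<longlongrightarrow> 0) (in_prob M)" by simp
    then have "((\<lambda>s. ?score s ** (matrix_inv (?gram s) - matrix_inv \<Gamma>)) \<longlongrightarrow> 0) (in_prob M)"
      by (rule tendsto_zero_mult_tight[OF score_tight']) (simp add: norm_matrix_mult_le)
    then have "((\<lambda>s. H ** (Jx ** (?score s ** (matrix_inv (?gram s) - matrix_inv \<Gamma>)) ** transpose Jy)) \<longlongrightarrow>
        H ** (Jx ** 0 ** transpose Jy)) (in_prob M)"
      by (intro tendsto_matrix_mult tendsto_const)
    then have "((\<lambda>s. norm (v s - w s)) \<longlongrightarrow> 0) (in_prob M)"
      unfolding diff norm_vec_of_mat using tendsto_norm_zero by fastforce
    then have vw: "((\<lambda>s. v s - w s) \<longlongrightarrow> 0) (in_prob M)" by (rule tendsto_norm_zero_cancel)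
    have v_tight: "tight_in_prob (\<lambda>s. norm (v s))"
      by (rule tight_in_prob_bound[OF V_tight, where c = "norm H"]) (simp add: v_def norm_matrix_mult_le)
    have w_tight: "tight_in_prob (\<lambda>s. norm (w s))"
    proof (rule tight_in_prob_bound[OF score_tight', where c = "norm (H ** Jx) * norm (matrix_inv \<Gamma> ** transpose Jy)"])
      have "norm (P ** X ** R) \<le> (norm P * norm R) * norm X" for P :: "real^('x + 'y)^'x" and R :: "real^('p \<times> 'y)^('p \<times> ('x + 'y))" and X
      proof -
        have "norm (P ** X ** R) \<le> (norm P * norm X) * norm R"
          by (intro order_trans[OF norm_matrix_mult_le] mult_right_mono norm_matrix_mult_le) simp
        then show ?thesis by (simp add: mult_ac)
      qed
      then show "\<forall>\<^sub>F s in in_prob M. norm (norm (w s)) \<le> norm (H ** Jx) * norm (matrix_inv \<Gamma> ** transpose Jy) * norm (?score s)"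
        by (simp add: w_def \<xi>_def)
    qed
    have "tight_in_prob (\<lambda>s. norm Q * (norm (v s) + norm (w s)))"
      by (rule tight_in_prob_bound[OF tight_in_prob_add[OF v_tight w_tight], where c = "norm Q"]) (simp add: abs_mult)
    then have "((\<lambda>s. v s \<bullet> (Q *v v s) - w s \<bullet> (Q *v w s)) \<longlongrightarrow> 0) (in_prob M)"
    proof (rule tendsto_zero_mult_tight[OF _ vw], intro always_eventually allI)
      fix s
      show "norm (v s \<bullet> (Q *v v s) - w s \<bullet> (Q *v w s)) \<le> norm (norm Q * (norm (v s) + norm (w s))) * norm (v s - w s)"
        using quadratic_form_diff_le[of "v s" Q "w s"] by (simp add: mult.commute)
    qed
    then show ?thesis
      unfolding v_def w_def Q_def nm.gc_quad_whitened[OF H(2)] .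
  qed

  \<comment> \<open>Transfer of the limit law to the estimator\<close>
  have diff_lim: "((\<lambda>s. real (fst s + ?p) * fhat (fst s + ?p) (snd s) - \<xi> (fst s) (snd s) \<bullet> (Q *v \<xi> (fst s) (snd s))) \<longlongrightarrow> 0) (in_prob M)"
  proof -
    have "((\<lambda>s. (real (fst s) * ?band s - nm.gc_quad (V s)) + real ?p * ?band s
        + (nm.gc_quad (V s) - \<xi> (fst s) (snd s) \<bullet> (Q *v \<xi> (fst s) (snd s)))) \<longlongrightarrow> 0 + real ?p * 0 + 0) (in_prob M)"
      by (intro tendsto_add tendsto_mult tendsto_const D1 D3 band_lim)
    then have "((\<lambda>s. (real (fst s) * ?band s - nm.gc_quad (V s)) + real ?p * ?band s
        + (nm.gc_quad (V s) - \<xi> (fst s) (snd s) \<bullet> (Q *v \<xi> (fst s) (snd s)))) \<longlongrightarrow> 0) (in_prob M)" by simp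
    moreover have "\<forall>\<^sub>F s in in_prob M. (real (fst s) * ?band s - nm.gc_quad (V s)) + real ?p * ?band s
        + (nm.gc_quad (V s) - \<xi> (fst s) (snd s) \<bullet> (Q *v \<xi> (fst s) (snd s))) =
        real (fst s + ?p) * fhat (fst s + ?p) (snd s) - \<xi> (fst s) (snd s) \<bullet> (Q *v \<xi> (fst s) (snd s))"
      using params eventually_in_prob_space
    proof eventually_elim
      case (elim s)
      then have "fhat (fst s + ?p) (snd s) = ?band s"
        using fhat[of "snd s" "fst s + ?p"] by (simp add: Ah_def Sh_def)
      then show ?case by (simp add: algebra_simps)
    qed
    ultimately show ?thesis by (rule Lim_transform_eventually)
  qed
  have "weak_conv_m (\<lambda>n. distr M borel (\<lambda>\<omega>. real (n + ?p) * fhat (n + ?p) \<omega>)) (gen_chi2 Q B)"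
  proof (rule slutsky_weak_conv[OF _ _ limit real_distribution_gen_chi2])
    show "(\<lambda>\<omega>. real (n + ?p) * fhat (n + ?p) \<omega>) \<in> borel_measurable M" for n
      using fhat_meas[of "n + ?p"] by measurable
    show "(\<lambda>\<omega>. \<xi> n \<omega> \<bullet> (Q *v \<xi> n \<omega>)) \<in> borel_measurable M" for n by measurable
    show "((\<lambda>s. real (fst s + ?p) * fhat (fst s + ?p) (snd s) - \<xi> (fst s) (snd s) \<bullet> (Q *v \<xi> (fst s) (snd s))) \<longlongrightarrow> 0) (in_prob M)"
      by (rule diff_lim)
  qed
  then have "weak_conv_m (\<lambda>N. distr M borel (\<lambda>\<omega>. real N * fhat N \<omega>)) (gen_chi2 Q B)"
    by (rule weak_conv_m_offset[where \<mu> = "\<lambda>N. distr M borel (\<lambda>\<omega>. real N * fhat N \<omega>)" and k = ?p])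
  then show ?thesis unfolding Q_def B_def nm.gc_form_def .
qed

end
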